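(* In the cellular model described in the context, with $N(\lambda)=\zeta\lambda$ antennas per base station, beamwidth $B(N)=\beta/N$, and gain ratio $G_{\max}(N)/G_{\min}(N)=\alpha N$ (where $\alpha,\beta,\zeta>0$), consider the conditional signal-to-interference-plus-noise ratio ${\rm SINR}(\lambda)$ of the tagged user, i.e. the SINR given the network geometry and the channel gains. As $\lambda\to\infty$ it is finite and independent of $\lambda$. Specifically, $$\lim_{\lambda\to\infty}{\rm SINR}(\lambda)=\frac{L_0\,\tilde h}{\sum_{r_i\in\Psi}L(r_i)h_i+\frac{2\pi\gamma}{\alpha\zeta}},$$ where $\Psi$ is a Poisson point process with density $\frac{\beta}{2\pi\zeta}$ (the $r_i$ being the distances of its points from the origin) and $\gamma=\int_0^\infty rL(r)\,{\rm d}r$, which is finite for physically feasible path loss functions. The mean SINR satisfies $$\lim_{\lambda\to\infty}\mathbb{E}[{\rm SINR}(\lambda)]=\int_0^\infty L_0\exp\left(-\frac{2\pi\gamma t}{\alpha\zeta}-\frac{\beta}{\zeta}\int_0^\infty\mathbb{E}_h\left[1-e^{-t h L(r)}\right]r\,{\rm d}r\right){\rm d}t,$$ where $\mathbb{E}_h$ is the expectation over the small-scale fading $h$ of an interfering link whose beam points towards the tagged user (a generic $h_i$). This limit is finite and bounded: $$\frac{L_0\alpha\zeta}{\gamma(2\pi+\alpha\beta)}\le\lim_{\lambda\to\infty}\mathbb{E}[{\rm SINR}(\lambda)]\le\frac{L_0\alpha\zeta}{2\pi\gamma}.$$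
   Context: Model. Base stations (BSs) form a homogeneous Poisson point process on $\mathbb{R}^2$ of intensity $\lambda$. Users form an independent stationary point process of density $\lambda_u\gg\lambda$, so that every BS has users to serve and transmits continuously. The tagged user is at the origin and is served by its nearest BS, at distance $r_0$ (with density $2\pi\lambda r_0 e^{-\pi\lambda r_0^2}$); all other BSs are interferers. Each BS serves one user and has $N=N(\lambda)=\zeta\lambda$ antennas, $\zeta>0$; each user has a single omnidirectional antenna. Antenna pattern. The pattern of a BS with $N$ antennas is a step function with constant main-lobe gain $G_{\max}(N)$ over the beamwidth $B(N)$ (radians) and constant side-lobe gain $G_{\min}(N)$ elsewhere. Here $G_{\max}$ is non-decreasing with $\lim_{N\to\infty}G_{\max}(N)=\infty$, $G_{\max}(N)/G_{\min}(N)=\alpha N$ with $\alpha>0$, and $B(N)=\beta/N$ with $\beta>0$. Write $G_{\max}(\lambda)=G_{\max}(N(\lambda))$, and similarly for $G_{\min}$ and $B$. The serving BS points its main lobe at the tagged user. Each interferer points its beam uniformly at random, independently, so it has the tagged user in its main lobe with probability $B(\lambda)/(2\pi)$ and in its side lobe otherwise. Let $\tilde\Phi$ be the set of interferers having the tagged user in their main lobe, and $\bar\Phi$ the set of the remaining interferers. Path loss. The large-scale channel gain at distance $r$ is $L(r)$, where $L:\mathbb{R}_+\to\mathbb{R}_+$ is a physically feasible path loss function: the average received power is less than the (finite) transmit power, so there is no singularity at the origin; $L_0:=L(0)=\lim_{r\to0}L(r)\in(0,\infty)$ with $L(r)\le L_0$ for all $r$; and $\gamma=\int_0^\infty rL(r)\,{\rm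 d}r<\infty$. This class includes bounded single-slope, multi-slope and stretched exponential models, but not the power law $r^{-\eta}$. Fading. $\tilde h$, $(h_i)_{i\ge1}$ and $(g_i)_{i\ge1}$ are independent (non-negative) random variables with unit means, independent of the node locations. They represent the small-scale fading of the desired link, of interfering links with beams pointing towards the tagged user, and of interfering links with beams pointing away from it, respectively. They need not have identical distributions, and nothing else is assumed about their distributions. SINR. With noise power $\sigma^2$, $${\rm SINR}(\lambda)=\frac{L(r_0)\,G_{\max}(\lambda)\,\tilde h}{\sum_{r_i\in\tilde\Phi}G_{\max}(\lambda)L(r_i)h_i+\sum_{r_i\in\bar\Phi}G_{\min}(\lambda)L(r_i)g_i+\sigma^2},$$ where $r_i$ denotes the distance from the origin of the $i$-th point in the respective set.
   Formalization: Convergence of the mean SINR is claimed only if ln G_max(N)/N → 0 or L(r) ≥ exp(-c r²) for large r (it can fail otherwise); noise power is positive; the h_i share one law and the g_i share one law; the SINR limit is in distribution. *)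

theory Defs
  imports "HOL-Probability.Probability"
begin

text \<open>
  A point process on the plane is given by an enumeration \<open>X\<close> of its points: \<open>X n \<omega>\<close> is the
  \<open>n\<close>-th point, and the number of points in \<open>A\<close> is the number of indices \<open>n\<close> with \<open>X n \<omega> \<in> A\<close>.
  Since \<open>card\<close> of an infinite set is 0, local finiteness is a separate clause.
  The Poisson weights are written out because \<open>poisson_pmf\<close> is unspecified at rate 0, which
  occurs for null sets \<open>A\<close>.
\<close>

definition homogeneous_PPP ::
  "'a measure \<Rightarrow> real \<Rightarrow> (nat \<Rightarrow> 'a \<Rightarrow> real^2) \<Rightarrow> bool" where
  "homogeneous_PPP M \<rho> X \<longleftrightarrow>
     (\<forall>n. X n \<in> borel_measurable M) \<and>
     (\<forall>A \<in> sets borel. bounded A \<longrightarrow> (AE \<omega> in M. finite {n. X n \<omega> \<in> A})) \<and>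
     (\<forall>A \<in> sets borel. bounded A \<longrightarrow>
        (\<forall>k. measure M {\<omega> \<in> space M. card {n. X n \<omega> \<in> A} = k}
           = (\<rho> * measure lborel A) ^ k / fact k * exp (- (\<rho> * measure lborel A)))) \<and>
     (\<forall>\<A>. finite \<A> \<and> disjoint \<A> \<and> (\<forall>A \<in> \<A>. A \<in> sets borel \<and> bounded A) \<longrightarrow>
        prob_space.indep_vars M (\<lambda>_. count_space UNIV) (\<lambda>A \<omega>. card {n. X n \<omega> \<in> A}) \<A>)"

definition physically_feasible :: "(real \<Rightarrow> real) \<Rightarrow> bool" where
  "physically_feasible L \<longleftrightarrow>
     (\<forall>r\<ge>0. 0 \<le> L r \<and> L r \<le> L 0) \<and> 0 < L 0 \<and> (L \<longlongrightarrow> L 0) (at_right 0) \<and>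
     set_integrable lborel {0..} (\<lambda>r. r * L r)"

definition path_loss_moment :: "(real \<Rightarrow> real) \<Rightarrow> real" where
  "path_loss_moment L = (LBINT r:{0..}. r * L r)"

definition unit_mean_fading :: "'a measure \<Rightarrow> ('a \<Rightarrow> real) \<Rightarrow> bool" where
  "unit_mean_fading M f \<longleftrightarrow> (AE \<omega> in M. 0 \<le> f \<omega>) \<and> integrable M f \<and> integral\<^sup>L M f = 1"

definition identically_distributed :: "'a measure \<Rightarrow> (nat \<Rightarrow> 'a \<Rightarrow> real) \<Rightarrow> bool" where
  "identically_distributed M f \<longleftrightarrow> (\<forall>n. distr M borel (f n) = distr M borel (f 0))"

datatype link = Desired | Towards nat | Away nat

fun fading :: "('a \<Rightarrow> real) \<Rightarrow> (nat \<Rightarrow> 'a \<Rightarrow> real) \<Rightarrow> (nat \<Rightarrow> 'a \<Rightarrow> real) \<Rightarrow> link \<Rightarrow> 'a \<Rightarrow> real" where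
  "fading h0 h g Desired = h0"
| "fading h0 h g (Towards n) = h n"
| "fading h0 h g (Away n) = g n"

text \<open>The marks \<open>W\<close> are mutually independent, and jointly independent of the whole point process.\<close>

definition independent_marks ::
  "'a measure \<Rightarrow> (nat \<Rightarrow> 'a \<Rightarrow> real^2) \<Rightarrow> ('i \<Rightarrow> 'a \<Rightarrow> real) \<Rightarrow> bool" where
  "independent_marks M X W \<longleftrightarrow>
     prob_space.indep_vars M (\<lambda>_. borel) W UNIV \<and>
     prob_space.indep_set M
       (sets (vimage_algebra (space M) (\<lambda>\<omega> n. X n \<omega>) (Pi\<^sub>M UNIV (\<lambda>_. borel))))
       (sets (vimage_algebra (space M) (\<lambda>\<omega> i. W i \<omega>) (Pi\<^sub>M UNIV (\<lambda>_. borel))))"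

text \<open>
  The base stations form a Poisson process of intensity \<open>lam\<close>, and all of them transmit. The angle
  \<open>\<theta> n\<close> between the beam of the \<open>n\<close>-th base station and the direction from it to the tagged user
  at the origin is uniform; it is used only if that station is an interferer.
\<close>

definition cellular_network ::
  "'a measure \<Rightarrow> real \<Rightarrow> (nat \<Rightarrow> 'a \<Rightarrow> real^2) \<Rightarrow> (nat \<Rightarrow> 'a \<Rightarrow> real) \<Rightarrow>
   ('a \<Rightarrow> real) \<Rightarrow> (nat \<Rightarrow> 'a \<Rightarrow> real) \<Rightarrow> (nat \<Rightarrow> 'a \<Rightarrow> real) \<Rightarrow> bool" where
  "cellular_network M lam X \<theta> h0 h g \<longleftrightarrow>
     homogeneous_PPP M lam X \<and>
     (\<forall>n. distr M borel (\<theta> n) = uniform_measure lborel {-pi..pi}) \<and>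
     independent_marks M X (case_sum (fading h0 h g) \<theta>)"

definition nearest :: "(nat \<Rightarrow> real^2) \<Rightarrow> nat" where
  "nearest x = (LEAST n. \<forall>m. norm (x n) \<le> norm (x m))"

text \<open>
  The conditional SINR, as a function of the realised locations \<open>x\<close>, beam angles \<open>\<theta>\<close> and channel
  gains \<open>h0\<close>, \<open>h\<close>, \<open>g\<close>. The main lobe of width \<open>bw\<close> covers the user iff \<open>\<bar>\<theta> n\<bar> \<le> bw / 2\<close>.
  Values are in \<open>ennreal\<close> so that the interference is meaningful without a summability condition.
\<close>

definition main_lobe_interference ::
  "(real \<Rightarrow> real) \<Rightarrow> real \<Rightarrow> real \<Rightarrow> (nat \<Rightarrow> real^2) \<Rightarrow> (nat \<Rightarrow> real) \<Rightarrow> (nat \<Rightarrow> real) \<Rightarrow> ennreal" where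
  "main_lobe_interference L gmax bw x \<theta> h =
     (\<Sum>n. if n \<noteq> nearest x \<and> \<bar>\<theta> n\<bar> \<le> bw / 2 then ennreal (gmax * L (norm (x n)) * h n) else 0)"

definition side_lobe_interference ::
  "(real \<Rightarrow> real) \<Rightarrow> real \<Rightarrow> real \<Rightarrow> (nat \<Rightarrow> real^2) \<Rightarrow> (nat \<Rightarrow> real) \<Rightarrow> (nat \<Rightarrow> real) \<Rightarrow> ennreal" where
  "side_lobe_interference L gmin bw x \<theta> g =
     (\<Sum>n. if n \<noteq> nearest x \<and> \<not> \<bar>\<theta> n\<bar> \<le> bw / 2 then ennreal (gmin * L (norm (x n)) * g n) else 0)"

definition SINR ::
  "(real \<Rightarrow> real) \<Rightarrow> real \<Rightarrow> real \<Rightarrow> real \<Rightarrow> real \<Rightarrow>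
   (nat \<Rightarrow> real^2) \<Rightarrow> (nat \<Rightarrow> real) \<Rightarrow> real \<Rightarrow> (nat \<Rightarrow> real) \<Rightarrow> (nat \<Rightarrow> real) \<Rightarrow> ennreal" where
  "SINR L gmax gmin bw \<sigma> x \<theta> h0 h g =
     ennreal (L (norm (x (nearest x))) * gmax * h0) /
     (main_lobe_interference L gmax bw x \<theta> h + side_lobe_interference L gmin bw x \<theta> g
      + ennreal (\<sigma>\<^sup>2))"

definition limit_SINR ::
  "(real \<Rightarrow> real) \<Rightarrow> real \<Rightarrow> real \<Rightarrow> (nat \<Rightarrow> real^2) \<Rightarrow> real \<Rightarrow> (nat \<Rightarrow> real) \<Rightarrow> ennreal" where
  "limit_SINR L \<alpha> \<zeta> y h0 h =
     ennreal (L 0 * h0) /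
     ((\<Sum>n. ennreal (L (norm (y n)) * h n)) + ennreal (2 * pi * path_loss_moment L / (\<alpha> * \<zeta>)))"

text \<open>
  Either the gain grows subexponentially in the number of antennas, or the path loss decays at most
  like a Gaussian. Convergence of the mean SINR needs a condition of this kind: with \<open>L\<close> the
  indicator of \<open>[0,1]\<close>, the tagged user has no interferer within distance 1, but a server there,
  with probability \<open>pi * lam * exp (- pi * lam)\<close>, and then its SINR is \<open>gmax * h0 / \<sigma>\<^sup>2\<close>; for
  \<open>gmax = exp (N\<^sup>2)\<close> the mean SINR diverges.
\<close>

definition gain_tail_condition :: "(real \<Rightarrow> real) \<Rightarrow> (real \<Rightarrow> real) \<Rightarrow> bool" where
  "gain_tail_condition Gmax L \<longleftrightarrow>
     ((\<lambda>N. ln (Gmax N) / N) \<longlongrightarrow> 0) at_top \<or>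
     (\<exists>c>0. \<exists>R. \<forall>r\<ge>R. exp (- c * r\<^sup>2) \<le> L r)"

definition mean_SINR_limit :: "'a measure \<Rightarrow> (real \<Rightarrow> real) \<Rightarrow> real \<Rightarrow> real \<Rightarrow> real \<Rightarrow> ('a \<Rightarrow> real) \<Rightarrow> real" where
  "mean_SINR_limit M L \<alpha> \<beta> \<zeta> h =
     (LBINT t:{0..}. L 0 * exp (- (2 * pi * path_loss_moment L * t / (\<alpha> * \<zeta>))
        - \<beta> / \<zeta> * (LBINT r:{0..}. (\<integral>\<omega>. 1 - exp (- (t * h \<omega> * L r)) \<partial>M) * r)))"

end

theory Submission
  imports Defs "HOL-Real_Asymp.Real_Asymp"
begin

text \<open>
  Divide interference and noise by the main-lobe gain and by \<open>L r\<^sub>0 / L 0\<close>, where \<open>r\<^sub>0\<close> is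
  the distance to the serving station; call the result the load, so that the SINR is
  \<open>L 0 * h0 / load\<close>, with \<open>h0\<close> independent of the load. Conditionally on the locations, the Laplace
  transform of the interference is a product over the stations, so that the Laplace functional of the
  Poisson process evaluates it in closed form, once the serving station is included as well. Its
  inclusion, and the factor \<open>L r\<^sub>0 / L 0\<close>, do not matter in the limit. The Laplace transform of the
  load therefore converges to that of the limiting load: the main lobes have constant intensity
  \<open>\<beta> / (2 * pi * \<zeta>)\<close>, while the many weak side lobes average out to the constant
  \<open>2 * pi * \<gamma> / (\<alpha> * \<zeta>)\<close>.

  Convergence in distribution follows since the values of the Laplace transform at the naturals are the moments
  of \<open>exp (- load) \<in> [0, 1]\<close>. The mean SINR is \<open>L 0\<close> times the integral over \<open>t \<ge> 0\<close> of
  the Laplace transform of the load. Dominated convergence applies on \<open>[0, C * lam]\<close>, and the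
  hypothesis on gain and path loss is what makes the integral over \<open>[C * lam, \<infinity>)\<close> vanish.
\<close>

section \<open>The function exp (- x) on the extended half-line\<close>

text \<open>The interference may be infinite and the serving station may have attenuation 0; the
  load is then \<open>\<top>\<close>. Working in \<open>ennreal\<close>, with \<open>nexp\<close>
  equal to 0 there (where \<open>enn2real\<close> alone would give exp 0 = 1), spares all
  summability conditions.

  Without the serving station the process is no longer Poisson. That station is determined by the
  locations alone, however, so given these its omission removes one factor \<phi>. At fixed t this
  factor tends to 1. For t of order \<open>lam\<close> and beyond it does not, and there the terms
  are truncated so that \<phi> stays away from 0.

  The fading laws are known only through their unit mean. From above this gives 1 - E exp (- s f)
  \<le> s, from below a positive probability of f \<ge> 1/2.

  The tail in t is delicate because for compactly supported L there is no interference at all with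
  probability exp (- c \<open>lam\<close>), so the transform of the interference does not tend to 0
  in t. Then only the noise makes the integral finite, at the price of a factor of the order of the
  gain. If L is bounded below by a Gaussian, the area that matters grows like ln t and the transform
  decays like a power of t with exponent proportional to \<open>lam\<close>.\<close>

definition nexp :: "ennreal \<Rightarrow> real" where
  "nexp x = (if x = \<top> then 0 else exp (- enn2real x))"

text \<open>Inverse of \<open>nexp\<close> on [0, 1]. It turns the factor that a station contributes
  to a conditional expectation back into a summand, so that an infinite product of such factors
  becomes a sum over points, to which the Laplace functional applies.\<close>

definition nlog :: "real \<Rightarrow> ennreal" where
  "nlog p = (if p \<le> 0 then \<top> else ennreal (- ln p))"

lemma nexp_0 [simp]: "nexp 0 = 1"
  by (simp add: nexp_def)

lemma nexp_top [simp]: "nexp \<top> = 0"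
  by (simp add: nexp_def)

lemma nexp_ennreal: "0 \<le> x \<Longrightarrow> nexp (ennreal x) = exp (- x)"
  by (simp add: nexp_def)

lemma nexp_nonneg [simp]: "0 \<le> nexp x"
  by (simp add: nexp_def)

lemma nexp_le_1 [simp]: "nexp x \<le> 1"
  by (simp add: nexp_def)

lemma nexp_add: "nexp (x + y) = nexp x * nexp y"
  by (cases x; cases y) (auto simp: nexp_ennreal exp_add[symmetric] simp flip: ennreal_plus)

lemma nexp_mono: "x \<le> y \<Longrightarrow> nexp y \<le> nexp x"
  by (cases x; cases y) (auto simp: nexp_ennreal top_unique)

lemma nexp_sum: "finite A \<Longrightarrow> nexp (\<Sum>i\<in>A. f i) = (\<Prod>i\<in>A. nexp (f i))"
  by (induction A rule: finite_induct) (auto simp: nexp_add)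

lemma nexp_nlog: "0 \<le> p \<Longrightarrow> p \<le> 1 \<Longrightarrow> nexp (nlog p) = p"
  by (auto simp: nlog_def nexp_ennreal)

lemma nlog_1 [simp]: "nlog 1 = 0"
  by (simp add: nlog_def)

lemma measurable_nexp [measurable]: "nexp \<in> borel_measurable borel"
  unfolding nexp_def[abs_def] by measurable

lemma measurable_nlog [measurable]: "nlog \<in> borel_measurable borel"
  unfolding nlog_def[abs_def] by measurable

lemma tendsto_nexp:
  assumes "(f \<longlongrightarrow> x) F"
  shows "((\<lambda>k. nexp (f k)) \<longlongrightarrow> nexp x) F"
proof (cases "x = \<top>")
  case True
  show ?thesis unfolding True nexp_top
  proof (rule order_tendstoI)
    fix e :: real assume "e < 0"
    then show "\<forall>\<^sub>F k in F. e < nexp (f k)"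
      by (intro always_eventually allI) (metis nexp_nonneg less_le_trans)
  next
    fix e :: real assume e: "0 < e"
    \<comment> \<open>The threshold makes the final bound e / exp 1 < e; the maximum with 0 provides
      the nonnegative argument that \<open>nexp_ennreal\<close> asks for.\<close>
    have "\<forall>\<^sub>F k in F. ennreal (max 0 (1 - ln e)) < f k"
      using assms True by (auto simp: order_tendsto_iff)
    then show "\<forall>\<^sub>F k in F. nexp (f k) < e"
    proof eventually_elim
      case (elim k)
      have "nexp (f k) \<le> nexp (ennreal (max 0 (1 - ln e)))"
        using elim by (intro nexp_mono) auto
      also have "\<dots> = exp (- max 0 (1 - ln e))" by (subst nexp_ennreal) simp_all
      also have "\<dots> \<le> exp (- (1 - ln e))" by simp
      also have "\<dots> < exp (ln e)" by (subst exp_less_cancel_iff) simp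
      also have "\<dots> = e" using e by simp
      finally show ?case .
    qed
  qed
next
  case False
  then obtain r where r: "x = ennreal r" "0 \<le> r" by (cases x) auto
  have "\<forall>\<^sub>F k in F. f k < \<top>"
    using assms False by (metis order_tendstoD(2) top.not_eq_extremum)
  then have *: "\<forall>\<^sub>F k in F. exp (- enn2real (f k)) = nexp (f k)"
    by eventually_elim (auto simp: nexp_def)
  have "((\<lambda>k. exp (- enn2real (f k))) \<longlongrightarrow> exp (- r)) F"
    using assms r by (intro tendsto_intros) auto
  then have "((\<lambda>k. nexp (f k)) \<longlongrightarrow> exp (- r)) F"
    using * by (rule Lim_transform_eventually)
  then show ?thesis using r by (simp add: nexp_ennreal)
qed

text \<open>Sums in \<open>ennreal\<close> always converge, so continuity of \<open>nexp\<close>, at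
  \<open>\<top>\<close> included, also covers infinite products that tend to 0.\<close>

lemma prod_nexp_tendsto: "(\<lambda>k. \<Prod>n<k. nexp (f n)) \<longlonglongrightarrow> nexp (\<Sum>n. f n)"
proof -
  have "(\<lambda>k. \<Sum>n<k. f n) \<longlonglongrightarrow> (\<Sum>n. f n)"
    using summable_LIMSEQ[of f] by simp
  from tendsto_nexp[OF this] show ?thesis by (simp add: nexp_sum)
qed

lemma nexp_divide_le: "0 \<le> w \<Longrightarrow> w \<le> 1 \<Longrightarrow> nexp (x / ennreal w) \<le> nexp x"
proof (intro nexp_mono)
  assume w: "0 \<le> w" "w \<le> 1"
  show "x \<le> x / ennreal w"
  proof (cases "w = 0")
    \<comment> \<open>Division by 0 gives \<open>\<top>\<close>, except that 0 / 0 = 0.\<close>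
    case True then show ?thesis by (cases "x = 0") auto
  next
    case False
    have "x * 1 \<le> x * ennreal (inverse w)"
      using w False by (intro mult_left_mono) (auto simp: one_le_inverse)
    moreover have "x / ennreal w = x * ennreal (inverse w)"
      using w False by (simp add: divide_ennreal_def inverse_ennreal)
    ultimately show ?thesis by simp
  qed
qed

text \<open>Convexity of \<open>exp\<close>: \<open>exp (- w y) \<le> (1 - w) + w exp (- y)\<close>.\<close>

lemma nexp_diff_divide_le:
  assumes w: "0 \<le> w" "w \<le> 1" and x: "0 < x"
  shows "nexp x - nexp (x / ennreal w) \<le> 1 - w"
proof (cases "w = 0 \<or> x = \<top>")
  case True
  then show ?thesis
  proof
    assume "w = 0" then show ?thesis using x by (simp add: ennreal_divide_zero)
  next
    assume "x = \<top>" then show ?thesis using w by (simp add: ennreal_top_divide)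
  qed
next
  case False
  then obtain r where r: "x = ennreal r" "0 \<le> r" by (cases x) auto
  from False w have w0: "0 < w" by auto
  define y where "y = r / w"
  have y: "0 \<le> y" "r = w * y" using r w0 by (auto simp: y_def)
  have "x / ennreal w = ennreal y"
    using r w0 by (simp add: y_def divide_ennreal)
  then have "nexp (x / ennreal w) = exp (- y)" using y by (simp add: nexp_ennreal)
  moreover have "exp (- r) \<le> (1 - w) + w * exp (- y)"
  proof -
    have "exp ((1 - w) *\<^sub>R 0 + w *\<^sub>R (- y)) \<le> (1 - w) * exp 0 + w * exp (- y)"
      using convex_onD[OF exp_convex, of w 0 "- y"] w by simp
    then show ?thesis using y by simp
  qed
  moreover have "w * exp (- y) \<le> exp (- y)" using w by (simp add: mult_left_le_one_le)
  moreover have "nexp x = exp (- r)" using r by (simp add: nexp_ennreal)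
  ultimately show ?thesis by linarith
qed

lemma nn_integral_exp_atLeast_0:
  assumes c: "0 < c"
  shows "(\<integral>\<^sup>+t\<in>{0..}. ennreal (exp (- (c * t))) \<partial>lborel) = ennreal (1 / c)"
proof -
  have "(\<integral>\<^sup>+t. ennreal (exp (- (c * t))) * indicator {0..} t \<partial>lborel) = ennreal (0 - - (exp (- (c * 0)) / c))"
  proof (rule nn_integral_FTC_atLeast)
    fix x :: real assume "0 \<le> x"
    show "((\<lambda>t. - (exp (- (c * t)) / c)) has_real_derivative exp (- (c * x))) (at x)"
      using c by (auto intro!: derivative_eq_intros)
  next
    have "((\<lambda>t. exp (- (c * t))) \<longlongrightarrow> 0) at_top"
      using c by real_asymp
    then show "((\<lambda>t. - (exp (- (c * t)) / c)) \<longlongrightarrow> 0) at_top"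
      using tendsto_minus[OF tendsto_divide[OF _ tendsto_const, of _ 0 at_top c]] c by fastforce
  qed auto
  then show ?thesis by simp
qed

text \<open>The identity 1 / x = integral of exp (- t x), valid at 0 and \<open>\<top>\<close> too.
  It expresses the mean of a reciprocal through a Laplace transform.\<close>

lemma nn_integral_nexp_mult:
  "(\<integral>\<^sup>+t\<in>{0..}. ennreal (nexp (ennreal t * x)) \<partial>lborel) = inverse x"
proof (cases x)
  case top
  have "(\<integral>\<^sup>+t\<in>{0..}. ennreal (nexp (ennreal t * x)) \<partial>lborel) = (\<integral>\<^sup>+t. 0 \<partial>(lborel :: real measure))"
  proof (rule nn_integral_cong_AE)
    \<comment> \<open>At t = 0 the product with \<open>\<top>\<close> is 0 and the integrand is 1,
      but this is a single point.\<close>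
    have "AE t in lborel. t \<noteq> (0::real)" by (rule AE_lborel_singleton)
    then show "AE t in lborel. ennreal (nexp (ennreal t * x)) * indicator {0..} t = 0"
      by eventually_elim (auto simp: top ennreal_mult_top split: split_indicator)
  qed
  then show ?thesis by (simp add: top)
next
  case (real r)
  show ?thesis
  proof (cases "r = 0")
    case True
    have "ennreal (real n) \<le> emeasure lborel {0::real..}" for n
      using emeasure_mono[of "{0..real n}" "{0..}" lborel] by auto
    then have "emeasure lborel {0::real..} = \<top>"
      by (metis ennreal_Ex_less_of_nat ennreal_of_nat_eq_real_of_nat leD less_top)
    then show ?thesis using real True by simp
  next
    case False
    have "(\<integral>\<^sup>+t\<in>{0..}. ennreal (nexp (ennreal t * x)) \<partial>lborel) = (\<integral>\<^sup>+t\<in>{0..}. ennreal (exp (- (r * t))) \<partial>lborel)"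
      using real by (intro nn_integral_cong) (auto simp: nexp_ennreal mult.commute simp flip: ennreal_mult split: split_indicator)
    then show ?thesis using real False nn_integral_exp_atLeast_0[of r]
      by (simp add: inverse_ennreal divide_inverse)
  qed
qed

section \<open>Laplace functional of a Poisson process\<close>

context prob_space
begin

lemma integrable_nexp [simp]:
  assumes [measurable]: "f \<in> borel_measurable M"
  shows "integrable M (\<lambda>\<omega>. nexp (f \<omega>))"
  by (rule integrable_const_bound[where B = 1]) auto

lemma PPP_measurable: "homogeneous_PPP M \<rho> X \<Longrightarrow> X n \<in> borel_measurable M"
  by (simp add: homogeneous_PPP_def)

lemma PPP_indep_counts:
  assumes "homogeneous_PPP M \<rho> X" "finite \<A>" "disjoint \<A>" "\<And>A. A \<in> \<A> \<Longrightarrow> A \<in> sets borel \<and> bounded A"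
  shows "indep_vars (\<lambda>_. count_space UNIV) (\<lambda>A \<omega>. card {n. X n \<omega> \<in> A}) \<A>"
  using assms unfolding homogeneous_PPP_def by blast

lemma PPP_count_measurable:
  assumes "homogeneous_PPP M \<rho> X" "A \<in> sets borel" "bounded A"
  shows "(\<lambda>\<omega>. card {n. X n \<omega> \<in> A}) \<in> measurable M (count_space UNIV)"
proof -
  have "indep_vars (\<lambda>_. count_space UNIV) (\<lambda>A \<omega>. card {n. X n \<omega> \<in> A}) {A}"
    using assms by (intro PPP_indep_counts) (auto simp: disjoint_def)
  then show ?thesis by (auto simp: indep_vars_def)
qed

lemma PPP_void_probability:
  assumes "homogeneous_PPP M \<rho> X" "A \<in> sets borel" "bounded A"
  shows "prob {\<omega> \<in> space M. card {n. X n \<omega> \<in> A} = 0} = exp (- (\<rho> * measure lborel A))"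
proof -
  have "prob {\<omega> \<in> space M. card {n. X n \<omega> \<in> A} = 0} = (\<rho> * measure lborel A) ^ 0 / fact 0 * exp (- (\<rho> * measure lborel A))"
    using assms unfolding homogeneous_PPP_def by blast
  then show ?thesis by simp
qed

text \<open>Expanding over the values of the count leaves an exponential series, as for the
  generating function of any Poisson variable.\<close>

lemma PPP_count_laplace:
  assumes ppp: "homogeneous_PPP M \<rho> X" and \<rho>: "0 \<le> \<rho>" and A: "A \<in> sets borel" "bounded A"
  shows "(\<integral>\<^sup>+\<omega>. ennreal (exp (- (c * real (card {n. X n \<omega> \<in> A})))) \<partial>M)
       = ennreal (exp (- (\<rho> * measure lborel A * (1 - exp (- c)))))"
proof -
  define N where "N \<omega> = card {n. X n \<omega> \<in> A}" for \<omega>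
  define \<mu> where "\<mu> = \<rho> * measure lborel A"
  have \<mu>: "0 \<le> \<mu>" using \<rho> by (simp add: \<mu>_def)
  have [measurable]: "N \<in> measurable M (count_space UNIV)"
    unfolding N_def[abs_def] by (rule PPP_count_measurable[OF ppp A])
  have P: "measure M {\<omega> \<in> space M. N \<omega> = k} = \<mu> ^ k / fact k * exp (- \<mu>)" for k
    using ppp A unfolding homogeneous_PPP_def N_def \<mu>_def by blast
  have "(\<integral>\<^sup>+\<omega>. ennreal (exp (- (c * real (N \<omega>)))) \<partial>M)
      = (\<integral>\<^sup>+\<omega>. (\<Sum>k. ennreal (exp (- (c * real k))) * indicator {\<omega> \<in> space M. N \<omega> = k} \<omega>) \<partial>M)"
  proof (rule nn_integral_cong)
    fix \<omega> assume "\<omega> \<in> space M"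
    then show "ennreal (exp (- (c * real (N \<omega>)))) = (\<Sum>k. ennreal (exp (- (c * real k))) * indicator {\<omega> \<in> space M. N \<omega> = k} \<omega>)"
      by (subst suminf_finite[where N = "{N \<omega>}"]) auto
  qed
  also have "\<dots> = (\<Sum>k. ennreal (exp (- (c * real k))) * emeasure M {\<omega> \<in> space M. N \<omega> = k})"
    by (subst nn_integral_suminf) (auto intro!: suminf_cong nn_integral_cmult_indicator)
  also have "\<dots> = (\<Sum>k. ennreal ((\<mu> * exp (- c)) ^ k / fact k * exp (- \<mu>)))"
    using \<mu> by (intro suminf_cong)
      (simp add: emeasure_eq_measure P ennreal_mult[symmetric] power_mult_distrib exp_of_nat_mult[symmetric] mult_ac)
  also have "\<dots> = ennreal (exp (\<mu> * exp (- c)) * exp (- \<mu>))"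
  proof (intro suminf_ennreal_eq)
    show "(\<lambda>k. (\<mu> * exp (- c)) ^ k / fact k * exp (- \<mu>)) sums (exp (\<mu> * exp (- c)) * exp (- \<mu>))"
      using exp_converges[of "\<mu> * exp (- c)"] by (intro sums_mult2) (simp add: divide_inverse mult.commute)
  qed (use \<mu> in auto)
  also have "exp (\<mu> * exp (- c)) * exp (- \<mu>) = exp (- (\<mu> * (1 - exp (- c))))"
    by (simp add: exp_add[symmetric] algebra_simps)
  finally show ?thesis by (simp add: N_def \<mu>_def)
qed

text \<open>The level sets of v at nonzero values are disjoint and bounded, so the sum over points
  is a linear combination of independent Poisson counts and the expectation factorises.\<close>

lemma PPP_laplace_simple:
  fixes v :: "real^2 \<Rightarrow> ennreal"
  assumes ppp: "homogeneous_PPP M \<rho> X" and \<rho>: "0 \<le> \<rho>"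
    and v: "simple_function borel v" "\<And>x. v x < \<top>" "bounded {x. v x \<noteq> 0}"
  shows "expectation (\<lambda>\<omega>. nexp (\<Sum>n. v (X n \<omega>)))
       = nexp (ennreal \<rho> * (\<integral>\<^sup>+x. ennreal (1 - nexp (v x)) \<partial>lborel))"
proof -
  note [measurable] = PPP_measurable[OF ppp]
  have [measurable]: "v \<in> borel_measurable borel"
    using v(1) by (rule borel_measurable_simple_function)
  define V where "V = range v - {0}"
  define A where "A c = v -` {c}" for c
  have finV: "finite V" using v(1) by (simp add: V_def simple_function_def)
  have Vtop: "c < \<top>" "c \<noteq> 0" if "c \<in> V" for c using that v(2) by (auto simp: V_def)
  have Ab [measurable]: "A c \<in> sets borel" for c using simple_functionD(2)[OF v(1), of "{c}"] by (simp add: A_def)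
  have Abd: "bounded (A c)" if "c \<in> V" for c
    using Vtop[OF that] by (intro bounded_subset[OF v(3)]) (auto simp: A_def)
  have injA: "inj_on A V"
    by (rule inj_onI) (auto simp: A_def V_def)
  define N where "N c \<omega> = card {n. X n \<omega> \<in> A c}" for c \<omega>
  \<comment> \<open>Indexed by the set and not by the value, because independence of the counts is
    stated for families indexed by the sets themselves; \<open>inv_into\<close> recovers the value
    from its level set.\<close>
  let ?e = "\<lambda>S \<omega>. ennreal (exp (- (enn2real (inv_into V A S) * real (card {n. X n \<omega> \<in> S}))))"
  \<comment> \<open>On an infinite level set \<open>card\<close> would report 0, while the sum over
    points is \<open>\<top>\<close>.\<close>
  have fin: "AE \<omega> in M. \<forall>c\<in>V. finite {n. X n \<omega> \<in> A c}"
  proof (intro AE_finite_allI finV)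
    show "AE \<omega> in M. finite {n. X n \<omega> \<in> A c}" if "c \<in> V" for c
      using ppp Ab[of c] Abd[OF that] unfolding homogeneous_PPP_def by blast
  qed
  \<comment> \<open>\<open>V\<close> leaves out the value 0, hence F 0 = 0. Used below for the
    identity and for 1 - \<open>nexp\<close>.\<close>
  have decomp: "F (v x) = (\<Sum>c\<in>V. F c * indicator (A c) x)" if "F 0 = 0" for F :: "ennreal \<Rightarrow> ennreal" and x
  proof (cases "v x = 0")
    case True
    then show ?thesis using that by (auto simp: A_def V_def indicator_def intro!: sum.neutral)
  next
    case False
    then have "(\<Sum>c\<in>V. F c * indicator (A c) x) = (\<Sum>c\<in>V. if c = v x then F c else 0)"
      by (intro sum.cong) (auto simp: A_def indicator_def)
    also have "\<dots> = F (v x)" using False finV by (simp add: V_def)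
    finally show ?thesis by simp
  qed
  have "AE \<omega> in M. nexp (\<Sum>n. v (X n \<omega>)) = (\<Prod>c\<in>V. exp (- (enn2real c * real (N c \<omega>))))"
    using fin
  proof eventually_elim
    case (elim \<omega>)
    have "(\<Sum>n. v (X n \<omega>)) = (\<Sum>n. \<Sum>c\<in>V. c * indicator (A c) (X n \<omega>))"
      by (subst decomp[of "\<lambda>c. c"]) simp_all
    also have "\<dots> = (\<Sum>c\<in>V. \<Sum>n. c * indicator (A c) (X n \<omega>))"
      by (intro suminf_sum) simp
    also have "\<dots> = (\<Sum>c\<in>V. c * ennreal (real (N c \<omega>)))"
    proof (intro sum.cong refl)
      fix c assume c: "c \<in> V"
      have "(\<Sum>n. indicator (A c) (X n \<omega>) :: ennreal) = (\<Sum>n\<in>{n. X n \<omega> \<in> A c}. 1)"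
        using elim c by (subst suminf_finite[where N = "{n. X n \<omega> \<in> A c}"]) auto
      then show "(\<Sum>n. c * indicator (A c) (X n \<omega>)) = c * ennreal (real (N c \<omega>))"
        by (simp add: N_def ennreal_of_nat_eq_real_of_nat)
    qed
    finally have "nexp (\<Sum>n. v (X n \<omega>)) = (\<Prod>c\<in>V. nexp (c * ennreal (real (N c \<omega>))))"
      using finV by (simp add: nexp_sum)
    also have "\<dots> = (\<Prod>c\<in>V. exp (- (enn2real c * real (N c \<omega>))))"
    proof (intro prod.cong refl)
      fix c assume "c \<in> V"
      then obtain r where "c = ennreal r" "0 \<le> r" using Vtop by (cases c) auto
      then show "nexp (c * ennreal (real (N c \<omega>))) = exp (- (enn2real c * real (N c \<omega>)))"
        by (simp add: nexp_ennreal flip: ennreal_mult)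
    qed
    finally show ?case .
  qed
  then have "(\<integral>\<^sup>+\<omega>. ennreal (nexp (\<Sum>n. v (X n \<omega>))) \<partial>M)
      = (\<integral>\<^sup>+\<omega>. (\<Prod>c\<in>V. ennreal (exp (- (enn2real c * real (N c \<omega>))))) \<partial>M)"
    by (intro nn_integral_cong_AE) (auto simp: prod_ennreal)
  also have "\<dots> = (\<integral>\<^sup>+\<omega>. (\<Prod>S\<in>A ` V. ?e S \<omega>) \<partial>M)"
    using injA by (simp add: prod.reindex N_def)
  also have "\<dots> = (\<Prod>S\<in>A ` V. \<integral>\<^sup>+\<omega>. ?e S \<omega> \<partial>M)"
  proof (rule indep_vars_nn_integral)
    have "indep_vars (\<lambda>_. count_space UNIV) (\<lambda>A \<omega>. card {n. X n \<omega> \<in> A}) (A ` V)"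
    proof (rule PPP_indep_counts[OF ppp])
      show "disjoint (A ` V)" by (auto simp: disjoint_def A_def)
    qed (use finV Ab Abd in auto)
    from indep_vars_compose2[OF this, of "\<lambda>S k. ennreal (exp (- (enn2real (inv_into V A S) * real k)))" "\<lambda>_. borel"]
    show "indep_vars (\<lambda>_. borel) (\<lambda>S \<omega>. ?e S \<omega>) (A ` V)"
      by simp
  qed (use finV in auto)
  also have "\<dots> = (\<Prod>c\<in>V. \<integral>\<^sup>+\<omega>. ennreal (exp (- (enn2real c * real (card {n. X n \<omega> \<in> A c})))) \<partial>M)"
    using injA by (simp add: prod.reindex)
  also have "\<dots> = (\<Prod>c\<in>V. ennreal (exp (- (\<rho> * measure lborel (A c) * (1 - exp (- enn2real c))))))"
    by (intro prod.cong refl PPP_count_laplace[OF ppp \<rho>] Ab Abd)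
  also have "\<dots> = ennreal (\<Prod>c\<in>V. nexp (ennreal (\<rho> * measure lborel (A c) * (1 - exp (- enn2real c)))))"
    using \<rho> by (subst prod_ennreal) (auto intro!: arg_cong[where f = ennreal] prod.cong simp: nexp_ennreal)
  also have "(\<Prod>c\<in>V. nexp (ennreal (\<rho> * measure lborel (A c) * (1 - exp (- enn2real c)))))
      = nexp (\<Sum>c\<in>V. ennreal (\<rho> * measure lborel (A c) * (1 - exp (- enn2real c))))"
    using finV by (simp add: nexp_sum)
  also have "(\<Sum>c\<in>V. ennreal (\<rho> * measure lborel (A c) * (1 - exp (- enn2real c))))
      = ennreal \<rho> * (\<Sum>c\<in>V. ennreal (1 - nexp c) * emeasure lborel (A c))"
  proof (subst sum_distrib_left, intro sum.cong refl)
    fix c assume c: "c \<in> V"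
    have "emeasure lborel (A c) = ennreal (measure lborel (A c))"
      using emeasure_bounded_finite[OF Abd[OF c]] by (simp add: emeasure_eq_ennreal_measure)
    moreover have "nexp c = exp (- enn2real c)" using Vtop[OF c] by (simp add: nexp_def)
    ultimately show "ennreal (\<rho> * measure lborel (A c) * (1 - exp (- enn2real c))) = ennreal \<rho> * (ennreal (1 - nexp c) * emeasure lborel (A c))"
      using \<rho> by (simp add: mult_ac flip: ennreal_mult)
  qed
  also have "(\<Sum>c\<in>V. ennreal (1 - nexp c) * emeasure lborel (A c)) = (\<integral>\<^sup>+x. ennreal (1 - nexp (v x)) \<partial>lborel)"
    by (subst decomp[of "\<lambda>c. ennreal (1 - nexp c)"]) (simp_all add: nn_integral_sum nn_integral_cmult_indicator)
  finally have *: "(\<integral>\<^sup>+\<omega>. ennreal (nexp (\<Sum>n. v (X n \<omega>))) \<partial>M) = ennreal (nexp (ennreal \<rho> * (\<integral>\<^sup>+x. ennreal (1 - nexp (v x)) \<partial>lborel)))" .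
  show ?thesis
    using * by (subst integral_eq_nn_integral) auto
qed

theorem PPP_laplace:
  fixes v :: "real^2 \<Rightarrow> ennreal"
  assumes ppp: "homogeneous_PPP M \<rho> X" and \<rho>: "0 \<le> \<rho>" and [measurable]: "v \<in> borel_measurable borel"
  shows "expectation (\<lambda>\<omega>. nexp (\<Sum>n. v (X n \<omega>)))
       = nexp (ennreal \<rho> * (\<integral>\<^sup>+x. ennreal (1 - nexp (v x)) \<partial>lborel))"
proof -
  note [measurable] = PPP_measurable[OF ppp]
  obtain U where U: "\<And>i. simple_function borel (U i)" "incseq U" "\<And>i x. U i x < \<top>" "\<And>x. (SUP i. U i x) = v x"
    using borel_measurable_implies_simple_function_sequence'[of v borel] by auto
  \<comment> \<open>Restriction to growing balls gives the bounded support of the simple case and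
    keeps the sequence increasing.\<close>
  define u where "u i x = U i x * indicator (cball 0 (real i)) x" for i x
  have us: "simple_function borel (u i)" for i
    unfolding u_def[abs_def] using U(1) by (intro simple_function_mult simple_function_indicator) auto
  have [measurable]: "u i \<in> borel_measurable borel" for i
    using us by (rule borel_measurable_simple_function)
  have inc: "incseq (\<lambda>i. u i x)" for x
    using U(2) unfolding u_def by (intro incseq_SucI mult_mono) (auto simp: incseq_Suc_iff le_fun_def split: split_indicator)
  have lim: "(\<lambda>i. u i x) \<longlonglongrightarrow> v x" for x
  proof -
    have "(\<lambda>i. U i x) \<longlonglongrightarrow> v x"
      using U(2) unfolding U(4)[symmetric] by (intro LIMSEQ_SUP) (auto simp: incseq_def le_fun_def)
    moreover have "\<forall>\<^sub>F i in sequentially. norm x \<le> real i"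
      using filterlim_real_sequentially by (simp add: filterlim_at_top)
    then have "\<forall>\<^sub>F i in sequentially. U i x = u i x"
      by eventually_elim (simp add: u_def)
    ultimately show ?thesis by (rule Lim_transform_eventually)
  qed
  have sup: "(SUP i. u i x) = v x" for x
    using LIMSEQ_unique[OF LIMSEQ_SUP[OF inc] lim] .
  have "(\<lambda>i. expectation (\<lambda>\<omega>. nexp (\<Sum>n. u i (X n \<omega>)))) \<longlonglongrightarrow> expectation (\<lambda>\<omega>. nexp (\<Sum>n. v (X n \<omega>)))"
  proof (rule integral_dominated_convergence[where w = "\<lambda>_. 1"])
    show "AE \<omega> in M. (\<lambda>i. nexp (\<Sum>n. u i (X n \<omega>))) \<longlonglongrightarrow> nexp (\<Sum>n. v (X n \<omega>))"
    proof (rule AE_I2, rule tendsto_nexp)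
      fix \<omega>
      have "(\<Sum>n. v (X n \<omega>)) = (SUP i. \<Sum>n. u i (X n \<omega>))"
        by (subst ennreal_suminf_SUP_eq[symmetric]) (auto simp: sup inc)
      moreover have "incseq (\<lambda>i. \<Sum>n. u i (X n \<omega>))"
        using inc by (intro incseq_SucI suminf_le) (auto simp: incseq_Suc_iff)
      ultimately show "(\<lambda>i. \<Sum>n. u i (X n \<omega>)) \<longlonglongrightarrow> (\<Sum>n. v (X n \<omega>))"
        using LIMSEQ_SUP by metis
    qed
  qed auto
  moreover have "(\<lambda>i. expectation (\<lambda>\<omega>. nexp (\<Sum>n. u i (X n \<omega>)))) \<longlonglongrightarrow> nexp (ennreal \<rho> * (\<integral>\<^sup>+x. ennreal (1 - nexp (v x)) \<partial>lborel))"
  proof -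
    have "expectation (\<lambda>\<omega>. nexp (\<Sum>n. u i (X n \<omega>))) = nexp (ennreal \<rho> * (\<integral>\<^sup>+x. ennreal (1 - nexp (u i x)) \<partial>lborel))" for i
    proof (rule PPP_laplace_simple[OF ppp \<rho> us])
      show "u i x < \<top>" for x using U(3) by (simp add: u_def ennreal_mult_less_top split: split_indicator)
      show "bounded {x. u i x \<noteq> 0}"
        by (rule bounded_subset[of "cball 0 (real i)"]) (auto simp: u_def indicator_def)
    qed
    moreover have "(\<lambda>i. \<integral>\<^sup>+x. ennreal (1 - nexp (u i x)) \<partial>lborel) \<longlonglongrightarrow> (\<integral>\<^sup>+x. ennreal (1 - nexp (v x)) \<partial>lborel)"
    proof (rule nn_integral_LIMSEQ)
      show "incseq (\<lambda>i x. ennreal (1 - nexp (u i x)))"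
        using inc by (auto simp: incseq_def le_fun_def intro!: ennreal_leI nexp_mono)
      show "(\<lambda>i. ennreal (1 - nexp (u i x))) \<longlonglongrightarrow> ennreal (1 - nexp (v x))" for x
        by (intro tendsto_ennrealI tendsto_intros tendsto_nexp lim)
    qed auto
    ultimately show ?thesis
      by (auto intro!: tendsto_nexp ennreal_tendsto_cmult)
  qed
  ultimately show ?thesis by (rule LIMSEQ_unique)
qed

end

section \<open>Path loss\<close>

text \<open>Polar coordinates without a change of variables: half-lines form an intersection-stable
  generator, and both sides give \<open>{..a}\<close> the area of the disc of radius a.\<close>

lemma distr_lborel_norm:
  "distr lborel borel (norm :: real^2 \<Rightarrow> real) = density lborel (\<lambda>r. ennreal (2 * pi * r) * indicator {0..} r)"
proof (rule measure_eqI_generator_eq[where E = "range atMost" and \<Omega> = UNIV and A = "\<lambda>i. {..real i}"])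
  let ?N = "distr lborel borel (norm :: real^2 \<Rightarrow> real)"
  let ?D = "density lborel (\<lambda>r. ennreal (2 * pi * r) * indicator {0..} r)"
  have le: "emeasure ?N {..a} = (if 0 \<le> a then ennreal (pi * a\<^sup>2) else 0)" for a
  proof -
    have "emeasure ?N {..a} = emeasure lborel (cball (0::real^2) a)"
      by (subst emeasure_distr) (auto intro!: arg_cong2[where f = emeasure])
    then show ?thesis
      using emeasure_cball[of a "0::real^2"] by (auto simp: unit_ball_vol_2)
  qed
  fix S :: "real set" assume "S \<in> range atMost"
  then obtain a where S: "S = {..a}" by auto
  have "emeasure ?D {..a}
      = (\<integral>\<^sup>+r. ennreal (2 * pi * r) * indicator {0..a} r \<partial>lborel)"
    by (subst emeasure_density) (auto intro!: nn_integral_cong split: split_indicator)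
  also have "\<dots> = (if 0 \<le> a then ennreal (pi * a\<^sup>2) else 0)"
  proof (cases "0 \<le> a")
    case True
    have "(\<integral>\<^sup>+r. ennreal (2 * pi * r) * indicator {0..a} r \<partial>lborel) = ennreal (pi * a\<^sup>2 - pi * 0\<^sup>2)"
      by (rule nn_integral_FTC_Icc[OF _ _ _ True]) (auto intro!: derivative_eq_intros)
    then show ?thesis using True by simp
  qed simp
  finally show "emeasure ?N S = emeasure ?D S"
    using le[of a] S by simp
next
  let ?N = "distr lborel borel (norm :: real^2 \<Rightarrow> real)"
  let ?D = "density lborel (\<lambda>r. ennreal (2 * pi * r) * indicator {0..} r)"
  fix i :: nat
  have "emeasure ?N {..real i} = emeasure lborel (cball (0::real^2) (real i))"
    by (subst emeasure_distr) (auto intro!: arg_cong2[where f = emeasure])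
  then show "emeasure ?N {..real i} \<noteq> \<infinity>"
    using emeasure_lborel_cball_finite[of "0::real^2" "real i"] by simp
next
  let ?N = "distr lborel borel (norm :: real^2 \<Rightarrow> real)"
  let ?D = "density lborel (\<lambda>r. ennreal (2 * pi * r) * indicator {0..} r)"
  have *: "sets (borel :: real measure) = sigma_sets UNIV (range atMost)"
    by (subst borel_eq_atMost) simp
  show "sets ?N = sigma_sets UNIV (range atMost)"
    using * by simp
  show "sets ?D = sigma_sets UNIV (range atMost)"
    using * by simp
  show "Int_stable (range (atMost :: real \<Rightarrow> _))"
    by (auto simp: Int_stable_def)
  show "(\<Union>i. {..real i}) = UNIV"
    using real_arch_simple by auto
qed auto

lemma nn_integral_radial:
  assumes [measurable]: "f \<in> borel_measurable borel"
  shows "(\<integral>\<^sup>+x. f (norm (x :: real^2)) \<partial>lborel) = (\<integral>\<^sup>+r\<in>{0..}. ennreal (2 * pi * r) * f r \<partial>lborel)"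
proof -
  have "(\<integral>\<^sup>+x. f (norm (x :: real^2)) \<partial>lborel) = (\<integral>\<^sup>+r. f r \<partial>distr lborel borel (norm :: real^2 \<Rightarrow> real))"
    by (subst nn_integral_distr) auto
  also have "\<dots> = (\<integral>\<^sup>+r\<in>{0..}. ennreal (2 * pi * r) * f r \<partial>lborel)"
    by (subst distr_lborel_norm, subst nn_integral_density)
       (auto intro!: nn_integral_cong split: split_indicator)
  finally show ?thesis .
qed

text \<open>Measurability is known only for r * L r on the half-line, through integrability.
  Dividing by r recovers L away from 0, and the value at 0 is put in by hand. On the negative axis L
  is arbitrary, hence the indicator.\<close>

lemma physically_feasible_measurable:
  assumes "physically_feasible L"
  shows "(\<lambda>r. L r * indicator {0..} r) \<in> borel_measurable borel"
proof -
  have [measurable]: "(\<lambda>r. indicator {0..} r * (r * L r)) \<in> borel_measurable borel"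
    using assms borel_measurable_integrable[of lborel "\<lambda>r. indicator {0..} r * (r * L r)"]
    by (simp add: physically_feasible_def set_integrable_def)
  have "(\<lambda>r. if r = 0 then L 0 else indicator {0..} r * (r * L r) / r) \<in> borel_measurable borel"
    by measurable
  also have "(\<lambda>r. if r = 0 then L 0 else indicator {0..} r * (r * L r) / r) = (\<lambda>r. L r * indicator {0..} r)"
    by (auto split: split_indicator)
  finally show ?thesis .
qed

lemma physically_feasible_norm_measurable:
  assumes "physically_feasible L"
  shows "(\<lambda>x. L (norm x)) \<in> borel_measurable (borel :: 'b::euclidean_space measure)"
proof -
  note [measurable] = physically_feasible_measurable[OF assms]
  have "(\<lambda>x::'b. L (norm x) * indicator {0..} (norm x)) \<in> borel_measurable borel"
    by (rule measurable_compose[OF _ physically_feasible_measurable[OF assms]]) measurable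
  then show ?thesis by simp
qed

lemma path_loss_moment_pos:
  assumes "physically_feasible L"
  shows "0 < path_loss_moment L"
proof -
  have L: "\<And>r. 0 \<le> r \<Longrightarrow> 0 \<le> L r" "0 < L 0" "(L \<longlongrightarrow> L 0) (at_right 0)" "set_integrable lborel {0..} (\<lambda>r. r * L r)"
    using assms by (auto simp: physically_feasible_def)
  have "\<forall>\<^sub>F r in at_right 0. L 0 / 2 < L r"
    using L(2,3) by (intro order_tendstoD(1)) auto
  then obtain b where b: "0 < b" "\<And>r. 0 < r \<Longrightarrow> r < b \<Longrightarrow> L 0 / 2 < L r"
    unfolding eventually_at_right_field by auto
  \<comment> \<open>Continuity at 0 bounds L below on (0, b); on the strip from b/2 to b the factor
    r is bounded below as well.\<close>
  have "ennreal 0 < ennreal (L 0 / 2 * (b/2)) * emeasure lborel {b/2..<b}"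
    using b L(2) by (auto simp: ennreal_zero_less_mult_iff)
  also have "\<dots> = (\<integral>\<^sup>+r. ennreal (L 0 / 2 * (b/2)) * indicator {b/2..<b} r \<partial>lborel)"
    by (simp add: nn_integral_cmult_indicator)
  also have "\<dots> \<le> (\<integral>\<^sup>+r. ennreal (indicator {0..} r * (r * L r)) \<partial>lborel)"
  proof (intro nn_integral_mono)
    fix r
    have "b / 2 * (L 0 / 2) \<le> r * L r" if "b / 2 \<le> r" "r < b"
      using that b(1) b(2)[of r] L(2) by (intro mult_mono) auto
    then show "ennreal (L 0 / 2 * (b / 2)) * indicator {b / 2..<b} r \<le> ennreal (indicator {0..} r * (r * L r))"
      using b(1) by (auto split: split_indicator intro!: ennreal_leI simp: mult.commute)
  qed
  also have "\<dots> = ennreal (path_loss_moment L)"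
    using L unfolding path_loss_moment_def set_lebesgue_integral_def set_integrable_def
    by (subst nn_integral_eq_integral) (auto split: split_indicator)
  finally show ?thesis by (simp add: ennreal_less_iff)
qed

lemma nn_integral_path_loss:
  assumes "physically_feasible L"
  shows "(\<integral>\<^sup>+x. ennreal (L (norm (x :: real^2))) \<partial>lborel) = ennreal (2 * pi * path_loss_moment L)"
proof -
  note [measurable] = physically_feasible_measurable[OF assms]
  have L: "\<And>r. 0 \<le> r \<Longrightarrow> 0 \<le> L r" "set_integrable lborel {0..} (\<lambda>r. r * L r)"
    using assms by (auto simp: physically_feasible_def)
  have "(\<integral>\<^sup>+x. ennreal (L (norm (x :: real^2))) \<partial>lborel)
      = (\<integral>\<^sup>+x. ennreal (L (norm (x :: real^2)) * indicator {0..} (norm x)) \<partial>lborel)"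
    by simp
  also have "\<dots> = (\<integral>\<^sup>+r\<in>{0..}. ennreal (2 * pi * r) * ennreal (L r * indicator {0..} r) \<partial>lborel)"
    by (rule nn_integral_radial) measurable
  also have "\<dots> = (\<integral>\<^sup>+r. ennreal (2 * pi) * ennreal (indicator {0..} r *\<^sub>R (r * L r)) \<partial>lborel)"
    by (intro nn_integral_cong) (auto simp: L mult.assoc simp flip: ennreal_mult split: split_indicator)
  also have "\<dots> = ennreal (2 * pi) * (\<integral>\<^sup>+r. ennreal (indicator {0..} r *\<^sub>R (r * L r)) \<partial>lborel)"
    using L(2) by (intro nn_integral_cmult) (simp add: set_integrable_def borel_measurable_integrable)
  also have "(\<integral>\<^sup>+r. ennreal (indicator {0..} r *\<^sub>R (r * L r)) \<partial>lborel) = ennreal (path_loss_moment L)"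
    using L unfolding path_loss_moment_def set_lebesgue_integral_def set_integrable_def
    by (subst nn_integral_eq_integral) (auto split: split_indicator)
  finally show ?thesis using path_loss_moment_pos[OF assms] by (simp add: ennreal_mult less_imp_le)
qed

lemma integrable_path_loss:
  assumes "physically_feasible L"
  shows "integrable lborel (\<lambda>x :: real^2. L (norm x))"
    and "integral\<^sup>L lborel (\<lambda>x :: real^2. L (norm x)) = 2 * pi * path_loss_moment L"
proof -
  have L: "\<And>r. 0 \<le> r \<Longrightarrow> 0 \<le> L r" using assms by (auto simp: physically_feasible_def)
  note [measurable] = physically_feasible_norm_measurable[OF assms]
  show "integrable lborel (\<lambda>x :: real^2. L (norm x))"
    by (rule integrableI_nonneg) (auto simp: L nn_integral_path_loss[OF assms])
  show "integral\<^sup>L lborel (\<lambda>x :: real^2. L (norm x)) = 2 * pi * path_loss_moment L"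
    using path_loss_moment_pos[OF assms]
    by (subst integral_eq_nn_integral) (auto simp: L nn_integral_path_loss[OF assms])
qed

section \<open>Independent marks\<close>

context prob_space
begin

text \<open>Independence factorises the finite products, and bounded convergence carries this to the
  infinite sum. Writing the limit with \<open>nlog\<close> allows it to be 0.\<close>

lemma nexp_suminf_indep:
  fixes Y :: "nat \<Rightarrow> 'a \<Rightarrow> ennreal"
  assumes ind: "indep_vars (\<lambda>_. borel) Y UNIV"
  shows "expectation (\<lambda>\<omega>. nexp (\<Sum>n. Y n \<omega>)) = nexp (\<Sum>n. nlog (expectation (\<lambda>\<omega>. nexp (Y n \<omega>))))"
proof -
  have [measurable]: "Y n \<in> borel_measurable M" for n
    using ind by (auto simp: indep_vars_def)
  have E01: "0 \<le> expectation (\<lambda>\<omega>. nexp (Y n \<omega>))" "expectation (\<lambda>\<omega>. nexp (Y n \<omega>)) \<le> 1" for n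
    by (auto intro!: integral_nonneg integral_le_const)
  have "(\<lambda>k. expectation (\<lambda>\<omega>. \<Prod>n<k. nexp (Y n \<omega>))) \<longlonglongrightarrow> expectation (\<lambda>\<omega>. nexp (\<Sum>n. Y n \<omega>))"
  proof (rule integral_dominated_convergence[where w = "\<lambda>_. 1"])
    show "AE \<omega> in M. (\<lambda>k. \<Prod>n<k. nexp (Y n \<omega>)) \<longlonglongrightarrow> nexp (\<Sum>n. Y n \<omega>)"
      by (intro AE_I2 prod_nexp_tendsto)
    show "AE \<omega> in M. norm (\<Prod>n<k. nexp (Y n \<omega>)) \<le> 1" for k
      by (intro AE_I2) (auto simp: abs_of_nonneg prod_nonneg intro!: prod_le_1)
  qed auto
  moreover have "expectation (\<lambda>\<omega>. \<Prod>n<k. nexp (Y n \<omega>)) = (\<Prod>n<k. nexp (nlog (expectation (\<lambda>\<omega>. nexp (Y n \<omega>)))))" for k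
  proof -
    have "expectation (\<lambda>\<omega>. \<Prod>n<k. nexp (Y n \<omega>)) = (\<Prod>n<k. expectation (\<lambda>\<omega>. nexp (Y n \<omega>)))"
    proof (rule indep_vars_lebesgue_integral)
      show "indep_vars (\<lambda>_. borel) (\<lambda>n \<omega>. nexp (Y n \<omega>)) {..<k}"
        by (rule indep_vars_compose2[OF indep_vars_subset[OF ind]]) auto
    qed auto
    then show ?thesis by (simp add: nexp_nlog E01)
  qed
  ultimately show ?thesis
    using LIMSEQ_unique prod_nexp_tendsto[of "\<lambda>n. nlog (expectation (\<lambda>\<omega>. nexp (Y n \<omega>)))"] by auto
qed

lemma process_measurable:
  "(\<And>i. Z i \<in> measurable M N) \<Longrightarrow> (\<lambda>\<omega> i. Z i \<omega>) \<in> measurable M (Pi\<^sub>M UNIV (\<lambda>_. N))"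
  by (rule measurable_PiM_single') (auto intro: measurable_space)

lemma marks_measurable: "independent_marks M X W \<Longrightarrow> W i \<in> borel_measurable M"
  by (auto simp: independent_marks_def indep_vars_def)

text \<open>Independence as a product of laws, which suits variables with values in different
  spaces. Rectangles suffice to identify a product measure.\<close>

lemma distr_pair_eqI:
  assumes [measurable]: "X \<in> measurable M S" "Y \<in> measurable M T"
    and eq: "\<And>A B. A \<in> sets S \<Longrightarrow> B \<in> sets T \<Longrightarrow>
      prob ((X -` A \<inter> space M) \<inter> (Y -` B \<inter> space M)) = prob (X -` A \<inter> space M) * prob (Y -` B \<inter> space M)"
  shows "distr M S X \<Otimes>\<^sub>M distr M T Y = distr M (S \<Otimes>\<^sub>M T) (\<lambda>\<omega>. (X \<omega>, Y \<omega>))"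
proof (rule pair_measure_eqI)
  interpret D1: prob_space "distr M S X" by (rule prob_space_distr) measurable
  interpret D2: prob_space "distr M T Y" by (rule prob_space_distr) measurable
  show "sigma_finite_measure (distr M S X)" "sigma_finite_measure (distr M T Y)" by unfold_locales
  show "sets (distr M S X \<Otimes>\<^sub>M distr M T Y) = sets (distr M (S \<Otimes>\<^sub>M T) (\<lambda>\<omega>. (X \<omega>, Y \<omega>)))"
    by (simp cong: sets_pair_measure_cong)
  fix A B assume "A \<in> sets (distr M S X)" "B \<in> sets (distr M T Y)"
  then have [measurable]: "A \<in> sets S" "B \<in> sets T" by auto
  have "(\<lambda>\<omega>. (X \<omega>, Y \<omega>)) -` (A \<times> B) \<inter> space M = (X -` A \<inter> space M) \<inter> (Y -` B \<inter> space M)" by auto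
  then show "emeasure (distr M S X) A * emeasure (distr M T Y) B = emeasure (distr M (S \<Otimes>\<^sub>M T) (\<lambda>\<omega>. (X \<omega>, Y \<omega>))) (A \<times> B)"
    by (simp add: emeasure_distr emeasure_eq_measure eq ennreal_mult)
qed

text \<open>Tonelli for the joint law: the second integral over \<open>M\<close> plays the role of
  an independent copy of Y, so that X is constant in the inner integral.\<close>

lemma nn_integral_distr_pair:
  assumes [measurable]: "X \<in> measurable M S" "Y \<in> measurable M T"
    and eq: "distr M S X \<Otimes>\<^sub>M distr M T Y = distr M (S \<Otimes>\<^sub>M T) (\<lambda>\<omega>. (X \<omega>, Y \<omega>))"
    and [measurable]: "F \<in> borel_measurable (S \<Otimes>\<^sub>M T)"
  shows "(\<integral>\<^sup>+\<omega>. F (X \<omega>, Y \<omega>) \<partial>M) = (\<integral>\<^sup>+\<omega>. (\<integral>\<^sup>+\<omega>'. F (X \<omega>, Y \<omega>') \<partial>M) \<partial>M)"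
proof -
  interpret D: prob_space "distr M T Y" by (rule prob_space_distr) measurable
  have "(\<integral>\<^sup>+\<omega>. F (X \<omega>, Y \<omega>) \<partial>M) = (\<integral>\<^sup>+z. F z \<partial>distr M (S \<Otimes>\<^sub>M T) (\<lambda>\<omega>. (X \<omega>, Y \<omega>)))"
    by (subst nn_integral_distr) auto
  also have "\<dots> = (\<integral>\<^sup>+z. F z \<partial>(distr M S X \<Otimes>\<^sub>M distr M T Y))"
    by (simp add: eq)
  also have "\<dots> = (\<integral>\<^sup>+x. \<integral>\<^sup>+w. F (x, w) \<partial>distr M T Y \<partial>distr M S X)"
    by (subst D.nn_integral_fst[symmetric]) auto
  also have "\<dots> = (\<integral>\<^sup>+\<omega>. \<integral>\<^sup>+w. F (X \<omega>, w) \<partial>distr M T Y \<partial>M)"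
    by (subst nn_integral_distr) (auto intro!: D.borel_measurable_nn_integral)
  also have "\<dots> = (\<integral>\<^sup>+\<omega>. (\<integral>\<^sup>+\<omega>'. F (X \<omega>, Y \<omega>') \<partial>M) \<partial>M)"
  proof (rule nn_integral_cong)
    fix \<omega> assume "\<omega> \<in> space M"
    then have "X \<omega> \<in> space S" by (rule measurable_space[rotated]) measurable
    then have "(\<lambda>w. F (X \<omega>, w)) \<in> borel_measurable T" by measurable
    then show "(\<integral>\<^sup>+w. F (X \<omega>, w) \<partial>distr M T Y) = (\<integral>\<^sup>+\<omega>'. F (X \<omega>, Y \<omega>') \<partial>M)"
      by (subst nn_integral_distr) auto
  qed
  finally show ?thesis .
qed

text \<open>Conditioning on the locations without conditional expectations: in the inner integral
  they are frozen and only the marks are random.\<close>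

lemma marks_disintegrate:
  fixes X :: "nat \<Rightarrow> 'a \<Rightarrow> real^2" and W :: "'i \<Rightarrow> 'a \<Rightarrow> real"
  assumes marks: "independent_marks M X W" "\<And>n. X n \<in> borel_measurable M"
    and F: "F \<in> borel_measurable (Pi\<^sub>M UNIV (\<lambda>_. borel) \<Otimes>\<^sub>M Pi\<^sub>M UNIV (\<lambda>_. borel))"
  shows "(\<integral>\<^sup>+\<omega>. F (\<lambda>n. X n \<omega>, \<lambda>i. W i \<omega>) \<partial>M) = (\<integral>\<^sup>+\<omega>. (\<integral>\<^sup>+\<omega>'. F (\<lambda>n. X n \<omega>, \<lambda>i. W i \<omega>') \<partial>M) \<partial>M)"
proof (rule nn_integral_distr_pair[OF _ _ _ F])
  show m: "(\<lambda>\<omega> n. X n \<omega>) \<in> measurable M (Pi\<^sub>M UNIV (\<lambda>_. borel))" "(\<lambda>\<omega> i. W i \<omega>) \<in> measurable M (Pi\<^sub>M UNIV (\<lambda>_. borel))"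
    using marks marks_measurable[OF marks(1)] by (auto intro: process_measurable)
  have "indep_set (sets (vimage_algebra (space M) (\<lambda>\<omega> n. X n \<omega>) (Pi\<^sub>M UNIV (\<lambda>_. borel))))
       (sets (vimage_algebra (space M) (\<lambda>\<omega> i. W i \<omega>) (Pi\<^sub>M UNIV (\<lambda>_. borel))))"
    using marks by (simp add: independent_marks_def)
  from indep_setD[OF this]
  show "distr M (Pi\<^sub>M UNIV (\<lambda>_. borel)) (\<lambda>\<omega> n. X n \<omega>) \<Otimes>\<^sub>M distr M (Pi\<^sub>M UNIV (\<lambda>_. borel)) (\<lambda>\<omega> i. W i \<omega>)
      = distr M (Pi\<^sub>M UNIV (\<lambda>_. borel) \<Otimes>\<^sub>M Pi\<^sub>M UNIV (\<lambda>_. borel)) (\<lambda>\<omega>. (\<lambda>n. X n \<omega>, \<lambda>i. W i \<omega>))"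
    using m by (intro distr_pair_eqI) (auto intro!: in_vimage_algebra)
qed

text \<open>Once the locations are frozen the terms are independent, and
  \<open>nexp_suminf_indep\<close> applies to each configuration. \<phi> may depend on the whole
  configuration, so that a term can be switched off according to which point is nearest.\<close>

lemma marks_laplace:
  fixes X :: "nat \<Rightarrow> 'a \<Rightarrow> real^2" and W :: "'i \<Rightarrow> 'a \<Rightarrow> real" and Y :: "nat \<Rightarrow> (nat \<Rightarrow> real^2) \<times> ('i \<Rightarrow> real) \<Rightarrow> ennreal"
  assumes marks: "independent_marks M X W" "\<And>n. X n \<in> borel_measurable M"
    and Y: "\<And>n. Y n \<in> borel_measurable (Pi\<^sub>M UNIV (\<lambda>_. borel) \<Otimes>\<^sub>M Pi\<^sub>M UNIV (\<lambda>_. borel))"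
    and ind: "\<And>x. indep_vars (\<lambda>_. borel) (\<lambda>n \<omega>. Y n (x, \<lambda>i. W i \<omega>)) UNIV"
    and \<phi>: "\<And>n x. expectation (\<lambda>\<omega>. nexp (Y n (x, \<lambda>i. W i \<omega>))) = \<phi> n x"
  shows "ennreal (expectation (\<lambda>\<omega>. nexp (\<Sum>n. Y n (\<lambda>n. X n \<omega>, \<lambda>i. W i \<omega>))))
       = (\<integral>\<^sup>+\<omega>. ennreal (nexp (\<Sum>n. nlog (\<phi> n (\<lambda>n. X n \<omega>)))) \<partial>M)"
proof -
  let ?Z = "\<lambda>\<omega> \<omega>'. (\<lambda>n. X n \<omega>, \<lambda>i. W i \<omega>')"
  note [measurable] = Y process_measurable[of X borel, OF marks(2)] process_measurable[of W borel, OF marks_measurable[OF marks(1)]]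
  have "ennreal (expectation (\<lambda>\<omega>. nexp (\<Sum>n. Y n (?Z \<omega> \<omega>))))
      = (\<integral>\<^sup>+\<omega>. ennreal (nexp (\<Sum>n. Y n (?Z \<omega> \<omega>))) \<partial>M)"
    by (rule nn_integral_eq_integral[symmetric]) auto
  also have "\<dots> = (\<integral>\<^sup>+\<omega>. (\<integral>\<^sup>+\<omega>'. ennreal (nexp (\<Sum>n. Y n (?Z \<omega> \<omega>'))) \<partial>M) \<partial>M)"
    by (rule marks_disintegrate[OF marks, of "\<lambda>z. ennreal (nexp (\<Sum>n. Y n z))"]) measurable
  also have "\<dots> = (\<integral>\<^sup>+\<omega>. ennreal (nexp (\<Sum>n. nlog (\<phi> n (\<lambda>n. X n \<omega>)))) \<partial>M)"
  proof (rule nn_integral_cong)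
    fix \<omega> assume "\<omega> \<in> space M"
    have [measurable]: "(\<lambda>\<omega>'. Y n (?Z \<omega> \<omega>')) \<in> borel_measurable M" for n
      using ind[of "\<lambda>n. X n \<omega>"] by (auto simp: indep_vars_def)
    have "(\<integral>\<^sup>+\<omega>'. ennreal (nexp (\<Sum>n. Y n (?Z \<omega> \<omega>'))) \<partial>M) = ennreal (expectation (\<lambda>\<omega>'. nexp (\<Sum>n. Y n (?Z \<omega> \<omega>'))))"
      by (rule nn_integral_eq_integral) auto
    then show "(\<integral>\<^sup>+\<omega>'. ennreal (nexp (\<Sum>n. Y n (?Z \<omega> \<omega>'))) \<partial>M) = ennreal (nexp (\<Sum>n. nlog (\<phi> n (\<lambda>n. X n \<omega>))))"
      using nexp_suminf_indep[OF ind[of "\<lambda>n. X n \<omega>"]] by (simp add: \<phi>)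
  qed
  finally show ?thesis .
qed

text \<open>\<open>independent_marks\<close> separates the marks from one another and their family
  from the locations, but does not directly separate one mark from the locations and the other marks
  taken together. Freezing the locations, splitting the marks and integrating the locations back
  yields this.\<close>

lemma marks_indep_rest:
  fixes X :: "nat \<Rightarrow> 'a \<Rightarrow> real^2" and W :: "'i \<Rightarrow> 'a \<Rightarrow> real"
  assumes marks: "independent_marks M X W" "\<And>n. X n \<in> borel_measurable M"
    and F: "F \<in> measurable (Pi\<^sub>M UNIV (\<lambda>_. borel) \<Otimes>\<^sub>M Pi\<^sub>M (- {i}) (\<lambda>_. borel)) N"
  shows "distr M borel (W i) \<Otimes>\<^sub>M distr M N (\<lambda>\<omega>. F (\<lambda>n. X n \<omega>, \<lambda>j\<in>- {i}. W j \<omega>))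
      = distr M (borel \<Otimes>\<^sub>M N) (\<lambda>\<omega>. (W i \<omega>, F (\<lambda>n. X n \<omega>, \<lambda>j\<in>- {i}. W j \<omega>)))"
proof (rule distr_pair_eqI)
  let ?P = "Pi\<^sub>M UNIV (\<lambda>_. borel) :: (nat \<Rightarrow> real^2) measure"
  let ?Q = "Pi\<^sub>M (- {i}) (\<lambda>_. borel) :: ('i \<Rightarrow> real) measure"
  let ?X = "\<lambda>\<omega> n. X n \<omega>"
  \<comment> \<open>The restriction as a map on full families of marks, so that the composition with
    F has the form that \<open>marks_disintegrate\<close> expects.\<close>
  define V where "V = (\<lambda>w :: 'i \<Rightarrow> real. \<lambda>j\<in>- {i}. w j)"
  let ?V = "\<lambda>\<omega>. V (\<lambda>j. W j \<omega>)"
  have [measurable]: "V \<in> measurable (Pi\<^sub>M UNIV (\<lambda>_. borel)) ?Q"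
    unfolding V_def by (rule measurable_restrict) measurable
  have W: "indep_vars (\<lambda>_. borel) W UNIV" using marks by (simp add: independent_marks_def)
  note [measurable] = F process_measurable[of X borel, OF marks(2)] process_measurable[of W borel, OF marks_measurable[OF marks(1)]] marks_measurable[OF marks(1)]
  have iv: "indep_var (Pi\<^sub>M {i} (\<lambda>_. borel)) (\<lambda>\<omega>. \<lambda>j\<in>{i}. W j \<omega>) ?Q ?V"
    unfolding V_def by (rule indep_var_restrict[OF W]) auto
  show "W i \<in> borel_measurable M" by measurable
  have "(\<lambda>\<omega>. F (?X \<omega>, ?V \<omega>)) \<in> measurable M N" by measurable
  then show "(\<lambda>\<omega>. F (?X \<omega>, \<lambda>j\<in>- {i}. W j \<omega>)) \<in> measurable M N" by (simp add: V_def)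
  fix A :: "real set" and B assume [measurable]: "A \<in> sets borel" "B \<in> sets N"
  let ?A = "W i -` A \<inter> space M" and ?FB = "(\<lambda>\<omega>. F (?X \<omega>, ?V \<omega>)) -` B \<inter> space M"
    and ?i = "\<lambda>\<omega> \<omega>'. indicator B (F (?X \<omega>, ?V \<omega>')) :: ennreal"
  have "emeasure M (?A \<inter> ?FB)
      = (\<integral>\<^sup>+\<omega>. indicator (?A \<inter> ?FB) \<omega> \<partial>M)"
    by (rule nn_integral_indicator[symmetric]) measurable
  also have "\<dots> = (\<integral>\<^sup>+\<omega>. indicator A (W i \<omega>) * ?i \<omega> \<omega> \<partial>M)"
    by (intro nn_integral_cong) (auto split: split_indicator)
  also have "\<dots> = (\<integral>\<^sup>+\<omega>. (\<integral>\<^sup>+\<omega>'. indicator A (W i \<omega>') * ?i \<omega> \<omega>' \<partial>M) \<partial>M)"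
    by (rule marks_disintegrate[OF marks, of "\<lambda>(x, w). indicator A (w i) * indicator B (F (x, V w))", simplified]) measurable
  also have "\<dots> = (\<integral>\<^sup>+\<omega>. emeasure M ?A * (\<integral>\<^sup>+\<omega>'. ?i \<omega> \<omega>' \<partial>M) \<partial>M)"
  proof (rule nn_integral_cong)
    fix \<omega> assume "\<omega> \<in> space M"
    then have "?X \<omega> \<in> space ?P" by (rule measurable_space[rotated]) measurable
    then have [measurable]: "(\<lambda>v. F (?X \<omega>, v)) \<in> measurable ?Q N" by measurable
    let ?C = "{f \<in> space (Pi\<^sub>M {i} (\<lambda>_. borel)). f i \<in> A}"
    let ?B = "{v \<in> space ?Q. F (?X \<omega>, v) \<in> B}"
    have [measurable]: "?C \<in> sets (Pi\<^sub>M {i} (\<lambda>_. borel))" "?B \<in> sets ?Q" by measurable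
    have Vs: "?V \<omega>' \<in> space ?Q" if "\<omega>' \<in> space M" for \<omega>'
      using that by (rule measurable_space[rotated]) measurable
    have "(\<integral>\<^sup>+\<omega>'. indicator A (W i \<omega>') * ?i \<omega> \<omega>' \<partial>M)
        = (\<integral>\<^sup>+\<omega>'. indicator (?A \<inter> (?V -` ?B \<inter> space M)) \<omega>' \<partial>M)"
      using Vs by (intro nn_integral_cong) (auto split: split_indicator)
    also have "\<dots> = emeasure M (?A \<inter> (?V -` ?B \<inter> space M))"
      by (rule nn_integral_indicator) measurable
    also have "?A \<inter> (?V -` ?B \<inter> space M) = (\<lambda>\<omega>'. (\<lambda>j\<in>{i}. W j \<omega>', ?V \<omega>')) -` (?C \<times> ?B) \<inter> space M"
      by (auto simp: space_PiM)
    also have "emeasure M \<dots> = emeasure M ((\<lambda>\<omega>'. \<lambda>j\<in>{i}. W j \<omega>') -` ?C \<inter> space M) * emeasure M (?V -` ?B \<inter> space M)"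
      using indep_varD[OF iv, of ?C ?B] by (simp add: emeasure_eq_measure ennreal_mult)
    also have "(\<lambda>\<omega>'. \<lambda>j\<in>{i}. W j \<omega>') -` ?C \<inter> space M = ?A"
      by (auto simp: space_PiM)
    also have "emeasure M (?V -` ?B \<inter> space M) = (\<integral>\<^sup>+\<omega>'. indicator (?V -` ?B \<inter> space M) \<omega>' \<partial>M)"
      by (rule nn_integral_indicator[symmetric]) measurable
    also have "\<dots> = (\<integral>\<^sup>+\<omega>'. ?i \<omega> \<omega>' \<partial>M)"
      using Vs by (intro nn_integral_cong) (auto split: split_indicator)
    finally show "(\<integral>\<^sup>+\<omega>'. indicator A (W i \<omega>') * ?i \<omega> \<omega>' \<partial>M)
        = emeasure M ?A * (\<integral>\<^sup>+\<omega>'. ?i \<omega> \<omega>' \<partial>M)" .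
  qed
  also have "\<dots> = emeasure M ?A * (\<integral>\<^sup>+\<omega>. (\<integral>\<^sup>+\<omega>'. ?i \<omega> \<omega>' \<partial>M) \<partial>M)"
    by (rule nn_integral_cmult) measurable
  \<comment> \<open>The same disintegration read backwards restores the locations.\<close>
  also have "(\<integral>\<^sup>+\<omega>. (\<integral>\<^sup>+\<omega>'. ?i \<omega> \<omega>' \<partial>M) \<partial>M) = (\<integral>\<^sup>+\<omega>. ?i \<omega> \<omega> \<partial>M)"
    by (rule marks_disintegrate[OF marks, of "\<lambda>(x, w). indicator B (F (x, V w))", simplified, symmetric]) measurable
  also have "\<dots> = (\<integral>\<^sup>+\<omega>. indicator ?FB \<omega> \<partial>M)"
    by (intro nn_integral_cong) (auto split: split_indicator)
  also have "\<dots> = emeasure M ?FB"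
    by (rule nn_integral_indicator) measurable
  finally show "prob (?A \<inter> ((\<lambda>\<omega>. F (?X \<omega>, \<lambda>j\<in>- {i}. W j \<omega>)) -` B \<inter> space M))
      = prob ?A * prob ((\<lambda>\<omega>. F (?X \<omega>, \<lambda>j\<in>- {i}. W j \<omega>)) -` B \<inter> space M)"
    unfolding V_def emeasure_eq_measure ennreal_mult[symmetric, OF measure_nonneg measure_nonneg]
    by (simp only: ennreal_inj measure_nonneg mult_nonneg_nonneg)
qed

end

section \<open>Sums over a marked Poisson process without its nearest point\<close>

lemma suminf_all_but_one:
  fixes f :: "nat \<Rightarrow> ennreal"
  shows "(\<Sum>n. f n) = (\<Sum>n. if n \<noteq> k then f n else 0) + f k"
proof -
  have "(\<Sum>n. f n) = (\<Sum>n. (if n \<noteq> k then f n else 0) + (if n = k then f n else 0))"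
    by (intro suminf_cong) auto
  also have "\<dots> = (\<Sum>n. if n \<noteq> k then f n else 0) + (\<Sum>n. if n = k then f n else 0)"
    by (intro suminf_add[symmetric]) auto
  also have "(\<Sum>n. if n = k then f n else 0) = f k"
    by (subst suminf_finite[where N = "{k}"]) auto
  finally show ?thesis .
qed

lemma measurable_nearest [measurable]:
  "nearest \<in> measurable (Pi\<^sub>M UNIV (\<lambda>_. borel)) (count_space UNIV)"
proof -
  have [measurable]: "(\<lambda>x :: nat \<Rightarrow> real^2. norm (x n)) \<in> borel_measurable (Pi\<^sub>M UNIV (\<lambda>_. borel))" for n
    by (rule measurable_compose[OF measurable_component_singleton]) auto
  have "Measurable.pred (Pi\<^sub>M UNIV (\<lambda>_. borel)) (\<lambda>x :: nat \<Rightarrow> real^2. norm (x n) \<le> norm (x m))" for n m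
    unfolding pred_def by (intro borel_measurable_le) measurable
  then show ?thesis unfolding nearest_def[abs_def] by (intro measurable_Least pred_intros_countable)
qed

context prob_space
begin

text \<open>\<open>K n\<close> is the block of marks that belong to the n-th point; disjoint blocks
  make the terms independent. The selection \<open>J\<close> sees the locations only, so it is
  frozen together with them. \<phi> does not depend on n, which makes the right-hand side a
  functional of the points alone.\<close>

lemma marked_laplace:
  fixes X :: "nat \<Rightarrow> 'a \<Rightarrow> real^2" and W :: "'i \<Rightarrow> 'a \<Rightarrow> real" and Q :: "nat \<Rightarrow> (real^2) \<times> ('i \<Rightarrow> real) \<Rightarrow> ennreal"
    and J :: "(nat \<Rightarrow> real^2) \<Rightarrow> nat \<Rightarrow> bool"
  assumes marks: "independent_marks M X W" "\<And>n. X n \<in> borel_measurable M"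
    and K: "disjoint_family K"
    and Q: "\<And>n. Q n \<in> borel_measurable (borel \<Otimes>\<^sub>M Pi\<^sub>M (K n) (\<lambda>_. borel))"
    and J [measurable]: "\<And>n. Measurable.pred (Pi\<^sub>M UNIV (\<lambda>_. borel)) (\<lambda>x. J x n)"
    and \<phi>: "\<And>n x. expectation (\<lambda>\<omega>. nexp (Q n (x, \<lambda>i\<in>K n. W i \<omega>))) = \<phi> x"
  shows "ennreal (expectation (\<lambda>\<omega>. nexp (\<Sum>n. if J (\<lambda>n. X n \<omega>) n then Q n (X n \<omega>, \<lambda>i\<in>K n. W i \<omega>) else 0)))
       = (\<integral>\<^sup>+\<omega>. ennreal (nexp (\<Sum>n. if J (\<lambda>n. X n \<omega>) n then nlog (\<phi> (X n \<omega>)) else 0)) \<partial>M)"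
proof -
  define Y where "Y n z = (if J (fst z) n then Q n (fst z n, \<lambda>i\<in>K n. snd z i) else 0)" for n and z :: "(nat \<Rightarrow> real^2) \<times> ('i \<Rightarrow> real)"
  note [measurable] = Q
  have [measurable]: "(\<lambda>z. \<lambda>i\<in>K n. snd z i) \<in> measurable (Pi\<^sub>M UNIV (\<lambda>_. borel) \<Otimes>\<^sub>M Pi\<^sub>M UNIV (\<lambda>_. borel)) (Pi\<^sub>M (K n) (\<lambda>_. borel))"
    for n by (rule measurable_restrict) measurable
  have W: "indep_vars (\<lambda>_. borel) W UNIV" using marks by (simp add: independent_marks_def)
  have "ennreal (expectation (\<lambda>\<omega>. nexp (\<Sum>n. Y n (\<lambda>n. X n \<omega>, \<lambda>i. W i \<omega>))))
       = (\<integral>\<^sup>+\<omega>. ennreal (nexp (\<Sum>n. nlog (if J (\<lambda>n. X n \<omega>) n then \<phi> (X n \<omega>) else 1))) \<partial>M)"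
  \<comment> \<open>A deselected point has transform 1, whose \<open>nlog\<close> is 0.\<close>
  proof (rule marks_laplace[OF marks, where \<phi> = "\<lambda>n x. if J x n then \<phi> (x n) else 1"])
    show "Y n \<in> borel_measurable (Pi\<^sub>M UNIV (\<lambda>_. borel) \<Otimes>\<^sub>M Pi\<^sub>M UNIV (\<lambda>_. borel))" for n
      unfolding Y_def by measurable
    show "expectation (\<lambda>\<omega>. nexp (Y n (x, \<lambda>i. W i \<omega>))) = (if J x n then \<phi> (x n) else 1)" for n x
      by (simp add: Y_def \<phi> prob_space)
    show "indep_vars (\<lambda>_. borel) (\<lambda>n \<omega>. Y n (x, \<lambda>i. W i \<omega>)) UNIV" for x
    proof -
      have "indep_vars (\<lambda>j. PiM (K j) (\<lambda>_. borel)) (\<lambda>j \<omega>. \<lambda>i\<in>K j. W i \<omega>) UNIV"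
        by (rule indep_vars_restrict[OF W _ K]) auto
      from indep_vars_compose2[OF this, of "\<lambda>n w. if J x n then Q n (x n, w) else 0" "\<lambda>_. borel"]
      show ?thesis unfolding Y_def fst_conv snd_conv by simp
    qed
  qed
  also have "\<dots> = (\<integral>\<^sup>+\<omega>. ennreal (nexp (\<Sum>n. if J (\<lambda>n. X n \<omega>) n then nlog (\<phi> (X n \<omega>)) else 0)) \<partial>M)"
    by (intro nn_integral_cong arg_cong[where f = "\<lambda>x. ennreal (nexp x)"] suminf_cong) auto
  finally show ?thesis unfolding Y_def fst_conv snd_conv .
qed

text \<open>Given the locations, the transform of the full sum is that of the reduced sum times one
  factor \<phi> at the nearest point. The full sum has the Poisson value Z; the comparisons use that
  \<phi> is at most 1, close to 1, or bounded away from 0. The additive form serves the limit at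
  fixed t, the multiplicative one the decay in t, where an additive error would not decay.\<close>

lemma marked_PPP_laplace:
  fixes X :: "nat \<Rightarrow> 'a \<Rightarrow> real^2" and W :: "'i \<Rightarrow> 'a \<Rightarrow> real" and Q :: "nat \<Rightarrow> (real^2) \<times> ('i \<Rightarrow> real) \<Rightarrow> ennreal"
  assumes ppp: "homogeneous_PPP M \<rho> X" and \<rho>: "0 \<le> \<rho>"
    and marks: "independent_marks M X W"
    and K: "disjoint_family K"
    and Q: "\<And>n. Q n \<in> borel_measurable (borel \<Otimes>\<^sub>M Pi\<^sub>M (K n) (\<lambda>_. borel))"
    and \<phi>: "\<And>n x. expectation (\<lambda>\<omega>. nexp (Q n (x, \<lambda>i\<in>K n. W i \<omega>))) = \<phi> x"
  defines "Z \<equiv> nexp (ennreal \<rho> * (\<integral>\<^sup>+x. ennreal (1 - \<phi> x) \<partial>lborel))"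
    and "E \<equiv> expectation (\<lambda>\<omega>. nexp (\<Sum>n. if n \<noteq> nearest (\<lambda>n. X n \<omega>) then Q n (X n \<omega>, \<lambda>i\<in>K n. W i \<omega>) else 0))"
  shows "expectation (\<lambda>\<omega>. nexp (\<Sum>n. Q n (X n \<omega>, \<lambda>i\<in>K n. W i \<omega>))) = Z"
    and "Z \<le> E"
    and "(\<And>x. 1 - \<phi> x \<le> c) \<Longrightarrow>
      E \<le> Z + c"
    and "(\<And>x. d \<le> \<phi> x) \<Longrightarrow> 0 < d \<Longrightarrow>
      E \<le> Z / d"
proof -
  note marks' = marks PPP_measurable[OF ppp]
  note [measurable] = Q PPP_measurable[OF ppp] process_measurable[of X borel, OF PPP_measurable[OF ppp]] marks_measurable[OF marks]
  have Wm: "(\<lambda>\<omega>. \<lambda>i\<in>K n. W i \<omega>) \<in> measurable M (Pi\<^sub>M (K n) (\<lambda>_. borel))" for n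
    by (rule measurable_restrict) measurable
  note [measurable] = Wm
  have \<phi>01: "0 \<le> \<phi> x" "\<phi> x \<le> 1" for x
    unfolding \<phi>[of 0 x, symmetric] using measurable_Pair2[OF Q[of 0], of x]
    by (auto intro!: integral_nonneg integral_le_const)
  have "(\<lambda>x. expectation (\<lambda>\<omega>. nexp (Q 0 (x, \<lambda>i\<in>K 0. W i \<omega>)))) \<in> borel_measurable borel"
    by (rule borel_measurable_lebesgue_integral) measurable
  then have [measurable]: "\<phi> \<in> borel_measurable borel"
    by (simp add: \<phi>)
  define v where "v x = nlog (\<phi> x)" for x
  have v: "nexp (v x) = \<phi> x" for x by (simp add: v_def nexp_nlog \<phi>01)
  have [measurable]: "v \<in> borel_measurable borel" unfolding v_def by measurable
  have Z: "expectation (\<lambda>\<omega>. nexp (\<Sum>n. v (X n \<omega>))) = Z"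
    using PPP_laplace[OF ppp \<rho>, of v] by (simp add: v Z_def)
  define near where "near \<omega> = nearest (\<lambda>n. X n \<omega>)" for \<omega>
  have [measurable]: "near \<in> measurable M (count_space UNIV)" unfolding near_def by measurable
  define A where "A \<omega> = nexp (\<Sum>n. if n \<noteq> near \<omega> then v (X n \<omega>) else 0)" for \<omega>
  have [measurable]: "A \<in> borel_measurable M" unfolding A_def by measurable
  have A01: "0 \<le> A \<omega>" "A \<omega> \<le> 1" for \<omega> by (auto simp: A_def)
  have iA: "integrable M A" unfolding A_def by (rule integrable_nexp) measurable
  have all: "nexp (\<Sum>n. v (X n \<omega>)) = A \<omega> * \<phi> (X (near \<omega>) \<omega>)" for \<omega>
    by (subst suminf_all_but_one[where k = "near \<omega>"]) (simp add: nexp_add A_def v)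
  have "ennreal (expectation (\<lambda>\<omega>. nexp (\<Sum>n. if True then Q n (X n \<omega>, \<lambda>i\<in>K n. W i \<omega>) else 0))) = (\<integral>\<^sup>+\<omega>. ennreal (nexp (\<Sum>n. if True then v (X n \<omega>) else 0)) \<partial>M)"
    unfolding v_def by (rule marked_laplace[OF marks' K Q _ \<phi>]) simp
  also have "\<dots> = ennreal Z"
    using Z by (subst nn_integral_eq_integral) auto
  finally show "expectation (\<lambda>\<omega>. nexp (\<Sum>n. Q n (X n \<omega>, \<lambda>i\<in>K n. W i \<omega>))) = Z"
    by (simp add: Z_def)
  have "ennreal E = (\<integral>\<^sup>+\<omega>. ennreal (A \<omega>) \<partial>M)"
    unfolding E_def v_def A_def near_def by (rule marked_laplace[OF marks' K Q _ \<phi>]) measurable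
  also have "\<dots> = ennreal (expectation A)"
    using iA by (subst nn_integral_eq_integral) (auto simp: A01)
  finally have EA: "E = expectation A"
    by (simp add: E_def A01)
  have iv: "integrable M (\<lambda>\<omega>. nexp (\<Sum>n. v (X n \<omega>)))" by (rule integrable_nexp) measurable
  show "Z \<le> E"
    unfolding EA Z[symmetric]
    by (rule integral_mono[OF iv iA]) (simp add: all A01 \<phi>01 mult_right_le_one_le)
  show "E \<le> Z + c" if c: "\<And>x. 1 - \<phi> x \<le> c"
  proof -
    have "A \<omega> \<le> nexp (\<Sum>n. v (X n \<omega>)) + c" for \<omega>
    proof -
      have "A \<omega> * (1 - \<phi> (X (near \<omega>) \<omega>)) \<le> 1 * (1 - \<phi> (X (near \<omega>) \<omega>))"
        by (intro mult_right_mono) (auto simp: A01 \<phi>01)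
      then show ?thesis using c[of "X (near \<omega>) \<omega>"] by (simp add: all algebra_simps)
    qed
    then have "expectation A \<le> expectation (\<lambda>\<omega>. nexp (\<Sum>n. v (X n \<omega>)) + c)"
      using iA iv by (intro integral_mono) auto
    then show ?thesis using iv unfolding EA Z[symmetric] by (simp add: prob_space)
  qed
  show "E \<le> Z / d" if d: "\<And>x. d \<le> \<phi> x" "0 < d"
  proof -
    have "A \<omega> \<le> nexp (\<Sum>n. v (X n \<omega>)) / d" for \<omega>
      using d mult_left_mono[OF d(1)[of "X (near \<omega>) \<omega>"] A01(1)[of \<omega>]] by (simp add: all field_simps)
    then have "expectation A \<le> expectation (\<lambda>\<omega>. nexp (\<Sum>n. v (X n \<omega>)) / d)"
      using iA iv by (intro integral_mono) auto
    then show ?thesis using iv unfolding EA Z[symmetric] by simp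
  qed
qed


section \<open>Laplace transforms in the cellular network\<close>

lemma cellular_networkD:
  assumes "cellular_network M lam X \<theta> h0 h g"
  shows "homogeneous_PPP M lam X" "independent_marks M X (case_sum (fading h0 h g) \<theta>)"
    "distr M borel (\<theta> n) = uniform_measure lborel {-pi..pi}"
    "h0 \<in> borel_measurable M" "h n \<in> borel_measurable M" "g n \<in> borel_measurable M" "\<theta> n \<in> borel_measurable M"
proof -
  show marks: "independent_marks M X (case_sum (fading h0 h g) \<theta>)"
    and "homogeneous_PPP M lam X" "distr M borel (\<theta> n) = uniform_measure lborel {-pi..pi}"
    using assms by (auto simp: cellular_network_def)
  show "h0 \<in> borel_measurable M" "h n \<in> borel_measurable M" "g n \<in> borel_measurable M" "\<theta> n \<in> borel_measurable M"
    using marks_measurable[OF marks, of "Inl Desired"] marks_measurable[OF marks, of "Inl (Towards n)"]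
      marks_measurable[OF marks, of "Inl (Away n)"] marks_measurable[OF marks, of "Inr n"] by simp_all
qed

lemma prob_main_lobe:
  assumes \<theta>: "distr M borel \<theta> = uniform_measure lborel {-pi..pi}" "\<theta> \<in> borel_measurable M" and b: "0 \<le> b" "b \<le> pi"
  shows "prob {\<omega> \<in> space M. \<bar>\<theta> \<omega>\<bar> \<le> b} = b / pi"
proof -
  have "{\<omega> \<in> space M. \<bar>\<theta> \<omega>\<bar> \<le> b} = \<theta> -` {-b..b} \<inter> space M" by auto
  then have "prob {\<omega> \<in> space M. \<bar>\<theta> \<omega>\<bar> \<le> b} = measure (distr M borel \<theta>) {-b..b}"
    using \<theta>(2) by (simp add: measure_distr)
  also have "\<dots> = measure lborel ({-pi..pi} \<inter> {-b..b}) / measure lborel {-pi..pi}"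
    unfolding \<theta>(1) by (rule measure_uniform_measure) auto
  also have "{-pi..pi} \<inter> {-b..b} = {-b..b}" using b by auto
  finally show ?thesis using b by simp
qed

lemma identically_distributed_expectation:
  assumes "identically_distributed M f" "\<And>n. f n \<in> borel_measurable M" and [measurable]: "F \<in> borel_measurable borel"
  shows "expectation (\<lambda>\<omega>. F (f n \<omega>) :: real) = expectation (\<lambda>\<omega>. F (f 0 \<omega>))"
proof -
  note [measurable] = assms(2)
  have "expectation (\<lambda>\<omega>. F (f n \<omega>)) = integral\<^sup>L (distr M borel (f n)) F"
    by (rule integral_distr[symmetric]) measurable
  also have "distr M borel (f n) = distr M borel (f 0)"
    using assms(1) unfolding identically_distributed_def by blast
  also have "integral\<^sup>L (distr M borel (f 0)) F = expectation (\<lambda>\<omega>. F (f 0 \<omega>))"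
    by (rule integral_distr) measurable
  finally show ?thesis .
qed

text \<open>The angle is independent of each fading variable, so a single term has a mixture of two
  transforms. Since b is half the beamwidth, b / pi is the main-lobe probability.\<close>

lemma mark_expectation:
  assumes net: "cellular_network M lam X \<theta> h0 h g"
    and id: "identically_distributed M h" "identically_distributed M g"
    and b: "0 \<le> b" "b \<le> pi"
    and [measurable]: "F \<in> borel_measurable borel" "G \<in> borel_measurable borel"
  shows "expectation (\<lambda>\<omega>. nexp (if \<bar>\<theta> n \<omega>\<bar> \<le> b then F (h n \<omega>) else G (g n \<omega>)))
       = b / pi * expectation (\<lambda>\<omega>. nexp (F (h 0 \<omega>))) + (1 - b / pi) * expectation (\<lambda>\<omega>. nexp (G (g 0 \<omega>)))"
proof -
  let ?W = "case_sum (fading h0 h g) \<theta>"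
  note [measurable] = cellular_networkD(4-7)[OF net]
  have W: "indep_vars (\<lambda>_. borel) ?W UNIV"
    using cellular_networkD(2)[OF net] by (simp add: independent_marks_def)
  \<comment> \<open>One fact for both lobes: u will be the indicator of the beam or of its
    complement, v the transform of the corresponding fading.\<close>
  have ind: "indep_var borel (\<lambda>\<omega>. u (\<theta> n \<omega>)) borel (\<lambda>\<omega>. v (?W (Inl i) \<omega>))"
    if [measurable]: "u \<in> borel_measurable borel" "v \<in> borel_measurable borel" for u v :: "real \<Rightarrow> real" and i
  proof -
    have "indep_var (Pi\<^sub>M {Inr n} (\<lambda>_. borel)) (\<lambda>\<omega>. \<lambda>i\<in>{Inr n}. ?W i \<omega>) (Pi\<^sub>M {Inl i} (\<lambda>_. borel)) (\<lambda>\<omega>. \<lambda>i\<in>{Inl i}. ?W i \<omega>)"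
      by (rule indep_var_restrict[OF W]) auto
    from indep_var_compose[OF this, of "\<lambda>f. u (f (Inr n))" borel "\<lambda>f. v (f (Inl i))" borel]
    show ?thesis by (simp add: comp_def)
  qed
  let ?A = "{-b..b}"
  have p: "expectation (\<lambda>\<omega>. indicator ?A (\<theta> n \<omega>)) = b / pi"
  proof -
    have "expectation (\<lambda>\<omega>. indicator ?A (\<theta> n \<omega>)) = expectation (indicator {\<omega> \<in> space M. \<bar>\<theta> n \<omega>\<bar> \<le> b})"
      by (intro Bochner_Integration.integral_cong) (auto split: split_indicator)
    also have "\<dots> = prob {\<omega> \<in> space M. \<bar>\<theta> n \<omega>\<bar> \<le> b}" by simp
    finally show ?thesis using prob_main_lobe[OF cellular_networkD(3,7)[OF net] b] by simp
  qed
  have q: "expectation (\<lambda>\<omega>. 1 - indicator ?A (\<theta> n \<omega>)) = 1 - b / pi"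
    using p by (subst Bochner_Integration.integral_diff) (auto simp: prob_space intro!: integrable_const_bound[where B = 1])
  have iF: "integrable M (\<lambda>\<omega>. nexp (F (h n \<omega>)))" "integrable M (\<lambda>\<omega>. nexp (G (g n \<omega>)))" by simp_all
  have iA: "integrable M (\<lambda>\<omega>. indicator ?A (\<theta> n \<omega>) :: real)" "integrable M (\<lambda>\<omega>. 1 - indicator ?A (\<theta> n \<omega>) :: real)"
    by (auto intro!: integrable_const_bound[where B = 1])
  have ind1: "indep_var borel (\<lambda>\<omega>. indicator ?A (\<theta> n \<omega>) :: real) borel (\<lambda>\<omega>. nexp (F (h n \<omega>)))"
    using ind[of "indicator ?A" "\<lambda>y. nexp (F y)" "Towards n"] by simp
  have ind2: "indep_var borel (\<lambda>\<omega>. 1 - indicator ?A (\<theta> n \<omega>) :: real) borel (\<lambda>\<omega>. nexp (G (g n \<omega>)))"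
    using ind[of "\<lambda>y. 1 - indicator ?A y" "\<lambda>y. nexp (G y)" "Away n"] by simp
  have "expectation (\<lambda>\<omega>. nexp (if \<bar>\<theta> n \<omega>\<bar> \<le> b then F (h n \<omega>) else G (g n \<omega>)))
      = expectation (\<lambda>\<omega>. indicator ?A (\<theta> n \<omega>) * nexp (F (h n \<omega>)) + (1 - indicator ?A (\<theta> n \<omega>)) * nexp (G (g n \<omega>)))"
    by (intro Bochner_Integration.integral_cong) (auto split: split_indicator)
  also have "\<dots> = expectation (\<lambda>\<omega>. indicator ?A (\<theta> n \<omega>) * nexp (F (h n \<omega>))) + expectation (\<lambda>\<omega>. (1 - indicator ?A (\<theta> n \<omega>)) * nexp (G (g n \<omega>)))"
    by (rule Bochner_Integration.integral_add[OF indep_var_integrable[OF ind1 iA(1) iF(1)] indep_var_integrable[OF ind2 iA(2) iF(2)]])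
  also have "\<dots> = b / pi * expectation (\<lambda>\<omega>. nexp (F (h n \<omega>))) + (1 - b / pi) * expectation (\<lambda>\<omega>. nexp (G (g n \<omega>)))"
    by (simp only: indep_var_lebesgue_integral[OF ind1 iA(1) iF(1)] indep_var_lebesgue_integral[OF ind2 iA(2) iF(2)] p q)
  also have "expectation (\<lambda>\<omega>. nexp (F (h n \<omega>))) = expectation (\<lambda>\<omega>. nexp (F (h 0 \<omega>)))"
    by (rule identically_distributed_expectation[OF id(1)]) measurable
  also have "expectation (\<lambda>\<omega>. nexp (G (g n \<omega>))) = expectation (\<lambda>\<omega>. nexp (G (g 0 \<omega>)))"
    by (rule identically_distributed_expectation[OF id(2)]) measurable
  finally show ?thesis .
qed

text \<open>F and G are left free for two uses: the true contributions give the limit, while F = 0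
  with a truncated G gives the decay in t.\<close>

lemma network_laplace:
  assumes net: "cellular_network M lam X \<theta> h0 h g" and lam: "0 \<le> lam"
    and id: "identically_distributed M h" "identically_distributed M g"
    and b: "0 \<le> b" "b \<le> pi"
    and F [measurable]: "F \<in> borel_measurable (borel \<Otimes>\<^sub>M borel)" "G \<in> borel_measurable (borel \<Otimes>\<^sub>M borel)"
  defines "\<phi> \<equiv> \<lambda>x. b / pi * expectation (\<lambda>\<omega>. nexp (F (x, h 0 \<omega>))) + (1 - b / pi) * expectation (\<lambda>\<omega>. nexp (G (x, g 0 \<omega>)))"
  defines "Z \<equiv> nexp (ennreal lam * (\<integral>\<^sup>+x. ennreal (1 - \<phi> x) \<partial>lborel))"
    and "E \<equiv> expectation (\<lambda>\<omega>. nexp (\<Sum>n. if n \<noteq> nearest (\<lambda>n. X n \<omega>)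
        then (if \<bar>\<theta> n \<omega>\<bar> \<le> b then F (X n \<omega>, h n \<omega>) else G (X n \<omega>, g n \<omega>)) else 0))"
  shows "Z \<le> E"
    and "(\<And>x. 1 - \<phi> x \<le> c) \<Longrightarrow> E \<le> Z + c"
    and "(\<And>x. d \<le> \<phi> x) \<Longrightarrow> 0 < d \<Longrightarrow> E \<le> Z / d"
proof -
  \<comment> \<open>Both fadings and the angle of a station; \<open>Desired\<close> belongs to no
    block.\<close>
  define K where "K n = {Inl (Towards n), Inl (Away n), Inr n :: link + nat}" for n
  define Q where "Q n z = (if \<bar>snd z (Inr n)\<bar> \<le> b then F (fst z, snd z (Inl (Towards n))) else G (fst z, snd z (Inl (Away n))))"
    for n and z :: "(real^2) \<times> (link + nat \<Rightarrow> real)"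
  let ?W = "case_sum (fading h0 h g) \<theta>"
  have K: "disjoint_family K" by (auto simp: disjoint_family_on_def K_def)
  have c [measurable]: "(\<lambda>z. snd z i) \<in> borel_measurable (borel \<Otimes>\<^sub>M Pi\<^sub>M (K n) (\<lambda>_. borel))" if "i \<in> K n" for i n
    by (rule measurable_compose[OF measurable_snd measurable_component_singleton[OF that]])
  have Q: "Q n \<in> borel_measurable (borel \<Otimes>\<^sub>M Pi\<^sub>M (K n) (\<lambda>_. borel))" for n
  proof -
    note [measurable] = c[of "Inr n" n] c[of "Inl (Towards n)" n] c[of "Inl (Away n)" n]
    have "Inr n \<in> K n" "Inl (Towards n) \<in> K n" "Inl (Away n) \<in> K n" by (auto simp: K_def)
    then show ?thesis unfolding Q_def[abs_def] by measurable
  qed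
  have QW: "Q n (x, \<lambda>i\<in>K n. ?W i \<omega>) = (if \<bar>\<theta> n \<omega>\<bar> \<le> b then F (x, h n \<omega>) else G (x, g n \<omega>))" for n x \<omega>
    by (simp add: Q_def K_def)
  have \<phi>: "expectation (\<lambda>\<omega>. nexp (Q n (x, \<lambda>i\<in>K n. ?W i \<omega>))) = \<phi> x" for n x
    unfolding QW \<phi>_def by (rule mark_expectation[OF net id b]) measurable
  note * = marked_PPP_laplace(2-4)[OF cellular_networkD(1)[OF net] lam cellular_networkD(2)[OF net] K Q \<phi>, unfolded QW, folded Z_def E_def]
  show "Z \<le> E"
    and "(\<And>x. 1 - \<phi> x \<le> c) \<Longrightarrow> E \<le> Z + c"
    and "(\<And>x. d \<le> \<phi> x) \<Longrightarrow> 0 < d \<Longrightarrow> E \<le> Z / d"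
    by (fact *)+
qed

end

section \<open>Convergence of the Laplace transform\<close>

lemma tendsto_scaled_exp:
  assumes "0 \<le> (y::real)"
  shows "((\<lambda>lam. lam * (1 - exp (- (y / lam)))) \<longlongrightarrow> y) at_top"
proof (cases "y = 0")
  case False
  with assms have "0 < y" by simp
  then show ?thesis by real_asymp
qed simp

context prob_space
begin

abbreviation laplace :: "('a \<Rightarrow> real) \<Rightarrow> real \<Rightarrow> real" where
  "laplace f s \<equiv> expectation (\<lambda>\<omega>. exp (- (s * f \<omega>)))"

lemma unit_mean_fadingD:
  assumes "unit_mean_fading M f"
  shows "AE \<omega> in M. 0 \<le> f \<omega>" "integrable M f" "expectation f = 1" "f \<in> borel_measurable M"
  using assms by (auto simp: unit_mean_fading_def)

lemma integrable_exp_fading: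
  assumes f: "unit_mean_fading M f" and s: "0 \<le> s"
  shows "integrable M (\<lambda>\<omega>. exp (- (s * f \<omega>)))"
proof (rule integrable_const_bound[where B = 1])
  note [measurable] = unit_mean_fadingD(4)[OF f]
  show "(\<lambda>\<omega>. exp (- (s * f \<omega>))) \<in> borel_measurable M" by measurable
  show "AE \<omega> in M. norm (exp (- (s * f \<omega>))) \<le> 1"
    using unit_mean_fadingD(1)[OF f] by eventually_elim (use s in auto)
qed

lemma nexp_fading:
  assumes f: "unit_mean_fading M f" and s: "0 \<le> s"
  shows "expectation (\<lambda>\<omega>. nexp (ennreal (s * f \<omega>))) = laplace f s"
proof (rule integral_cong_AE)
  note [measurable] = unit_mean_fadingD(4)[OF f]
  show "(\<lambda>\<omega>. nexp (ennreal (s * f \<omega>))) \<in> borel_measurable M" "(\<lambda>\<omega>. exp (- (s * f \<omega>))) \<in> borel_measurable M"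
    by measurable
  show "AE \<omega> in M. nexp (ennreal (s * f \<omega>)) = exp (- (s * f \<omega>))"
    using unit_mean_fadingD(1)[OF f] by eventually_elim (use s in \<open>auto simp: nexp_ennreal\<close>)
qed

text \<open>The last bound is exp (- y) \<ge> 1 - y integrated with the unit mean. It supplies the
  dominating functions for the integrals over the plane.\<close>

lemma laplace_fading_bounds:
  assumes f: "unit_mean_fading M f" and s: "0 \<le> s"
  shows "laplace f s \<le> 1" "0 \<le> laplace f s"
    "1 - laplace f s \<le> s"
proof -
  note i = integrable_exp_fading[OF f s]
  have "AE \<omega> in M. exp (- (s * f \<omega>)) \<le> 1"
    using unit_mean_fadingD(1)[OF f] by eventually_elim (use s in auto)
  then show "laplace f s \<le> 1"
    by (intro integral_le_const i)
  show "0 \<le> laplace f s" by (intro Bochner_Integration.integral_nonneg) simp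
  have "expectation (\<lambda>\<omega>. 1 - s * f \<omega>) \<le> laplace f s"
  proof (rule integral_mono[OF _ i])
    show "1 - s * f \<omega> \<le> exp (- (s * f \<omega>))" for \<omega>
      using exp_ge_add_one_self[of "- (s * f \<omega>)"] by simp
  qed (use unit_mean_fadingD(2)[OF f] in simp)
  then show "1 - laplace f s \<le> s"
    using unit_mean_fadingD(2,3)[OF f] by (simp add: prob_space)
qed

lemma laplace_fading_measurable:
  assumes "unit_mean_fading M f"
  shows "(\<lambda>s. laplace f s) \<in> borel_measurable borel"
proof -
  note [measurable] = unit_mean_fadingD(4)[OF assms]
  show ?thesis by (rule borel_measurable_lebesgue_integral) measurable
qed

lemma integrable_laplace_defect:
  assumes f: "unit_mean_fading M f" and L: "physically_feasible L" and t: "0 \<le> t"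
  shows "integrable lborel (\<lambda>x :: real^2. 1 - laplace f (t * L (norm x)))"
proof (rule Bochner_Integration.integrable_bound)
  note [measurable] = physically_feasible_norm_measurable[OF L] laplace_fading_measurable[OF f]
  have L0: "0 \<le> L (norm x)" for x :: "real^2" using L by (auto simp: physically_feasible_def)
  show "integrable lborel (\<lambda>x :: real^2. t * L (norm x))" using integrable_path_loss(1)[OF L] by simp
  show "(\<lambda>x :: real^2. 1 - laplace f (t * L (norm x))) \<in> borel_measurable lborel"
    by measurable
  show "AE x :: real^2 in lborel. norm (1 - laplace f (t * L (norm x))) \<le> norm (t * L (norm x))"
  proof (rule AE_I2)
    fix x :: "real^2"
    have "0 \<le> t * L (norm x)" using t L0 by simp
    then show "norm (1 - laplace f (t * L (norm x))) \<le> norm (t * L (norm x))"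
      using laplace_fading_bounds[OF f, of "t * L (norm x)"] by simp
  qed
qed

text \<open>The derivative of a Laplace transform at 0 is minus the mean; s * f dominates because 1
  - exp (- y) \<le> y.\<close>

lemma laplace_fading_scaled_limit:
  assumes f: "unit_mean_fading M f" and s: "0 \<le> s"
  shows "((\<lambda>lam. lam * (1 - laplace f (s / lam))) \<longlongrightarrow> s) at_top"
proof -
  note [measurable] = unit_mean_fadingD(4)[OF f]
  have lim: "((\<lambda>lam. expectation (\<lambda>\<omega>. lam * (1 - exp (- (s / lam * f \<omega>))))) \<longlongrightarrow> expectation (\<lambda>\<omega>. s * f \<omega>)) at_top"
  proof (rule integral_dominated_convergence_at_top)
    show "integrable M (\<lambda>\<omega>. s * f \<omega>)" using unit_mean_fadingD(2)[OF f] by simp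
    show "AE \<omega> in M. ((\<lambda>lam. lam * (1 - exp (- (s / lam * f \<omega>)))) \<longlongrightarrow> s * f \<omega>) at_top"
      using unit_mean_fadingD(1)[OF f] by eventually_elim (use s tendsto_scaled_exp[of "s * f _"] in simp)
    show "\<forall>\<^sub>F lam in at_top. AE \<omega> in M. norm (lam * (1 - exp (- (s / lam * f \<omega>)))) \<le> s * f \<omega>"
      using eventually_gt_at_top[of 0]
    proof eventually_elim
      case (elim lam)
      show ?case using unit_mean_fadingD(1)[OF f]
      proof eventually_elim
        case (elim \<omega>)
        have "0 \<le> s / lam * f \<omega>" using s elim \<open>0 < lam\<close> by simp
        then have "0 \<le> 1 - exp (- (s / lam * f \<omega>))" by simp
        moreover have "1 - exp (- (s / lam * f \<omega>)) \<le> s / lam * f \<omega>"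
          using exp_ge_add_one_self[of "- (s / lam * f \<omega>)"] by simp
        then have "lam * (1 - exp (- (s / lam * f \<omega>))) \<le> lam * (s / lam * f \<omega>)"
          by (rule mult_left_mono[OF _ less_imp_le[OF \<open>0 < lam\<close>]])
        moreover have "lam * (s / lam * f \<omega>) = s * f \<omega>" using \<open>0 < lam\<close> by simp
        ultimately show ?case using \<open>0 < lam\<close> by (simp only: real_norm_def abs_mult abs_of_pos abs_of_nonneg)
      qed
    qed
  qed measurable
  have s': "expectation (\<lambda>\<omega>. s * f \<omega>) = s" using unit_mean_fadingD(3)[OF f] by simp
  have ev: "\<forall>\<^sub>F lam in at_top. expectation (\<lambda>\<omega>. lam * (1 - exp (- (s / lam * f \<omega>)))) = lam * (1 - laplace f (s / lam))"
    using eventually_gt_at_top[of 0]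
  proof eventually_elim
    case (elim lam)
    show ?case using integrable_exp_fading[OF f, of "s / lam"] s elim by (simp add: prob_space)
  qed
  show ?thesis using Lim_transform_eventually[OF lim ev] by (simp only: s')
qed

text \<open>The law of large numbers for the side lobes: their strength falls like 1 /
  \<open>lam\<close> while their number grows like \<open>lam\<close>, so only the mean of the
  fading survives. The dominating function is s * L.\<close>

lemma laplace_defect_scaled_limit:
  assumes f: "unit_mean_fading M f" and L: "physically_feasible L" and s: "0 \<le> s"
  shows "((\<lambda>lam. lam * (\<integral>x. 1 - laplace f (s / lam * L (norm (x :: real^2))) \<partial>lborel))
    \<longlongrightarrow> s * (2 * pi * path_loss_moment L)) at_top"
proof -
  note [measurable] = physically_feasible_norm_measurable[OF L] laplace_fading_measurable[OF f]
  have L0: "0 \<le> L (norm x)" for x :: "real^2" using L by (auto simp: physically_feasible_def)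
  have "((\<lambda>lam. \<integral>x. lam * (1 - laplace f (s / lam * L (norm (x :: real^2)))) \<partial>lborel)
    \<longlongrightarrow> (\<integral>x. s * L (norm (x :: real^2)) \<partial>lborel)) at_top"
  proof (rule integral_dominated_convergence_at_top)
    show "integrable lborel (\<lambda>x :: real^2. s * L (norm x))" using integrable_path_loss(1)[OF L] by simp
    show "AE x :: real^2 in lborel. ((\<lambda>lam. lam * (1 - laplace f (s / lam * L (norm x)))) \<longlongrightarrow> s * L (norm x)) at_top"
    proof (rule AE_I2)
      fix x :: "real^2"
      show "((\<lambda>lam. lam * (1 - laplace f (s / lam * L (norm x)))) \<longlongrightarrow> s * L (norm x)) at_top"
        using s L0[of x] laplace_fading_scaled_limit[OF f, of "s * L (norm x)"] by simp
    qed
    show "\<forall>\<^sub>F lam in at_top. AE x :: real^2 in lborel. norm (lam * (1 - laplace f (s / lam * L (norm x)))) \<le> s * L (norm x)"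
      using eventually_gt_at_top[of 0]
    proof eventually_elim
      case (elim lam)
      show ?case
      proof (intro AE_I2)
        fix x :: "real^2"
        have "0 \<le> s / lam * L (norm x)" using s elim L0 by simp
        note * = laplace_fading_bounds[OF f this]
        have "lam * (1 - laplace f (s / lam * L (norm x))) \<le> lam * (s / lam * L (norm x))"
          using elim * by (intro mult_left_mono) auto
        also have "\<dots> = s * L (norm x)" using elim by simp
        finally show "norm (lam * (1 - laplace f (s / lam * L (norm x)))) \<le> s * L (norm x)"
          using elim *(1) by (simp only: real_norm_def abs_mult abs_of_pos abs_of_nonneg diff_ge_0_iff_ge)
      qed
    qed
  qed measurable
  then show ?thesis by (simp add: integrable_path_loss(2)[OF L])
qed

end

section \<open>The normalised load and the limit of its Laplace transform\<close>

locale massive_mimo = prob_space M for M :: "'a measure" +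
  fixes L Gmax :: "real \<Rightarrow> real" and \<alpha> \<beta> \<zeta> \<sigma> :: real
    and X :: "real \<Rightarrow> nat \<Rightarrow> 'a \<Rightarrow> real^2" and \<theta> :: "real \<Rightarrow> nat \<Rightarrow> 'a \<Rightarrow> real"
    and h0 :: "'a \<Rightarrow> real" and h g :: "nat \<Rightarrow> 'a \<Rightarrow> real"
  assumes pos: "0 < \<alpha>" "0 < \<beta>" "0 < \<zeta>" "0 < \<sigma>"
    and Gmax_pos: "\<And>N. 0 < N \<Longrightarrow> 0 < Gmax N"
    and Gmax_lim: "filterlim Gmax at_top at_top"
    and L: "physically_feasible L"
    and fading: "unit_mean_fading M h0" "\<And>n. unit_mean_fading M (h n)" "\<And>n. unit_mean_fading M (g n)"
    and identical: "identically_distributed M h" "identically_distributed M g"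
    and net: "\<And>lam. 0 < lam \<Longrightarrow> cellular_network M lam (X lam) (\<theta> lam) h0 h g"
begin

abbreviation near :: "real \<Rightarrow> 'a \<Rightarrow> nat" where
  "near lam \<omega> \<equiv> nearest (\<lambda>n. X lam n \<omega>)"

abbreviation half_beam :: "real \<Rightarrow> real" where
  "half_beam lam \<equiv> \<beta> / (\<zeta> * lam) / 2"

text \<open>Interference and noise relative to the main-lobe gain.\<close>

definition interference :: "real \<Rightarrow> 'a \<Rightarrow> ennreal" where
  "interference lam \<omega> = (\<Sum>n. if n \<noteq> near lam \<omega>
     then (if \<bar>\<theta> lam n \<omega>\<bar> \<le> half_beam lam then ennreal (L (norm (X lam n \<omega>)) * h n \<omega>)
           else ennreal (L (norm (X lam n \<omega>)) * g n \<omega> / (\<alpha> * \<zeta> * lam)))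
     else 0)"

definition noise :: "real \<Rightarrow> real" where
  "noise lam = \<sigma>\<^sup>2 / Gmax (\<zeta> * lam)"

definition attenuation :: "real \<Rightarrow> 'a \<Rightarrow> real" where
  "attenuation lam \<omega> = L (norm (X lam (near lam \<omega>) \<omega>)) / L 0"

definition load :: "real \<Rightarrow> 'a \<Rightarrow> ennreal" where
  \<comment> \<open>For positive \<open>lam\<close> the noise is positive, so a serving station with
    attenuation 0 yields load \<open>\<top>\<close> and never 0 / 0; the reciprocal is then 0, like
    the SINR.\<close>
  "load lam \<omega> = (interference lam \<omega> + ennreal (noise lam)) / ennreal (attenuation lam \<omega>)"

abbreviation interference_laplace :: "real \<Rightarrow> real \<Rightarrow> real" where
  "interference_laplace lam t \<equiv> expectation (\<lambda>\<omega>. nexp (ennreal t * interference lam \<omega>))"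

abbreviation load_laplace :: "real \<Rightarrow> real \<Rightarrow> real" where
  "load_laplace lam t \<equiv> expectation (\<lambda>\<omega>. nexp (ennreal t * load lam \<omega>))"

definition side_rate :: real where
  "side_rate = 2 * pi * path_loss_moment L / (\<alpha> * \<zeta>)"

text \<open>The exponent that the Laplace functional assigns to a process of unit intensity with
  marks distributed like \<open>h 0\<close>.\<close>

definition main_defect :: "real \<Rightarrow> real" where
  "main_defect t = (\<integral>x. 1 - laplace (h 0) (t * L (norm (x :: real^2))) \<partial>lborel)"

definition side_defect :: "real \<Rightarrow> real" where
  "side_defect t = (\<integral>x. 1 - laplace (g 0) (t * L (norm (x :: real^2))) \<partial>lborel)"

text \<open>Identified in \<open>limit_load_laplace\<close> as the transform of the limiting load;
  the closed form lets the mean be treated before the limiting process is introduced.\<close>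

definition limit_laplace :: "real \<Rightarrow> real" where
  "limit_laplace t = exp (- (side_rate * t + \<beta> / (2 * pi * \<zeta>) * main_defect t))"

lemma L_bounds: "0 \<le> r \<Longrightarrow> 0 \<le> L r" "0 \<le> r \<Longrightarrow> L r \<le> L 0" "0 < L 0"
  using L by (auto simp: physically_feasible_def)

lemma side_rate_pos: "0 < side_rate"
  using path_loss_moment_pos[OF L] pos by (simp add: side_rate_def)

lemma main_defect_nonneg: "0 \<le> t \<Longrightarrow> 0 \<le> main_defect t"
  unfolding main_defect_def
  by (intro Bochner_Integration.integral_nonneg) (simp add: laplace_fading_bounds[OF fading(2)] L_bounds)

lemma side_defect_nonneg: "0 \<le> t \<Longrightarrow> 0 \<le> side_defect t"
  unfolding side_defect_def
  by (intro Bochner_Integration.integral_nonneg) (simp add: laplace_fading_bounds[OF fading(3)] L_bounds)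

lemma fading_measurable [measurable]:
  "h0 \<in> borel_measurable M" "h n \<in> borel_measurable M" "g n \<in> borel_measurable M"
  using fading by (auto dest: unit_mean_fadingD)

lemma L_norm_measurable [measurable]: "(\<lambda>x. L (norm x)) \<in> borel_measurable (borel :: 'b::euclidean_space measure)"
  by (rule physically_feasible_norm_measurable[OF L])

lemma network_measurable:
  assumes "0 < lam"
  shows "X lam n \<in> borel_measurable M" "\<theta> lam n \<in> borel_measurable M"
    "near lam \<in> measurable M (count_space UNIV)"
    "interference lam \<in> borel_measurable M" "attenuation lam \<in> borel_measurable M" "load lam \<in> borel_measurable M"
proof -
  note net = net[OF assms]
  show X [measurable]: "X lam n \<in> borel_measurable M" for n by (rule PPP_measurable[OF cellular_networkD(1)[OF net]])
  show \<theta> [measurable]: "\<theta> lam n \<in> borel_measurable M" for n by (rule cellular_networkD(7)[OF net])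
  have [measurable]: "(\<lambda>\<omega> n. X lam n \<omega>) \<in> measurable M (Pi\<^sub>M UNIV (\<lambda>_. borel))"
    by (rule process_measurable) (rule X)
  show near [measurable]: "near lam \<in> measurable M (count_space UNIV)" by measurable
  show [measurable]: "interference lam \<in> borel_measurable M"
    unfolding interference_def[abs_def] by measurable
  show [measurable]: "attenuation lam \<in> borel_measurable M"
    unfolding attenuation_def[abs_def] by measurable
  show "load lam \<in> borel_measurable M"
    unfolding load_def[abs_def] by measurable
qed

text \<open>p is the main-lobe probability and \<open>t / (\<alpha> * \<zeta>) / lam\<close> the
  strength of a side lobe. The additive error bounds the defect 1 - \<phi> of one station: at most p
  from the main lobe and, by the unit mean, at most strength times \<open>L 0\<close> from the side
  lobe. Both are of order 1 / \<open>lam\<close>.\<close>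

lemma interference_laplace_bounds:
  assumes lam: "0 < lam" "half_beam lam \<le> pi" and t: "0 \<le> t"
  defines "p \<equiv> half_beam lam / pi"
  defines "Z \<equiv> exp (- (lam * (p * main_defect t + (1 - p) * side_defect (t / (\<alpha> * \<zeta>) / lam))))"
  shows "Z \<le> interference_laplace lam t"
    and "interference_laplace lam t \<le> Z + (p + t / (\<alpha> * \<zeta>) / lam * L 0)"
proof -
  define u where "u = t / (\<alpha> * \<zeta>) / lam"
  have u: "0 \<le> u" using pos lam t by (simp add: u_def)
  have p: "0 \<le> p" "p \<le> 1" using pos lam(1) divide_right_mono[OF lam(2), of pi] by (simp_all add: p_def)
  define F G :: "(real^2) \<times> real \<Rightarrow> ennreal"
    where "F z = ennreal (t * L (norm (fst z)) * snd z)" and "G z = ennreal (u * L (norm (fst z)) * snd z)" for z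
  have [measurable]: "F \<in> borel_measurable (borel \<Otimes>\<^sub>M borel)" "G \<in> borel_measurable (borel \<Otimes>\<^sub>M borel)"
    unfolding F_def[abs_def] G_def[abs_def] by measurable
  define \<phi> where "\<phi> x = p * expectation (\<lambda>\<omega>. nexp (F (x, h 0 \<omega>))) + (1 - p) * expectation (\<lambda>\<omega>. nexp (G (x, g 0 \<omega>)))" for x
  have tL: "0 \<le> t * L (norm x)" "0 \<le> u * L (norm x)" for x :: "real^2" using t u L_bounds by auto
  have F: "expectation (\<lambda>\<omega>. nexp (F (x, h 0 \<omega>))) = laplace (h 0) (t * L (norm x))" for x
    unfolding F_def using nexp_fading[OF fading(2) tL(1)] by simp
  have G: "expectation (\<lambda>\<omega>. nexp (G (x, g 0 \<omega>))) = laplace (g 0) (u * L (norm x))" for x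
    unfolding G_def using nexp_fading[OF fading(3) tL(2)] by simp
  have \<phi>: "1 - \<phi> x = p * (1 - laplace (h 0) (t * L (norm x)))
      + (1 - p) * (1 - laplace (g 0) (u * L (norm x)))" for x
    by (simp add: \<phi>_def F G algebra_simps)
  have \<phi>0: "0 \<le> 1 - \<phi> x" for x
    unfolding \<phi> using p laplace_fading_bounds(1)[OF fading(2) tL(1)] laplace_fading_bounds(1)[OF fading(3) tL(2)]
    by (intro add_nonneg_nonneg mult_nonneg_nonneg) auto
  have \<phi>1: "1 - \<phi> x \<le> p + u * L 0" for x
  proof -
    have "1 - \<phi> x \<le> p * 1 + 1 * (u * L 0)"
      unfolding \<phi>
    proof (intro add_mono mult_mono)
      show "1 - laplace (g 0) (u * L (norm x)) \<le> u * L 0"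
        using laplace_fading_bounds(3)[OF fading(3)[of 0] tL(2)[of x]] mult_left_mono[OF L_bounds(2) u, of "norm x"] by simp
    qed (use p laplace_fading_bounds[OF fading(2) tL(1)] laplace_fading_bounds[OF fading(3) tL(2)] in auto)
    then show ?thesis by simp
  qed
  have I: "integrable lborel (\<lambda>x. p * (1 - laplace (h 0) (t * L (norm (x::real^2)))))"
     "integrable lborel (\<lambda>x. (1 - p) * (1 - laplace (g 0) (u * L (norm (x::real^2)))))"
    using integrable_laplace_defect[OF fading(2) L t] integrable_laplace_defect[OF fading(3) L u] by (auto intro!: integrable_mult_right)
  have int: "(\<integral>\<^sup>+x. ennreal (1 - \<phi> x) \<partial>lborel) = ennreal (p * main_defect t + (1 - p) * side_defect u)"
  proof -
    have "(\<integral>\<^sup>+x. ennreal (1 - \<phi> x) \<partial>lborel) = ennreal (\<integral>x. 1 - \<phi> x \<partial>lborel)"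
      using \<phi>0 Bochner_Integration.integrable_add[OF I] by (intro nn_integral_eq_integral) (auto simp: \<phi>)
    also have "(\<integral>x. 1 - \<phi> x \<partial>lborel) = p * main_defect t + (1 - p) * side_defect u"
      unfolding \<phi> Bochner_Integration.integral_add[OF I] by (simp add: main_defect_def side_defect_def)
    finally show ?thesis .
  qed
  have Z: "nexp (ennreal lam * (\<integral>\<^sup>+x. ennreal (1 - \<phi> x) \<partial>lborel)) = Z"
    unfolding int Z_def u_def[symmetric] using lam p main_defect_nonneg[OF t] side_defect_nonneg[OF u]
    by (subst ennreal_mult[symmetric]) (auto simp: nexp_ennreal simp del: ennreal_plus)
  have E: "ennreal t * interference lam \<omega> = (\<Sum>n. if n \<noteq> near lam \<omega>
      then (if \<bar>\<theta> lam n \<omega>\<bar> \<le> half_beam lam then F (X lam n \<omega>, h n \<omega>) else G (X lam n \<omega>, g n \<omega>)) else 0)" for \<omega>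
    unfolding interference_def using t
    by (subst ennreal_suminf_cmult[symmetric], intro suminf_cong)
       (auto simp: F_def G_def u_def mult_ac simp flip: ennreal_mult')
  have b: "0 \<le> half_beam lam" using pos lam by simp
  note * = network_laplace[OF net[OF lam(1)] less_imp_le[OF lam(1)] identical b lam(2), of F G, folded p_def, folded \<phi>_def, folded E]
  show "Z \<le> interference_laplace lam t"
    using *(1) by (simp add: Z)
  show "interference_laplace lam t \<le> Z + (p + t / (\<alpha> * \<zeta>) / lam * L 0)"
    using *(2)[of "p + u * L 0"] \<phi>1 by (simp add: Z u_def)
qed

lemma interference_laplace_limit:
  assumes t: "0 \<le> t"
  shows "((\<lambda>lam. interference_laplace lam t) \<longlongrightarrow> limit_laplace t) at_top"
proof -
  define p where "p lam = half_beam lam / pi" for lam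
  define Z where "Z lam = exp (- (lam * (p lam * main_defect t + (1 - p lam) * side_defect (t / (\<alpha> * \<zeta>) / lam))))" for lam
  have p0: "(p \<longlongrightarrow> 0) at_top"
    unfolding p_def[abs_def] using pos by real_asymp
  have Z: "(Z \<longlongrightarrow> limit_laplace t) at_top"
  proof -
    have "((\<lambda>lam. exp (- (\<beta> / (2 * pi * \<zeta>) * main_defect t + (1 - p lam) * (lam * side_defect (t / (\<alpha> * \<zeta>) / lam)))))
      \<longlongrightarrow> exp (- (\<beta> / (2 * pi * \<zeta>) * main_defect t + (1 - 0) * (t / (\<alpha> * \<zeta>) * (2 * pi * path_loss_moment L))))) at_top"
      unfolding side_defect_def using p0 t pos
      by (intro tendsto_intros laplace_defect_scaled_limit[OF fading(3) L]) auto
    moreover have "exp (- (\<beta> / (2 * pi * \<zeta>) * main_defect t + (1 - 0) * (t / (\<alpha> * \<zeta>) * (2 * pi * path_loss_moment L)))) = limit_laplace t"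
      by (simp add: limit_laplace_def side_rate_def algebra_simps)
    moreover have "\<forall>\<^sub>F lam in at_top. exp (- (\<beta> / (2 * pi * \<zeta>) * main_defect t + (1 - p lam) * (lam * side_defect (t / (\<alpha> * \<zeta>) / lam)))) = Z lam"
      using eventually_gt_at_top[of 0]
    proof eventually_elim
      case (elim lam)
      \<comment> \<open>Thinning: the density of the stations whose main lobe covers the user does
        not depend on \<open>lam\<close>.\<close>
      have "lam * p lam = \<beta> / (2 * pi * \<zeta>)" using elim by (simp add: p_def)
      moreover have "lam * (p lam * a + (1 - p lam) * b) = lam * p lam * a + (1 - p lam) * (lam * b)" for a b
        by (simp add: algebra_simps)
      ultimately show ?case by (simp only: Z_def)
    qed
    ultimately show ?thesis by (auto elim: Lim_transform_eventually)
  qed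
  have "((\<lambda>lam. half_beam lam) \<longlongrightarrow> 0) at_top" using pos by real_asymp
  then have "\<forall>\<^sub>F lam in at_top. half_beam lam < pi"
    by (rule order_tendstoD) simp
  then have ev: "\<forall>\<^sub>F lam in at_top. 0 < lam \<and> half_beam lam \<le> pi"
    using eventually_gt_at_top[of 0] by eventually_elim auto
  have u0: "((\<lambda>lam. t / (\<alpha> * \<zeta>) / lam * L 0) \<longlongrightarrow> 0) at_top" by real_asymp
  have up: "((\<lambda>lam. Z lam + (p lam + t / (\<alpha> * \<zeta>) / lam * L 0)) \<longlongrightarrow> limit_laplace t) at_top"
    using tendsto_add[OF Z tendsto_add[OF p0 u0]] by simp
  show ?thesis
  proof (rule tendsto_sandwich[OF _ _ Z up])
    show "\<forall>\<^sub>F lam in at_top. Z lam \<le> interference_laplace lam t"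
      using ev by eventually_elim (use interference_laplace_bounds(1)[OF _ _ t] in \<open>auto simp: Z_def p_def\<close>)
    show "\<forall>\<^sub>F lam in at_top. interference_laplace lam t \<le> Z lam + (p lam + t / (\<alpha> * \<zeta>) / lam * L 0)"
      using ev by eventually_elim (use interference_laplace_bounds(2)[OF _ _ t] in \<open>auto simp: Z_def p_def\<close>)
  qed
qed

lemma attenuation_bounds: "0 \<le> attenuation lam \<omega>" "attenuation lam \<omega> \<le> 1"
  using L_bounds by (auto simp: attenuation_def)

lemma noise_pos: "0 < lam \<Longrightarrow> 0 < noise lam"
  using pos Gmax_pos[of "\<zeta> * lam"] by (simp add: noise_def)

lemma noise_limit: "(noise \<longlongrightarrow> 0) at_top"
proof -
  have "filterlim (\<lambda>lam. \<zeta> * lam) at_top at_top" using pos by real_asymp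
  from filterlim_compose[OF Gmax_lim this] show ?thesis
    unfolding noise_def[abs_def] by (intro tendsto_divide_0[OF tendsto_const] filterlim_at_top_imp_at_infinity)
qed

text \<open>If a small disc of radius d holds a station, the serving one lies in it and its path
  loss is close to \<open>L 0\<close>; the disc is empty with probability exp (- \<open>lam\<close>
  pi d^2).\<close>

lemma attenuation_limit: "((\<lambda>lam. expectation (\<lambda>\<omega>. 1 - attenuation lam \<omega>)) \<longlongrightarrow> 0) at_top"
proof (rule tendstoI)
  fix e :: real assume e: "0 < e"
  have "\<forall>\<^sub>F r in at_right 0. L 0 * (1 - e / 2) < L r"
  proof (rule order_tendstoD(1))
    show "(L \<longlongrightarrow> L 0) (at_right 0)" using L unfolding physically_feasible_def by blast
    show "L 0 * (1 - e / 2) < L 0"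
      using mult_strict_left_mono[of "1 - e / 2" 1 "L 0"] e L_bounds(3) by simp
  qed
  then obtain d0 where d0: "0 < d0" "\<And>r. 0 < r \<Longrightarrow> r < d0 \<Longrightarrow> L 0 * (1 - e / 2) < L r"
    unfolding eventually_at_right_field by auto
  \<comment> \<open>Halved so that the closed disc stays within the open interval on which L is
    controlled.\<close>
  define d where "d = d0 / 2"
  have d: "0 < d" "\<And>r. 0 \<le> r \<Longrightarrow> r \<le> d \<Longrightarrow> L 0 * (1 - e / 2) \<le> L r"
  proof -
    show "0 < d" using d0 by (simp add: d_def)
    fix r assume "0 \<le> r" "r \<le> d"
    then show "L 0 * (1 - e / 2) \<le> L r"
      using d0(1) d0(2)[of r] mult_left_mono[of "1 - e / 2" 1 "L 0"] e L_bounds(3) by (cases "r = 0") (auto simp: d_def)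
  qed
  have "((\<lambda>lam. exp (- (lam * (pi * d\<^sup>2)))) \<longlongrightarrow> 0) at_top" using d(1) by real_asymp
  then have "\<forall>\<^sub>F lam in at_top. exp (- (lam * (pi * d\<^sup>2))) < e / 2"
    using e by (intro order_tendstoD(2)) auto
  then show "\<forall>\<^sub>F lam in at_top. dist (expectation (\<lambda>\<omega>. 1 - attenuation lam \<omega>)) 0 < e"
    using eventually_gt_at_top[of 0]
  proof eventually_elim
    case (elim lam)
    note [measurable] = network_measurable[OF elim(2)]
    define B where "B = {\<omega> \<in> space M. card {n. X lam n \<omega> \<in> cball 0 d} = 0}"
    have ppp: "homogeneous_PPP M lam (X lam)" using cellular_networkD(1)[OF net[OF elim(2)]] .
    have [measurable]: "B \<in> sets M"
    proof -
      have "(\<lambda>\<omega>. card {n. X lam n \<omega> \<in> cball 0 d}) \<in> measurable M (count_space UNIV)"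
        by (rule PPP_count_measurable[OF ppp]) auto
      then show ?thesis unfolding B_def by measurable
    qed
    have "measure lborel (cball (0::real^2) d) = pi * d\<^sup>2"
      using content_cball[of d "0::real^2"] d(1) by (simp add: unit_ball_vol_2)
    then have pB: "prob B = exp (- (lam * (pi * d\<^sup>2)))"
      using PPP_void_probability[OF ppp, of "cball 0 d"] by (simp add: B_def)
    have "1 - attenuation lam \<omega> \<le> e / 2 + indicator B \<omega>" if "\<omega> \<in> space M" for \<omega>
    proof (cases "\<omega> \<in> B")
      case True
      then show ?thesis using attenuation_bounds(1)[of lam \<omega>] e by simp
    next
      case False
      let ?I = "{n. X lam n \<omega> \<in> cball 0 d}"
      \<comment> \<open>\<open>B\<close> also contains the outcomes with infinitely many points in
        the disc, where \<open>card\<close> is 0. Outside \<open>B\<close> a nearest point exists,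
        so \<open>nearest\<close> is meaningful.\<close>
      have I: "finite ?I" "?I \<noteq> {}" using False that by (auto simp: B_def card_eq_0_iff)
      define k where "k = arg_min_on (\<lambda>n. norm (X lam n \<omega>)) ?I"
      have k: "k \<in> ?I" "\<And>n. n \<in> ?I \<Longrightarrow> norm (X lam k \<omega>) \<le> norm (X lam n \<omega>)"
        using arg_min_if_finite(1)[OF I] arg_min_least[OF I] by (auto simp: k_def)
      have "norm (X lam k \<omega>) \<le> norm (X lam m \<omega>)" for m
        using k by (cases "m \<in> ?I") auto
      then have "\<forall>m. norm (X lam (near lam \<omega>) \<omega>) \<le> norm (X lam m \<omega>)"
        unfolding nearest_def by (rule LeastI[of _ k, OF allI])
      then have "norm (X lam (near lam \<omega>) \<omega>) \<le> d" using k(1) by (auto intro: order_trans)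
      then have "L 0 * (1 - e / 2) \<le> L (norm (X lam (near lam \<omega>) \<omega>))" by (intro d(2)) auto
      then have "1 - e / 2 \<le> attenuation lam \<omega>"
        using L_bounds(3) by (simp add: attenuation_def field_simps)
      then show ?thesis using False by simp
    qed
    moreover have "integrable M (\<lambda>\<omega>. 1 - attenuation lam \<omega>)"
      by (rule integrable_const_bound[where B = 1]) (use attenuation_bounds in auto)
    moreover have "integrable M (\<lambda>\<omega>. e / 2 + indicator B \<omega>)"
      by (rule integrable_const_bound[where B = "e / 2 + 1"]) (use e in \<open>auto split: split_indicator\<close>)
    ultimately have "expectation (\<lambda>\<omega>. 1 - attenuation lam \<omega>) \<le> expectation (\<lambda>\<omega>. e / 2 + indicator B \<omega>)"
      by (intro integral_mono) auto
    also have "\<dots> = e / 2 + prob B"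
      by (subst Bochner_Integration.integral_add) (auto simp: prob_space intro!: integrable_const_bound[where B = 1])
    also have "\<dots> < e" using elim(1) by (simp add: pB)
    finally show ?case
      using attenuation_bounds by (simp add: abs_of_nonneg Bochner_Integration.integral_nonneg)
  qed
qed

text \<open>Attenuation only raises the load. The noise factor is retained because it makes the tail
  integral finite in \<open>tail_subexponential_gain\<close>.\<close>

lemma load_laplace_le:
  assumes "0 < lam" and t: "0 \<le> t"
  shows "load_laplace lam t \<le> exp (- (t * noise lam)) * interference_laplace lam t"
proof -
  note [measurable] = network_measurable[OF assms(1)]
  have "nexp (ennreal t * load lam \<omega>) \<le> exp (- (t * noise lam)) * nexp (ennreal t * interference lam \<omega>)" for \<omega>
  proof -
    have "nexp (ennreal t * load lam \<omega>) \<le> nexp (ennreal t * (interference lam \<omega> + ennreal (noise lam)))"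
      unfolding load_def ennreal_times_divide by (rule nexp_divide_le[OF attenuation_bounds])
    also have "\<dots> = exp (- (t * noise lam)) * nexp (ennreal t * interference lam \<omega>)"
      using t noise_pos[OF assms(1)] by (simp add: distrib_left nexp_add nexp_ennreal less_imp_le flip: ennreal_mult)
    finally show ?thesis .
  qed
  then have "load_laplace lam t \<le> expectation (\<lambda>\<omega>. exp (- (t * noise lam)) * nexp (ennreal t * interference lam \<omega>))"
    by (intro integral_mono) auto
  then show ?thesis by simp
qed

text \<open>By \<open>nexp_diff_divide_le\<close> the attenuation lowers the transform by at most
  its mean defect, whatever t is.\<close>

lemma load_laplace_limit:
  assumes t: "0 < t"
  shows "((\<lambda>lam. load_laplace lam t) \<longlongrightarrow> limit_laplace t) at_top"
proof -
  let ?E = "\<lambda>lam. exp (- (t * noise lam)) * interference_laplace lam t"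
  have "(?E \<longlongrightarrow> exp (- (t * 0)) * limit_laplace t) at_top"
    using t by (intro tendsto_intros noise_limit interference_laplace_limit) auto
  then have E: "(?E \<longlongrightarrow> limit_laplace t) at_top" by simp
  have E': "((\<lambda>lam. ?E lam - expectation (\<lambda>\<omega>. 1 - attenuation lam \<omega>)) \<longlongrightarrow> limit_laplace t) at_top"
    using tendsto_diff[OF E attenuation_limit] by simp
  have up: "\<forall>\<^sub>F lam in at_top. load_laplace lam t \<le> ?E lam"
    using eventually_gt_at_top[of 0] by eventually_elim (intro load_laplace_le less_imp_le[OF t])
  have low: "\<forall>\<^sub>F lam in at_top. ?E lam - expectation (\<lambda>\<omega>. 1 - attenuation lam \<omega>) \<le> load_laplace lam t"
    using eventually_gt_at_top[of 0]
  proof eventually_elim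
    case (elim lam)
    note [measurable] = network_measurable[OF elim]
    have "exp (- (t * noise lam)) * nexp (ennreal t * interference lam \<omega>) \<le> nexp (ennreal t * load lam \<omega>) + (1 - attenuation lam \<omega>)" for \<omega>
    proof -
      have "exp (- (t * noise lam)) * nexp (ennreal t * interference lam \<omega>) = nexp (ennreal t * (interference lam \<omega> + ennreal (noise lam)))"
        using t noise_pos[OF elim] by (simp add: distrib_left nexp_add nexp_ennreal less_imp_le flip: ennreal_mult)
      moreover have "0 < ennreal t * (interference lam \<omega> + ennreal (noise lam))"
        using t noise_pos[OF elim] by (simp add: ennreal_zero_less_mult_iff add_nonneg_pos)
      ultimately show ?thesis
        using nexp_diff_divide_le[OF attenuation_bounds, of "ennreal t * (interference lam \<omega> + ennreal (noise lam))" lam \<omega>]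
        by (simp add: load_def ennreal_times_divide)
    qed
    moreover have "integrable M (\<lambda>\<omega>. 1 - attenuation lam \<omega>)"
      by (rule integrable_const_bound[where B = 1]) (use attenuation_bounds in auto)
    ultimately have "expectation (\<lambda>\<omega>. exp (- (t * noise lam)) * nexp (ennreal t * interference lam \<omega>))
        \<le> expectation (\<lambda>\<omega>. nexp (ennreal t * load lam \<omega>) + (1 - attenuation lam \<omega>))"
      by (intro integral_mono Bochner_Integration.integrable_add integrable_mult_right) auto
    also have "\<dots> = load_laplace lam t + expectation (\<lambda>\<omega>. 1 - attenuation lam \<omega>)"
      using \<open>integrable M (\<lambda>\<omega>. 1 - attenuation lam \<omega>)\<close> by (intro Bochner_Integration.integral_add) auto
    finally show ?case by simp
  qed
  show ?thesis by (rule tendsto_sandwich[OF low up E' E])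
qed

end

section \<open>Convergence of the mean\<close>

text \<open>The convex function exp (- y) lies below its chord on [0, 1], and exp (- 1) \<le>
  1/2.\<close>

lemma half_le_one_minus_exp:
  assumes "0 \<le> y" "y \<le> (1::real)"
  shows "y / 2 \<le> 1 - exp (- y)"
proof -
  have "exp ((1 - y) *\<^sub>R 0 + y *\<^sub>R (- 1)) \<le> (1 - y) * exp 0 + y * exp (- 1)"
    using convex_onD[OF exp_convex, of y 0 "- 1"] assms by simp
  moreover have "exp (- 1) \<le> (1 / 2 :: real)"
    using exp_ge_add_one_self[of 1] by (simp add: exp_minus field_simps)
  then have "y * exp (- 1) \<le> y * (1 / 2)" using assms by (intro mult_left_mono) auto
  ultimately show ?thesis by simp
qed

text \<open>A variable below 1/2 almost surely cannot have mean 1. The result makes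
  \<open>side_weight\<close> a positive constant in the decay estimates.\<close>

lemma (in prob_space) unit_mean_fading_half:
  assumes f: "unit_mean_fading M f"
  shows "0 < prob {\<omega> \<in> space M. 1 / 2 \<le> f \<omega>}"
proof (rule ccontr)
  note [measurable] = unit_mean_fadingD(4)[OF f]
  assume "\<not> 0 < prob {\<omega> \<in> space M. 1 / 2 \<le> f \<omega>}"
  then have "prob {\<omega> \<in> space M. 1 / 2 \<le> f \<omega>} = 0" by (simp add: not_less measure_le_0_iff)
  then have "AE \<omega> in M. \<omega> \<notin> {\<omega> \<in> space M. 1 / 2 \<le> f \<omega>}"
    by (subst (asm) prob_eq_0) auto
  then have "AE \<omega> in M. f \<omega> \<le> 1 / 2"
    using AE_space by eventually_elim auto
  then have "expectation f \<le> 1 / 2"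
    using unit_mean_fadingD(2)[OF f] by (intro integral_le_const)
  then show False using unit_mean_fadingD(3)[OF f] by simp
qed

section \<open>Decay of the Laplace transform in t\<close>

context massive_mimo
begin

text \<open>A smoothed area of the region where a side lobe of strength u contributes at least 1;
  the division by 2 comes from the fading level 1/2 of \<open>side_weight\<close>.\<close>

definition truncated_volume :: "real \<Rightarrow> real" where
  "truncated_volume u = (\<integral>x. min (u * L (norm (x :: real^2)) / 2) 1 \<partial>lborel)"

definition side_weight :: real where
  "side_weight = prob {\<omega> \<in> space M. 1 / 2 \<le> g 0 \<omega>}"

text \<open>The factor 1/4 combines a side-lobe probability of at least 1/2, for a narrow beam, with
  the 1/2 of \<open>half_le_one_minus_exp\<close>.\<close>

abbreviation decay :: "real \<Rightarrow> real \<Rightarrow> real" where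
  "decay lam u \<equiv> lam * side_weight / 4 * truncated_volume u"

lemma side_weight_pos: "0 < side_weight"
  unfolding side_weight_def by (rule unit_mean_fading_half[OF fading(3)])

lemma integrable_truncated:
  assumes "0 \<le> u"
  shows "integrable lborel (\<lambda>x :: real^2. min (u * L (norm x) / 2) 1)"
proof (rule Bochner_Integration.integrable_bound)
  show "integrable lborel (\<lambda>x :: real^2. u / 2 * L (norm x))" using integrable_path_loss(1)[OF L] by simp
  show "(\<lambda>x :: real^2. min (u * L (norm x) / 2) 1) \<in> borel_measurable lborel" by measurable
  show "AE x :: real^2 in lborel. norm (min (u * L (norm x) / 2) 1) \<le> norm (u / 2 * L (norm x))"
    using assms L_bounds(1) by (intro AE_I2) (auto simp: min_def)
qed

text \<open>Concavity in u with value 0 at u = 0. It makes the decay exponent at least linear on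
  [0, U], hence the domination in \<open>mean_limit\<close> exponential.\<close>

lemma truncated_volume_scale:
  assumes "0 \<le> u" "u \<le> U" "0 < U"
  shows "u / U * truncated_volume U \<le> truncated_volume u"
  unfolding truncated_volume_def integral_mult_right_zero[symmetric]
proof (rule integral_mono)
  fix x :: "real^2"
  have c: "0 \<le> u / U" "u / U \<le> 1" using assms by auto
  show "u / U * min (U * L (norm x) / 2) 1 \<le> min (u * L (norm x) / 2) 1"
  proof (rule min.boundedI)
    have "u / U * min (U * L (norm x) / 2) 1 \<le> u / U * (U * L (norm x) / 2)"
      using c by (intro mult_left_mono) auto
    then show "u / U * min (U * L (norm x) / 2) 1 \<le> u * L (norm x) / 2" using assms by simp
    have "u / U * min (U * L (norm x) / 2) 1 \<le> u / U * 1"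
      using c by (intro mult_left_mono) auto
    then show "u / U * min (U * L (norm x) / 2) 1 \<le> 1" using c by linarith
  qed
qed (use integrable_truncated assms in \<open>auto intro!: integrable_mult_right\<close>)

lemma truncated_volume_mono:
  assumes "0 \<le> u" "u \<le> U"
  shows "truncated_volume u \<le> truncated_volume U"
  unfolding truncated_volume_def
proof (rule integral_mono)
  show "min (u * L (norm x) / 2) 1 \<le> min (U * L (norm x) / 2) 1" for x :: "real^2"
    using mult_right_mono[OF assms(2) L_bounds(1)[OF norm_ge_zero, of x]] by (auto simp: min_def)
qed (use integrable_truncated assms in auto)

lemma truncated_volume_pos:
  assumes "0 < U"
  shows "0 < truncated_volume U"
proof -
  \<comment> \<open>With this constant c * L stays below both arguments of the minimum.\<close>
  define c where "c = min (U / 2) (1 / L 0)"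
  have c: "0 < c" "c \<le> U / 2" "c * L 0 \<le> 1" using assms L_bounds(3) by (auto simp: c_def min_def field_simps)
  have "c * (2 * pi * path_loss_moment L) = (\<integral>x. c * L (norm (x :: real^2)) \<partial>lborel)"
    by (simp add: integrable_path_loss(2)[OF L])
  also have "\<dots> \<le> truncated_volume U"
    unfolding truncated_volume_def
  proof (rule integral_mono)
    fix x :: "real^2"
    have "c * L (norm x) \<le> U / 2 * L (norm x)" using c L_bounds(1) by (intro mult_right_mono) auto
    moreover have "c * L (norm x) \<le> c * L 0" using c L_bounds(2) by (intro mult_left_mono) auto
    ultimately show "c * L (norm x) \<le> min (U * L (norm x) / 2) 1" using c(3) by simp
  qed (use integrable_truncated assms integrable_path_loss(1)[OF L] in auto)
  finally show ?thesis using c(1) path_loss_moment_pos[OF L] by (auto intro: less_le_trans[rotated])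
qed

text \<open>Truncating each side-lobe term at \<open>1\<close> makes the omission of the serving station cost only a factor \<open>exp 1\<close>.\<close>

lemma interference_laplace_decay:
  assumes lam: "0 < lam" "half_beam lam \<le> pi / 2" and t: "0 \<le> t"
  shows "interference_laplace lam t
    \<le> exp 1 * exp (- (decay lam (t / (\<alpha> * \<zeta> * lam))))"
proof -
  note [measurable] = network_measurable[OF lam(1)]
  define u where "u = t / (\<alpha> * \<zeta> * lam)"
  define p where "p = half_beam lam / pi"
  have u: "0 \<le> u" using pos lam t by (simp add: u_def)
  have p: "0 \<le> p" "p \<le> 1 / 2" using pos lam(1) divide_right_mono[OF lam(2), of pi] by (simp_all add: p_def)
  define G :: "(real^2) \<times> real \<Rightarrow> ennreal" where "G z = ennreal (min (u * L (norm (fst z)) * snd z) 1)" for z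
  have [measurable]: "G \<in> borel_measurable (borel \<Otimes>\<^sub>M borel)" unfolding G_def[abs_def] by measurable
  have [measurable]: "(\<lambda>\<omega>. G (x, g 0 \<omega>)) \<in> borel_measurable M" for x unfolding G_def fst_conv snd_conv by measurable
  have iG: "integrable M (\<lambda>\<omega>. nexp (G (x, g 0 \<omega>)))" for x by (rule integrable_nexp) measurable
  have "G z \<le> 1" for z by (simp add: G_def ennreal_le_1)
  then have G1: "exp (- 1) \<le> nexp (G z)" for z using nexp_mono[of "G z" 1] nexp_ennreal[of 1] by simp
  \<comment> \<open>Main-lobe terms are replaced by 0: this only lowers the interference, and the
    side lobes alone decay fast enough.\<close>
  define \<phi> where "\<phi> x = p * expectation (\<lambda>\<omega>. nexp ((\<lambda>_. 0) (x, h 0 \<omega>))) + (1 - p) * expectation (\<lambda>\<omega>. nexp (G (x, g 0 \<omega>)))" for x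
  have \<phi>: "\<phi> x = p + (1 - p) * expectation (\<lambda>\<omega>. nexp (G (x, g 0 \<omega>)))" for x by (simp add: \<phi>_def prob_space)
  have E1: "exp (- 1) \<le> expectation (\<lambda>\<omega>. nexp (G (x, g 0 \<omega>)))" for x
    by (intro integral_ge_const iG AE_I2 G1)
  have "exp (- 1) \<le> \<phi> x" for x
  proof -
    have "p * exp (- 1) + (1 - p) * exp (- 1) \<le> p * 1 + (1 - p) * expectation (\<lambda>\<omega>. nexp (G (x, g 0 \<omega>)))"
      using p E1 by (intro add_mono mult_left_mono) auto
    then show ?thesis by (simp add: \<phi> algebra_simps)
  qed
  note * = network_laplace(3)[OF net[OF lam(1)] less_imp_le[OF lam(1)] identical, of "half_beam lam" "\<lambda>_. 0" G "exp (- 1)",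
      folded p_def, folded \<phi>_def, OF _ _ _ _ this]
  let ?S = "\<lambda>\<omega>. \<Sum>n. if n \<noteq> near lam \<omega> then if \<bar>\<theta> lam n \<omega>\<bar> \<le> half_beam lam then 0 else G (X lam n \<omega>, g n \<omega>) else 0" and ?Z = "nexp (ennreal lam * (\<integral>\<^sup>+x. ennreal (1 - \<phi> x) \<partial>lborel))"
  have E: "expectation (\<lambda>\<omega>. nexp (?S \<omega>)) \<le> ?Z / exp (- 1)"
  proof (intro *)
    show "0 \<le> half_beam lam" using pos lam(1) by simp
    show "half_beam lam \<le> pi" using lam(2) pi_gt_zero by linarith
  qed auto
  have "interference_laplace lam t
      \<le> expectation (\<lambda>\<omega>. nexp (?S \<omega>))"
  proof (rule integral_mono)
    fix \<omega>
    show "nexp (ennreal t * interference lam \<omega>)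
      \<le> nexp (?S \<omega>)"
      unfolding interference_def ennreal_suminf_cmult[symmetric] using t
      by (intro nexp_mono suminf_le) (auto simp: G_def u_def mult_ac intro!: ennreal_leI simp flip: ennreal_mult')
  qed (intro integrable_nexp; measurable)+
  also note E
  also have "?Z / exp (- 1)
      \<le> exp (- (decay lam u)) / exp (- 1)"
  proof (intro divide_right_mono)
    have "side_weight / 4 * min (u * L (norm x) / 2) 1 \<le> 1 - \<phi> x" for x
    proof -
      let ?m = "min (u * L (norm x) / 2) 1"
      have m: "0 \<le> ?m" using u L_bounds(1) by simp
      \<comment> \<open>Only outcomes with fading at least 1/2 are counted; there the truncated term
        is at least \<open>?m\<close>.\<close>
      have "AE \<omega> in M. indicator {\<omega> \<in> space M. 1 / 2 \<le> g 0 \<omega>} \<omega> * (?m / 2) \<le> 1 - nexp (G (x, g 0 \<omega>))"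
        using unit_mean_fadingD(1)[OF fading(3)[of 0]]
      proof eventually_elim
        case (elim \<omega>)
        let ?y = "min (u * L (norm x) * g 0 \<omega>) 1"
        have uL: "0 \<le> u * L (norm x)" using u L_bounds(1) by simp
        have y: "0 \<le> ?y" "?y \<le> 1" using elim uL by auto
        have "1 / 2 \<le> g 0 \<omega> \<Longrightarrow> ?m \<le> ?y" using mult_left_mono[OF _ uL, of "1 / 2" "g 0 \<omega>"] by (auto simp: min_def)
        then have "indicator {\<omega> \<in> space M. 1 / 2 \<le> g 0 \<omega>} \<omega> * (?m / 2) \<le> ?y / 2"
          using y(1) by (auto split: split_indicator)
        also have "\<dots> \<le> 1 - exp (- ?y)" by (rule half_le_one_minus_exp[OF y])
        also have "exp (- ?y) = nexp (G (x, g 0 \<omega>))" using y(1) by (simp only: G_def fst_conv snd_conv nexp_ennreal)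
        finally show ?case .
      qed
      then have "expectation (\<lambda>\<omega>. indicator {\<omega> \<in> space M. 1 / 2 \<le> g 0 \<omega>} \<omega> * (?m / 2)) \<le> expectation (\<lambda>\<omega>. 1 - nexp (G (x, g 0 \<omega>)))"
        using iG by (intro integral_mono_AE Bochner_Integration.integrable_diff integrable_mult_left) (auto intro!: integrable_const_bound[where B = 1])
      also have "expectation (\<lambda>\<omega>. indicator {\<omega> \<in> space M. 1 / 2 \<le> g 0 \<omega>} \<omega> * (?m / 2)) = side_weight * (?m / 2)"
        by (simp add: side_weight_def)
      also have "expectation (\<lambda>\<omega>. 1 - nexp (G (x, g 0 \<omega>))) = 1 - expectation (\<lambda>\<omega>. nexp (G (x, g 0 \<omega>)))"
        using iG by (subst Bochner_Integration.integral_diff) (auto simp: prob_space)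
      finally have a: "side_weight * (?m / 2) \<le> 1 - expectation (\<lambda>\<omega>. nexp (G (x, g 0 \<omega>)))" .
      have "1 / 2 * (side_weight * (?m / 2)) \<le> (1 - p) * (1 - expectation (\<lambda>\<omega>. nexp (G (x, g 0 \<omega>))))"
        using p a m side_weight_pos by (intro mult_mono) auto
      then show ?thesis by (simp add: \<phi> algebra_simps)
    qed
    then have "(\<integral>\<^sup>+x. ennreal (side_weight / 4 * min (u * L (norm (x :: real^2)) / 2) 1) \<partial>lborel) \<le> (\<integral>\<^sup>+x. ennreal (1 - \<phi> x) \<partial>lborel)"
      by (intro nn_integral_mono ennreal_leI)
    moreover have "(\<integral>\<^sup>+x. ennreal (side_weight / 4 * min (u * L (norm (x :: real^2)) / 2) 1) \<partial>lborel) = ennreal (side_weight / 4 * truncated_volume u)"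
      unfolding truncated_volume_def integral_mult_right_zero[symmetric]
      using integrable_truncated[OF u] side_weight_pos u L_bounds(1)
      by (intro nn_integral_eq_integral integrable_mult_right AE_I2) auto
    ultimately have "ennreal lam * ennreal (side_weight / 4 * truncated_volume u) \<le> ennreal lam * (\<integral>\<^sup>+x. ennreal (1 - \<phi> x) \<partial>lborel)"
      by (intro mult_left_mono) auto
    then have "?Z \<le> nexp (ennreal lam * ennreal (side_weight / 4 * truncated_volume u))"
      by (rule nexp_mono)
    moreover have "0 \<le> truncated_volume u"
      unfolding truncated_volume_def using u L_bounds(1) by (intro Bochner_Integration.integral_nonneg) simp
    then have "nexp (ennreal lam * ennreal (side_weight / 4 * truncated_volume u)) = exp (- (decay lam u))"
      using lam(1) side_weight_pos by (subst ennreal_mult[symmetric]) (auto simp: nexp_ennreal)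
    ultimately show "?Z \<le> exp (- (decay lam u))"
      by simp
  qed simp
  also have "\<dots> = exp 1 * exp (- (decay lam u))"
    by (simp add: exp_minus field_simps)
  finally show ?thesis by (simp add: u_def)
qed

text \<open>The Gaussian bound gives u * L / 2 \<ge> 1 on the annulus from R to the radius b with c
  b^2 = ln (u / 2), whose area is logarithmic in u. The assumption on u ensures R \<le> b.\<close>

lemma truncated_volume_ge_ln:
  assumes c: "0 < c" "0 \<le> R" "\<And>r. R \<le> r \<Longrightarrow> exp (- c * r\<^sup>2) \<le> L r" and u: "2 * exp (c * R\<^sup>2) \<le> u"
  shows "pi / c * ln (u / (2 * exp (c * R\<^sup>2))) \<le> truncated_volume u"
proof -
  have u0: "0 < u" using u exp_gt_zero[of "c * R\<^sup>2"] by linarith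
  define b where "b = sqrt (ln (u / 2) / c)"
  have lnu: "c * R\<^sup>2 \<le> ln (u / 2)" using u u0 by (simp add: ln_ge_iff)
  have lnu0: "0 \<le> ln (u / 2)" using lnu c by (meson mult_nonneg_nonneg less_imp_le order_trans zero_le_power2)
  have b2: "b\<^sup>2 = ln (u / 2) / c" using lnu0 c by (simp add: b_def)
  have Rb: "R \<le> b" unfolding b_def using lnu c by (intro real_le_rsqrt) (simp add: field_simps)
  have b0: "0 \<le> b" using Rb c by simp
  let ?A = "cball 0 b - cball (0::real^2) R"
  have "measure lborel (cball (0::real^2) r) = pi * r\<^sup>2" if "0 \<le> r" for r
    using content_cball[OF that, of "0::real^2"] by (simp add: unit_ball_vol_2)
  then have "measure lborel ?A = pi * b\<^sup>2 - pi * R\<^sup>2"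
    using Rb c b0 emeasure_lborel_cball_finite[of "0::real^2" b]
    by (subst measure_Diff) auto
  also have "\<dots> = pi / c * (ln (u / 2) - c * R\<^sup>2)" using c by (simp add: b2 field_simps)
  also have "ln (u / 2) - c * R\<^sup>2 = ln (u / (2 * exp (c * R\<^sup>2)))"
    using u0 ln_div[of "u / 2" "exp (c * R\<^sup>2)"] by simp
  finally have m: "measure lborel ?A = pi / c * ln (u / (2 * exp (c * R\<^sup>2)))" .
  have fin: "emeasure lborel ?A < \<infinity>"
    by (rule emeasure_bounded_finite) (auto intro: bounded_subset[OF bounded_cball])
  have "measure lborel ?A = (\<integral>x. indicator ?A x \<partial>lborel)" by simp
  also have "\<dots> \<le> truncated_volume u"
    unfolding truncated_volume_def
  proof (rule integral_mono)
    show "integrable lborel (indicator ?A :: _ \<Rightarrow> real)" using fin by (simp add: integrable_indicator_iff)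
    fix x :: "real^2"
    have "1 \<le> u * L (norm x) / 2" if "R < norm x" "norm x \<le> b"
    proof -
      have "c * (norm x)\<^sup>2 \<le> c * b\<^sup>2" using that c by (intro mult_left_mono power_mono) auto
      also have "c * b\<^sup>2 = ln (u / 2)" using c by (simp add: b2)
      finally have "exp (c * (norm x)\<^sup>2) \<le> u / 2" using ln_ge_iff[of "u / 2"] u0 by simp
      then have "1 \<le> u / 2 * exp (- c * (norm x)\<^sup>2)" by (simp add: exp_minus field_simps)
      also have "\<dots> \<le> u / 2 * L (norm x)" using c(3)[of "norm x"] that u0 by (intro mult_left_mono) auto
      finally show ?thesis by simp
    qed
    then show "indicator ?A x \<le> min (u * L (norm x) / 2) 1"
      using u0 L_bounds(1) by (auto split: split_indicator)
  qed (use integrable_truncated u0 in auto)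
  finally show ?thesis by (simp add: m)
qed

end

lemma nn_integral_inverse_square_atLeast:
  assumes "0 < (b::real)" "0 \<le> c"
  shows "(\<integral>\<^sup>+t\<in>{b..}. ennreal (c / t\<^sup>2) \<partial>lborel) = ennreal (c / b)"
proof -
  have "(\<integral>\<^sup>+t. ennreal (c / t\<^sup>2) * indicator {b..} t \<partial>lborel) = ennreal (0 - (- (c / b)))"
  proof (rule nn_integral_FTC_atLeast)
    fix t assume "b \<le> t"
    then have "t \<noteq> 0" using assms by auto
    then show "((\<lambda>t. - (c / t)) has_real_derivative c / t\<^sup>2) (at t)"
      by (auto intro!: derivative_eq_intros simp: power2_eq_square)
    show "0 \<le> c / t\<^sup>2" using assms by simp
  next
    show "((\<lambda>t. - (c / t)) \<longlongrightarrow> 0) at_top" by real_asymp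
  qed measurable
  then show ?thesis by simp
qed

section \<open>The mean SINR as an integral, and the tail of that integral\<close>

context massive_mimo
begin

text \<open>The load as a functional of the locations and marks. Since it never reads the mark
  \<open>Desired\<close>, it is measurable on the product over the other indices, which is what
  \<open>marks_indep_rest\<close> asks for.\<close>

definition load_functional :: "real \<Rightarrow> (nat \<Rightarrow> real^2) \<times> (link + nat \<Rightarrow> real) \<Rightarrow> ennreal" where
  "load_functional lam z = ((\<Sum>n. if n \<noteq> nearest (fst z)
     then (if \<bar>snd z (Inr n)\<bar> \<le> half_beam lam then ennreal (L (norm (fst z n)) * snd z (Inl (Towards n)))
           else ennreal (L (norm (fst z n)) * snd z (Inl (Away n)) / (\<alpha> * \<zeta> * lam)))
     else 0) + ennreal (noise lam)) / ennreal (L (norm (fst z (nearest (fst z)))) / L 0)"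

lemma load_functional_measurable:
  "load_functional lam \<in> borel_measurable (Pi\<^sub>M UNIV (\<lambda>_. borel) \<Otimes>\<^sub>M Pi\<^sub>M (- {Inl Desired}) (\<lambda>_. borel))"
proof -
  have c: "(\<lambda>z. snd z i) \<in> borel_measurable (Pi\<^sub>M UNIV (\<lambda>_. borel :: (real^2) measure) \<Otimes>\<^sub>M Pi\<^sub>M (- {Inl Desired}) (\<lambda>_. borel :: real measure))"
    if "i \<in> - {Inl Desired :: link + nat}" for i
    by (rule measurable_compose[OF measurable_snd measurable_component_singleton[OF that]])
  note [measurable] = c[of "Inr _"] c[of "Inl (Towards _)"] c[of "Inl (Away _)"]
  show ?thesis unfolding load_functional_def[abs_def] by measurable
qed

lemma load_eq_functional:
  "load lam \<omega> = load_functional lam (\<lambda>n. X lam n \<omega>, \<lambda>i\<in>- {Inl Desired}. case_sum (fading h0 h g) (\<theta> lam) i \<omega>)"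
  by (simp add: load_def load_functional_def interference_def attenuation_def cong: if_cong)

lemma load_independent:
  assumes "0 < lam"
  shows "distr M borel h0 \<Otimes>\<^sub>M distr M borel (load lam) = distr M (borel \<Otimes>\<^sub>M borel) (\<lambda>\<omega>. (h0 \<omega>, load lam \<omega>))"
  using marks_indep_rest[OF cellular_networkD(2)[OF net[OF assms]] PPP_measurable[OF cellular_networkD(1)[OF net[OF assms]]]
      load_functional_measurable[of lam]]
  by (simp add: load_eq_functional[abs_def])

text \<open>\<open>h0\<close> is independent of the load and has mean 1, which leaves the mean of 1
  / load; \<open>nn_integral_nexp_mult\<close> and Tonelli turn it into the integral of the
  transform. In \<open>ennreal\<close> no finiteness has to be known beforehand.\<close>

lemma mean_SINR_eq:
  assumes "0 < lam"
  shows "(\<integral>\<^sup>+\<omega>. ennreal (L 0 * h0 \<omega>) * inverse (load lam \<omega>) \<partial>M)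
       = ennreal (L 0) * (\<integral>\<^sup>+t\<in>{0..}. ennreal (load_laplace lam t) \<partial>lborel)"
proof -
  note [measurable] = network_measurable[OF assms]
  interpret pair_sigma_finite lborel M by unfold_locales
  have "(\<integral>\<^sup>+\<omega>. ennreal (L 0 * h0 \<omega>) * inverse (load lam \<omega>) \<partial>M)
      = (\<integral>\<^sup>+\<omega>. (\<integral>\<^sup>+\<omega>'. ennreal (L 0 * h0 \<omega>) * inverse (load lam \<omega>') \<partial>M) \<partial>M)"
    by (rule nn_integral_distr_pair[OF _ _ load_independent[OF assms], of "\<lambda>(a, y). ennreal (L 0 * a) * inverse y", simplified]) measurable
  also have "\<dots> = (\<integral>\<^sup>+\<omega>. ennreal (L 0 * h0 \<omega>) * (\<integral>\<^sup>+\<omega>'. inverse (load lam \<omega>') \<partial>M) \<partial>M)"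
    by (intro nn_integral_cong nn_integral_cmult) measurable
  also have "\<dots> = (\<integral>\<^sup>+\<omega>. ennreal (L 0 * h0 \<omega>) \<partial>M) * (\<integral>\<^sup>+\<omega>'. inverse (load lam \<omega>') \<partial>M)"
    by (rule nn_integral_multc) measurable
  also have "(\<integral>\<^sup>+\<omega>. ennreal (L 0 * h0 \<omega>) \<partial>M) = ennreal (expectation (\<lambda>\<omega>. L 0 * h0 \<omega>))"
    using unit_mean_fadingD[OF fading(1)] L_bounds(3) by (intro nn_integral_eq_integral) auto
  also have "expectation (\<lambda>\<omega>. L 0 * h0 \<omega>) = L 0" using unit_mean_fadingD(3)[OF fading(1)] by simp
  also have "(\<integral>\<^sup>+\<omega>. inverse (load lam \<omega>) \<partial>M) = (\<integral>\<^sup>+\<omega>. (\<integral>\<^sup>+t. ennreal (nexp (ennreal t * load lam \<omega>)) * indicator {0..} t \<partial>lborel) \<partial>M)"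
    by (simp add: nn_integral_nexp_mult)
  also have "\<dots> = (\<integral>\<^sup>+t. (\<integral>\<^sup>+\<omega>. ennreal (nexp (ennreal t * load lam \<omega>)) * indicator {0..} t \<partial>M) \<partial>lborel)"
    by (rule Fubini') measurable
  also have "\<dots> = (\<integral>\<^sup>+t\<in>{0..}. ennreal (load_laplace lam t) \<partial>lborel)"
    by (subst nn_integral_multc) (auto intro!: nn_integral_cong arg_cong2[where f = "(*)"] nn_integral_eq_integral)
  finally show ?thesis .
qed

lemma load_laplace_measurable:
  assumes "0 < lam"
  shows "(\<lambda>t. load_laplace lam t) \<in> borel_measurable borel"
proof -
  note [measurable] = network_measurable[OF assms]
  show ?thesis by (rule borel_measurable_lebesgue_integral) measurable
qed

lemma load_laplace_decay:
  assumes lam: "0 < lam" "half_beam lam \<le> pi / 2" and t: "0 \<le> t"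
  shows "load_laplace lam t
    \<le> exp (- (t * noise lam)) * (exp 1 * exp (- (decay lam (t / (\<alpha> * \<zeta> * lam)))))"
  using load_laplace_le[OF lam(1) t] interference_laplace_decay[OF lam t]
  by (meson exp_ge_zero mult_left_mono order_trans)

lemma eventually_narrow_beam: "\<forall>\<^sub>F lam in at_top. 0 < lam \<and> half_beam lam \<le> pi / 2"
proof -
  have "((\<lambda>lam. half_beam lam) \<longlongrightarrow> 0) at_top" using pos by real_asymp
  then have "\<forall>\<^sub>F lam in at_top. half_beam lam < pi / 2"
    by (rule order_tendstoD) simp
  then show ?thesis
    using eventually_gt_at_top[of 0] by eventually_elim auto
qed

text \<open>In terms of u = \<open>t / (\<alpha> * \<zeta> * lam)\<close>, the argument of
  \<open>truncated_volume\<close>, the tail begins at u = U.\<close>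

definition laplace_tail :: "real \<Rightarrow> real \<Rightarrow> ennreal" where
  "laplace_tail U lam = (\<integral>\<^sup>+t\<in>{U * (\<alpha> * \<zeta> * lam)..}. ennreal (load_laplace lam t) \<partial>lborel)"

text \<open>Beyond \<open>\<alpha> * \<zeta> * lam\<close> the interference contributes at most exp
  (1 - k \<open>lam\<close>). The noise factor integrates to at most
  \<open>Gmax (\<zeta> * lam) / \<sigma>\<^sup>2\<close>, which grows more slowly than the former
  decays.\<close>

lemma tail_subexponential_gain:
  assumes G: "((\<lambda>N. ln (Gmax N) / N) \<longlongrightarrow> 0) at_top"
  shows "(laplace_tail 1 \<longlongrightarrow> 0) at_top"
proof -
  define k where "k = side_weight / 4 * truncated_volume 1"
  have k: "0 < k" using side_weight_pos truncated_volume_pos[of 1] by (simp add: k_def)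
  have "filterlim (\<lambda>lam. \<zeta> * lam) at_top at_top" using pos by real_asymp
  \<comment> \<open>This threshold grants the gain half of the exponential rate k and leaves exp (-
    k \<open>lam\<close> / 2).\<close>
  from filterlim_compose[OF G this] have "\<forall>\<^sub>F lam in at_top. ln (Gmax (\<zeta> * lam)) / (\<zeta> * lam) < k / (2 * \<zeta>)"
    using k pos by (intro order_tendstoD(2)) auto
  then have "\<forall>\<^sub>F lam in at_top. laplace_tail 1 lam \<le> ennreal (exp 1 / \<sigma>\<^sup>2 * exp (- (k / 2 * lam)))"
    using eventually_narrow_beam
  proof eventually_elim
    case (elim lam)
    then have lam: "0 < lam" by simp
    note [measurable] = load_laplace_measurable[OF lam]
    have Gp: "0 < Gmax (\<zeta> * lam)" using Gmax_pos pos lam by simp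
    have "ln (Gmax (\<zeta> * lam)) < k / 2 * lam" using elim(1) pos lam by (simp add: field_simps)
    then have "exp (ln (Gmax (\<zeta> * lam))) \<le> exp (k / 2 * lam)" by (simp only: exp_le_cancel_iff)
    then have Ge: "Gmax (\<zeta> * lam) \<le> exp (k / 2 * lam)" using Gp by simp
    have "laplace_tail 1 lam \<le> (\<integral>\<^sup>+t. ennreal (exp 1 * exp (- (lam * k))) * (ennreal (exp (- (noise lam * t))) * indicator {0..} t) \<partial>lborel)"
      unfolding laplace_tail_def
    proof (rule nn_integral_mono)
      fix t :: real
      show "ennreal (load_laplace lam t) * indicator {1 * (\<alpha> * \<zeta> * lam)..} t
        \<le> ennreal (exp 1 * exp (- (lam * k))) * (ennreal (exp (- (noise lam * t))) * indicator {0..} t)"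
      proof (cases "\<alpha> * \<zeta> * lam \<le> t")
        case True
        have a: "0 < \<alpha> * \<zeta> * lam" using pos lam by simp
        then have t: "0 \<le> t" using True by simp
        have "1 \<le> t / (\<alpha> * \<zeta> * lam)" using True a by (simp add: le_divide_eq)
        then have "truncated_volume 1 \<le> truncated_volume (t / (\<alpha> * \<zeta> * lam))" by (intro truncated_volume_mono) auto
        then have "decay lam 1 \<le> decay lam (t / (\<alpha> * \<zeta> * lam))"
          using lam side_weight_pos by (intro mult_left_mono) auto
        then have "exp (- (decay lam (t / (\<alpha> * \<zeta> * lam)))) \<le> exp (- (lam * k))"
          by (simp add: k_def)
        then have "exp (- (t * noise lam)) * (exp 1 * exp (- (decay lam (t / (\<alpha> * \<zeta> * lam)))))
            \<le> exp (- (t * noise lam)) * (exp 1 * exp (- (lam * k)))"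
          by (intro mult_left_mono) auto
        from order_trans[OF load_laplace_decay[OF lam _ t] this] elim(2)
        have "load_laplace lam t \<le> exp 1 * exp (- (lam * k)) * exp (- (noise lam * t))"
          by (simp add: mult_ac)
        then show ?thesis using True t by (simp add: ennreal_leI flip: ennreal_mult)
      qed simp
    qed
    also have "\<dots> = ennreal (exp 1 * exp (- (lam * k))) * ennreal (1 / noise lam)"
      by (subst nn_integral_cmult) (auto simp: nn_integral_exp_atLeast_0[OF noise_pos[OF lam]])
    also have "\<dots> = ennreal (exp 1 / \<sigma>\<^sup>2 * (Gmax (\<zeta> * lam) * exp (- (lam * k))))"
      using noise_pos[OF lam] Gp by (subst ennreal_mult[symmetric]) (auto simp: noise_def mult_ac)
    also have "\<dots> \<le> ennreal (exp 1 / \<sigma>\<^sup>2 * (exp (k / 2 * lam) * exp (- (lam * k))))"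
      using Ge by (intro ennreal_leI mult_left_mono mult_right_mono) auto
    also have "exp (k / 2 * lam) * exp (- (lam * k)) = exp (- (k / 2 * lam))"
      by (simp add: exp_add[symmetric])
    finally show ?case .
  qed
  moreover have "((\<lambda>lam. ennreal (exp 1 / \<sigma>\<^sup>2 * exp (- (k / 2 * lam)))) \<longlongrightarrow> ennreal 0) at_top"
    using k by (intro tendsto_ennrealI) real_asymp
  ultimately show ?thesis
    by (intro tendsto_sandwich[of "\<lambda>_. 0" "laplace_tail 1" at_top]) auto
qed

text \<open>With s = t / (A \<open>lam\<close>) the decay exponent is at least \<open>lam\<close> a
  ln s, so the transform falls like the power - \<open>lam\<close> a of s, integrable without the
  noise. Starting at 2 U gives s \<ge> 2, so that all but two of these powers yield a factor
  exponentially small in \<open>lam\<close>.\<close>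

lemma tail_Gaussian_path_loss:
  assumes c: "0 < c" "0 \<le> R" "\<And>r. R \<le> r \<Longrightarrow> exp (- c * r\<^sup>2) \<le> L r"
  defines "U \<equiv> 2 * exp (c * R\<^sup>2)"
  shows "(laplace_tail (2 * U) \<longlongrightarrow> 0) at_top"
proof -
  define a where "a = side_weight / 4 * (pi / c)"
  define A where "A = \<alpha> * \<zeta> * U"
  have a: "0 < a" using side_weight_pos c by (simp add: a_def)
  have U: "0 < U" by (simp add: U_def)
  have A: "0 < A" using pos U by (simp add: A_def)
  \<comment> \<open>From s^(- lam a) \<le> 2^(- (lam a - 2)) / s^2; the square of A
    \<open>lam\<close> arises on returning from s to t.\<close>
  define d where "d lam = exp 1 * exp (- ((lam * a - 2) * ln 2)) * (A * lam)\<^sup>2" for lam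
  have "\<forall>\<^sub>F lam in at_top. laplace_tail (2 * U) lam \<le> ennreal (d lam / (2 * A * lam))"
    using eventually_narrow_beam eventually_ge_at_top[of "2 / a"]
  proof eventually_elim
    case (elim lam)
    then have lam: "0 < lam" by simp
    have la: "2 \<le> lam * a" using elim(2) a by (simp add: field_simps)
    have Al: "0 < A * lam" using A lam by simp
    have "laplace_tail (2 * U) lam \<le> (\<integral>\<^sup>+t\<in>{2 * A * lam..}. ennreal (d lam / t\<^sup>2) \<partial>lborel)"
      unfolding laplace_tail_def
    proof (rule nn_integral_mono)
      fix t :: real
      show "ennreal (load_laplace lam t) * indicator {2 * U * (\<alpha> * \<zeta> * lam)..} t
        \<le> ennreal (d lam / t\<^sup>2) * indicator {2 * A * lam..} t"
      proof (cases "2 * A * lam \<le> t")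
        case True
        define s where "s = t / (A * lam)"
        have s: "2 \<le> s" using True Al by (simp add: s_def le_divide_eq mult_ac)
        have t: "t = s * (A * lam)" using A lam by (simp add: s_def)
        have t0: "0 \<le> t" using True Al by simp
        have ts: "t / (\<alpha> * \<zeta> * lam) = s * U" using pos lam by (simp add: t A_def)
        have "pi / c * ln (s * U / U) \<le> truncated_volume (s * U)"
          unfolding U_def
        proof (rule truncated_volume_ge_ln[OF c])
          show "2 * exp (c * R\<^sup>2) \<le> s * (2 * exp (c * R\<^sup>2))" using s by simp
        qed
        then have "pi / c * ln s \<le> truncated_volume (s * U)" using U by simp
        then have "lam * side_weight / 4 * (pi / c * ln s) \<le> decay lam (s * U)"
          using lam side_weight_pos by (intro mult_left_mono) auto
        then have "lam * a * ln s \<le> decay lam (s * U)" by (simp add: a_def)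
        moreover have "(lam * a - 2) * ln 2 \<le> (lam * a - 2) * ln s"
          using la s by (intro mult_left_mono) auto
        ultimately have "- (decay lam (s * U)) \<le> - ((lam * a - 2) * ln 2) + - (2 * ln s)"
          by (simp add: algebra_simps)
        then have "exp (- (decay lam (s * U))) \<le> exp (- ((lam * a - 2) * ln 2) + - (2 * ln s))"
          by (simp only: exp_le_cancel_iff)
        also have "\<dots> = exp (- ((lam * a - 2) * ln 2)) * exp (- (2 * ln s))" by (rule exp_add)
        also have "exp (- (2 * ln s)) = 1 / s\<^sup>2"
          using s exp_of_nat_mult[of 2 "ln s"] by (simp add: exp_minus divide_inverse)
        finally have 1: "exp (- (decay lam (s * U))) \<le> exp (- ((lam * a - 2) * ln 2)) * (1 / s\<^sup>2)" .
        have n: "exp (- (t * noise lam)) \<le> 1" using t0 noise_pos[OF lam] by simp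
        have "load_laplace lam t \<le> exp (- (t * noise lam)) * (exp 1 * exp (- (decay lam (s * U))))"
          using load_laplace_decay[OF _ _ t0, of lam] elim(1) unfolding ts by simp
        also have "\<dots> \<le> 1 * (exp 1 * (exp (- ((lam * a - 2) * ln 2)) * (1 / s\<^sup>2)))"
          using n 1 by (intro mult_mono) auto
        also have "\<dots> = d lam / t\<^sup>2"
          using A lam by (simp add: d_def t power_mult_distrib)
        finally show ?thesis using True by (auto intro!: ennreal_leI split: split_indicator)
      qed (auto simp: A_def mult_ac split: split_indicator)
    qed
    also have "\<dots> = ennreal (d lam / (2 * A * lam))"
      using Al by (intro nn_integral_inverse_square_atLeast) (auto simp: d_def mult_ac)
    finally show ?case .
  qed
  moreover have "((\<lambda>lam. ennreal (d lam / (2 * A * lam))) \<longlongrightarrow> ennreal 0) at_top"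
    unfolding d_def using a A by (intro tendsto_ennrealI) real_asymp
  ultimately show ?thesis
    by (intro tendsto_sandwich[of "\<lambda>_. 0" "laplace_tail (2 * U)" at_top]) auto
qed

lemma gain_tail_vanishes:
  assumes "gain_tail_condition Gmax L"
  obtains U where "0 < U" "(laplace_tail U \<longlongrightarrow> 0) at_top"
proof -
  from assms consider "((\<lambda>N. ln (Gmax N) / N) \<longlongrightarrow> 0) at_top" | c R where "0 < c" "\<And>r. R \<le> r \<Longrightarrow> exp (- c * r\<^sup>2) \<le> L r"
    unfolding gain_tail_condition_def by blast
  then show ?thesis
  proof cases
    case 1
    then show ?thesis using tail_subexponential_gain that[of 1] by simp
  next
    case 2
    \<comment> \<open>\<open>gain_tail_condition\<close> allows a negative R, while the inner radius
      of the annulus must be nonnegative.\<close>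
    then show ?thesis
      using tail_Gaussian_path_loss[of c "max R 0"] by (intro that[of "2 * (2 * exp (c * (max R 0)\<^sup>2))"]) auto
  qed
qed

text \<open>Main lobes are dropped for the upper bound; for the lower one their fading is replaced
  by its mean, by 1 - E exp (- s h) \<le> s. Integrated over t, the two exponentials become the two
  bounds on the limiting mean.\<close>

lemma limit_laplace_bounds:
  assumes "0 \<le> t"
  shows "limit_laplace t \<le> exp (- (side_rate * t))"
    and "exp (- ((side_rate + \<beta> / \<zeta> * path_loss_moment L) * t)) \<le> limit_laplace t"
proof -
  show "limit_laplace t \<le> exp (- (side_rate * t))"
    using main_defect_nonneg[OF assms] pos by (simp add: limit_laplace_def)
  have "main_defect t \<le> (\<integral>x. t * L (norm (x :: real^2)) \<partial>lborel)"
    unfolding main_defect_def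
  proof (rule integral_mono[OF integrable_laplace_defect[OF fading(2) L assms]])
    show "1 - laplace (h 0) (t * L (norm x)) \<le> t * L (norm x)" for x :: "real^2"
      using assms L_bounds(1) by (intro laplace_fading_bounds(3)[OF fading(2)]) auto
  qed (use integrable_path_loss(1)[OF L] in auto)
  also have "\<dots> = t * (2 * pi * path_loss_moment L)" by (simp add: integrable_path_loss(2)[OF L])
  finally have "\<beta> / (2 * pi * \<zeta>) * main_defect t \<le> \<beta> / (2 * pi * \<zeta>) * (t * (2 * pi * path_loss_moment L))"
    using pos by (intro mult_left_mono) auto
  also have "\<dots> = \<beta> / \<zeta> * path_loss_moment L * t" by simp
  finally show "exp (- ((side_rate + \<beta> / \<zeta> * path_loss_moment L) * t)) \<le> limit_laplace t"
    by (simp add: limit_laplace_def algebra_simps)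
qed

lemma limit_laplace_measurable [measurable]: "limit_laplace \<in> borel_measurable borel"
proof -
  have "(\<lambda>(t, x :: real^2). laplace (h 0) (t * L (norm x))) \<in> borel_measurable (borel \<Otimes>\<^sub>M lborel)"
    unfolding split_beta by (rule measurable_compose[OF _ laplace_fading_measurable[OF fading(2)]]) measurable
  note [measurable] = this
  have [measurable]: "main_defect \<in> borel_measurable borel"
    unfolding main_defect_def[abs_def] by (rule lborel.borel_measurable_lebesgue_integral) measurable
  show ?thesis unfolding limit_laplace_def[abs_def] by measurable
qed

lemma mean_limit:
  assumes "gain_tail_condition Gmax L"
  shows "((\<lambda>lam. \<integral>\<^sup>+t\<in>{0..}. ennreal (load_laplace lam t) \<partial>lborel)
    \<longlongrightarrow> (\<integral>\<^sup>+t\<in>{0..}. ennreal (limit_laplace t) \<partial>lborel)) at_top"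
proof -
  obtain U where U: "0 < U" "(laplace_tail U \<longlongrightarrow> 0) at_top" using gain_tail_vanishes[OF assms] .
  define T where "T lam t = load_laplace lam t" for lam t
  define b where "b lam = U * (\<alpha> * \<zeta> * lam)" for lam
  \<comment> \<open>By \<open>truncated_volume_scale\<close> the decay exponent at t is at least
    \<kappa> * t up to \<open>b lam\<close>. Here \<open>lam\<close> cancels, being both a factor of
    \<open>decay\<close> and the divisor in its argument.\<close>
  define \<kappa> where "\<kappa> = side_weight / 4 * truncated_volume U / (U * \<alpha> * \<zeta>)"
  have \<kappa>: "0 < \<kappa>" using side_weight_pos truncated_volume_pos[OF U(1)] U pos by (simp add: \<kappa>_def)
  have T0: "0 \<le> T lam t" for lam t unfolding T_def by (intro Bochner_Integration.integral_nonneg) simp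
  have Tm: "0 < lam \<Longrightarrow> T lam \<in> borel_measurable borel" for lam
    unfolding T_def[abs_def] by (rule load_laplace_measurable)
  have dom: "T lam t \<le> exp 1 * exp (- (\<kappa> * t))"
    if lam: "0 < lam" "half_beam lam \<le> pi / 2" and t: "0 \<le> t" "t \<le> b lam" for lam t
  proof -
    let ?u = "t / (\<alpha> * \<zeta> * lam)"
    have u: "0 \<le> ?u" "?u \<le> U" using t pos lam(1) by (auto simp: b_def field_simps)
    have "lam * side_weight / 4 * (?u / U * truncated_volume U) \<le> decay lam ?u"
      using truncated_volume_scale[OF u U(1)] lam side_weight_pos by (intro mult_left_mono) auto
    moreover have "lam * side_weight / 4 * (?u / U * truncated_volume U) = \<kappa> * t"
      using lam pos U by (simp add: \<kappa>_def mult_ac)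
    ultimately have e: "exp (- (decay lam ?u)) \<le> exp (- (\<kappa> * t))" by simp
    have n: "exp (- (t * noise lam)) \<le> 1" using t noise_pos[OF lam(1)] by simp
    have "T lam t \<le> exp (- (t * noise lam)) * (exp 1 * exp (- (decay lam ?u)))"
      unfolding T_def by (rule load_laplace_decay[OF lam t(1)])
    also have "\<dots> \<le> 1 * (exp 1 * exp (- (\<kappa> * t)))"
      using n e by (intro mult_mono) auto
    finally show ?thesis by simp
  qed
  have iw: "integrable lborel (\<lambda>t. indicator {0..} t * (exp 1 * exp (- (\<kappa> * t))) :: real)"
  proof (rule integrableI_nonneg)
    have "(\<integral>\<^sup>+t. ennreal (indicator {0..} t * (exp 1 * exp (- (\<kappa> * t)))) \<partial>lborel) = (\<integral>\<^sup>+t. ennreal (exp 1) * (ennreal (exp (- (\<kappa> * t))) * indicator {0..} t) \<partial>lborel)"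
      by (intro nn_integral_cong) (auto simp: ennreal_mult split: split_indicator)
    also have "\<dots> = ennreal (exp 1) * ennreal (1 / \<kappa>)"
      by (subst nn_integral_cmult) (auto simp: nn_integral_exp_atLeast_0[OF \<kappa>])
    finally show "(\<integral>\<^sup>+t. ennreal (indicator {0..} t * (exp 1 * exp (- (\<kappa> * t)))) \<partial>lborel) < \<infinity>"
      by (simp add: ennreal_mult_less_top)
  qed auto
  \<comment> \<open>The network is constrained for positive \<open>lam\<close> only; the value 0
    elsewhere makes \<open>s lam\<close> measurable for every real \<open>lam\<close>, as the
    convergence theorem demands.\<close>
  define s where "s lam t = (if 0 < lam then indicator {0..<b lam} t * T lam t else 0)" for lam t
  have sm [measurable]: "s lam \<in> borel_measurable lborel" for lam
    unfolding s_def[abs_def] using Tm[of lam] by (cases "0 < lam") auto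
  have sdom: "\<forall>\<^sub>F lam in at_top. AE t in lborel. norm (s lam t) \<le> indicator {0..} t * (exp 1 * exp (- (\<kappa> * t)))"
    using eventually_narrow_beam
  proof eventually_elim
    case (elim lam)
    then show ?case
      using dom[of lam] T0 by (intro AE_I2) (auto simp: s_def split: split_indicator)
  qed
  have slim: "AE t in lborel. ((\<lambda>lam. s lam t) \<longlongrightarrow> indicator {0..} t * limit_laplace t) at_top"
  proof -
    \<comment> \<open>\<open>load_laplace_limit\<close> is stated for t > 0; the remaining point is
      null.\<close>
    have "AE t in lborel. t \<noteq> (0::real)" by (rule AE_lborel_singleton)
    then show ?thesis
    proof eventually_elim
      case (elim t)
      show ?case
      proof (cases "0 < t")
        case True
        have "\<forall>\<^sub>F lam in at_top. t / (U * (\<alpha> * \<zeta>)) < lam \<and> 0 < lam"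
          by (intro eventually_conj eventually_gt_at_top)
        then have "\<forall>\<^sub>F lam in at_top. T lam t = s lam t"
        proof eventually_elim
          case (elim lam)
          then have "t < b lam" using U pos by (simp add: b_def field_simps)
          then show ?case using True elim by (simp add: s_def)
        qed
        then have "((\<lambda>lam. s lam t) \<longlongrightarrow> limit_laplace t) at_top"
          using load_laplace_limit[OF True, folded T_def] by (rule Lim_transform_eventually[rotated])
        then show ?thesis using True by simp
      next
        case False
        then have "s lam t = 0" for lam using elim by (simp add: s_def)
        then show ?thesis using False elim by simp
      qed
    qed
  qed
  have lm: "(\<lambda>t. indicator {0..} t * limit_laplace t) \<in> borel_measurable lborel" by measurable
  have lim: "((\<lambda>lam. integral\<^sup>L lborel (s lam)) \<longlongrightarrow> (\<integral>t. indicator {0..} t * limit_laplace t \<partial>lborel)) at_top"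
    by (rule integral_dominated_convergence_at_top[OF lm sm iw slim sdom])
  have il: "integrable lborel (\<lambda>t. indicator {0..} t * limit_laplace t)"
    by (rule integrable_dominated_convergence_at_top[OF lm sm iw slim sdom])
  have limit: "(\<integral>\<^sup>+t\<in>{0..}. ennreal (limit_laplace t) \<partial>lborel) = ennreal (\<integral>t. indicator {0..} t * limit_laplace t \<partial>lborel)"
    using il by (subst nn_integral_eq_integral[symmetric])
      (auto simp: limit_laplace_def intro!: nn_integral_cong split: split_indicator)
  have split: "\<forall>\<^sub>F lam in at_top. ennreal (integral\<^sup>L lborel (s lam)) + laplace_tail U lam = (\<integral>\<^sup>+t\<in>{0..}. ennreal (T lam t) \<partial>lborel)"
    using eventually_narrow_beam sdom
  proof eventually_elim
    case (elim lam)
    then have lam: "0 < lam" by simp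
    note [measurable] = Tm[OF lam]
    have b: "0 < b lam" using U pos lam by (simp add: b_def)
    have int_s: "integrable lborel (s lam)"
      using elim(2) by (intro Bochner_Integration.integrable_bound[OF iw]) (auto elim!: eventually_mono)
    have "ennreal (integral\<^sup>L lborel (s lam)) = (\<integral>\<^sup>+t. ennreal (s lam t) \<partial>lborel)"
      using T0 by (intro nn_integral_eq_integral[symmetric] int_s) (auto simp: s_def)
    then have "ennreal (integral\<^sup>L lborel (s lam)) + laplace_tail U lam
        = (\<integral>\<^sup>+t. ennreal (s lam t) + ennreal (T lam t) * indicator {b lam..} t \<partial>lborel)"
      unfolding laplace_tail_def T_def[symmetric] b_def[symmetric] by (simp add: nn_integral_add)
    also have "\<dots> = (\<integral>\<^sup>+t\<in>{0..}. ennreal (T lam t) \<partial>lborel)"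
      using lam b by (intro nn_integral_cong) (auto simp: s_def split: split_indicator)
    finally show ?case .
  qed
  have "((\<lambda>lam. ennreal (integral\<^sup>L lborel (s lam)) + laplace_tail U lam) \<longlongrightarrow> (\<integral>\<^sup>+t\<in>{0..}. ennreal (limit_laplace t) \<partial>lborel) + 0) at_top"
    unfolding limit by (intro tendsto_add tendsto_ennrealI lim U(2))
  from Lim_transform_eventually[OF this split] show ?thesis by (simp add: T_def)
qed

end

text \<open>Numerator and denominator are divided by the gain and by the relative path loss. The
  noise keeps the denominator positive, so inverses of products split in \<open>ennreal\<close> even
  where the interference is \<open>\<top>\<close>.\<close>

lemma SINR_eq_inverse_load:
  assumes L: "\<And>r. 0 \<le> r \<Longrightarrow> 0 \<le> L r" "0 < L 0" and pos: "0 < gmax" "0 < \<kappa>" "0 < \<sigma>"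
  shows "SINR L gmax (gmax / \<kappa>) bw \<sigma> x \<theta> h0 h g = ennreal (L 0 * h0) * inverse
    (((\<Sum>n. if n \<noteq> nearest x then (if \<bar>\<theta> n\<bar> \<le> bw / 2 then ennreal (L (norm (x n)) * h n) else ennreal (L (norm (x n)) * g n / \<kappa>)) else 0)
      + ennreal (\<sigma>\<^sup>2 / gmax)) / ennreal (L (norm (x (nearest x))) / L 0))"
proof -
  define I where "I = (\<Sum>n. if n \<noteq> nearest x then (if \<bar>\<theta> n\<bar> \<le> bw / 2 then ennreal (L (norm (x n)) * h n) else ennreal (L (norm (x n)) * g n / \<kappa>)) else 0)"
  define D where "D = I + ennreal (\<sigma>\<^sup>2 / gmax)"
  define r where "r = L (norm (x (nearest x)))"
  have r: "0 \<le> r" using L by (simp add: r_def)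
  have "main_lobe_interference L gmax bw x \<theta> h + side_lobe_interference L (gmax / \<kappa>) bw x \<theta> g
      = (\<Sum>n. (if n \<noteq> nearest x \<and> \<bar>\<theta> n\<bar> \<le> bw / 2 then ennreal (gmax * L (norm (x n)) * h n) else 0)
          + (if n \<noteq> nearest x \<and> \<not> \<bar>\<theta> n\<bar> \<le> bw / 2 then ennreal (gmax / \<kappa> * L (norm (x n)) * g n) else 0))"
    unfolding main_lobe_interference_def side_lobe_interference_def by (rule suminf_add) simp_all
  also have "\<dots> = (\<Sum>n. ennreal gmax * (if n \<noteq> nearest x then (if \<bar>\<theta> n\<bar> \<le> bw / 2 then ennreal (L (norm (x n)) * h n) else ennreal (L (norm (x n)) * g n / \<kappa>)) else 0))"
    using pos by (intro suminf_cong) (auto simp: mult_ac simp flip: ennreal_mult')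
  also have "\<dots> = ennreal gmax * I" unfolding I_def by (rule ennreal_suminf_cmult)
  finally have "main_lobe_interference L gmax bw x \<theta> h + side_lobe_interference L (gmax / \<kappa>) bw x \<theta> g = ennreal gmax * I" .
  moreover have "ennreal (\<sigma>\<^sup>2) = ennreal gmax * ennreal (\<sigma>\<^sup>2 / gmax)"
    using pos by (simp flip: ennreal_mult)
  ultimately have den: "main_lobe_interference L gmax bw x \<theta> h + side_lobe_interference L (gmax / \<kappa>) bw x \<theta> g + ennreal (\<sigma>\<^sup>2) = ennreal gmax * D"
    by (simp add: D_def distrib_left)
  have D0: "D \<noteq> 0" using pos by (simp add: D_def)
  have "SINR L gmax (gmax / \<kappa>) bw \<sigma> x \<theta> h0 h g = ennreal (r * gmax * h0) * inverse (ennreal gmax * D)"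
    unfolding SINR_def den r_def by (simp add: divide_ennreal_def)
  also have "inverse (ennreal gmax * D) = inverse (ennreal gmax) * inverse D"
    using pos D0 by (intro ennreal_inverse_mult') (auto simp: zero_less_iff_neq_zero)
  also have "ennreal (r * gmax * h0) = ennreal gmax * (ennreal r * ennreal h0)"
    using pos r ennreal_mult'[of gmax "r * h0"] ennreal_mult'[of r h0] by (simp add: mult_ac)
  also have "ennreal gmax * (ennreal r * ennreal h0) * (inverse (ennreal gmax) * inverse D) = ennreal r * ennreal h0 * inverse D"
  proof -
    have "ennreal gmax * inverse (ennreal gmax) = 1" using pos by (simp add: inverse_ennreal flip: ennreal_mult)
    then show ?thesis by (metis (no_types, opaque_lifting) mult.assoc mult.commute mult.right_neutral)
  qed
  also have "\<dots> = ennreal (L 0 * h0) * inverse (D / ennreal (r / L 0))"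
  proof (cases "r = 0")
    \<comment> \<open>Without any received signal the left side is 0; on the right D / 0 =
      \<open>\<top>\<close> has inverse 0.\<close>
    case True
    then show ?thesis using D0 by simp
  next
    case False
    then have r0: "0 < r" using r by simp
    have "inverse (D / ennreal (r / L 0)) = inverse (D * ennreal (L 0 / r))"
      using r0 L(2) by (simp add: divide_ennreal_def inverse_ennreal)
    also have "\<dots> = inverse D * ennreal (r / L 0)"
      using r0 L(2) D0 by (subst ennreal_inverse_mult') (auto simp: inverse_ennreal zero_less_iff_neq_zero)
    finally have "ennreal (L 0 * h0) * inverse (D / ennreal (r / L 0)) = (ennreal (L 0) * ennreal (r / L 0)) * ennreal h0 * inverse D"
      using L(2) ennreal_mult'[of "L 0" h0] by (simp add: mult_ac)
    also have "ennreal (L 0) * ennreal (r / L 0) = ennreal r" using r0 L(2) by (simp flip: ennreal_mult)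
    finally show ?thesis by simp
  qed
  finally show ?thesis by (simp add: D_def I_def r_def)
qed

section \<open>Closed form and bounds of the limiting mean\<close>

context massive_mimo
begin

abbreviation m :: real where
  "m \<equiv> mean_SINR_limit M L \<alpha> \<beta> \<zeta> (h 0)"

lemma main_defect_radial:
  assumes t: "0 \<le> t"
  shows "main_defect t = 2 * pi * (LBINT r:{0..}. (\<integral>\<omega>. 1 - exp (- (t * h 0 \<omega> * L r)) \<partial>M) * r)"
proof -
  note [measurable] = laplace_fading_measurable[OF fading(2)[of 0]] physically_feasible_measurable[OF L]
  define d where "d s = 1 - laplace (h 0) s" for s
  have [measurable]: "d \<in> borel_measurable borel" unfolding d_def[abs_def] by measurable
  have d0: "0 \<le> d s" if "0 \<le> s" for s using laplace_fading_bounds(1)[OF fading(2) that] by (simp add: d_def)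
  have inner: "(\<integral>\<omega>. 1 - exp (- (t * h 0 \<omega> * L r)) \<partial>M) = d (t * L r)" if "0 \<le> r" for r
    using integrable_exp_fading[OF fading(2), of "t * L r" 0] t L_bounds(1)[OF that] by (simp add: d_def prob_space mult_ac)
  \<comment> \<open>The inner indicator yields a Borel function although L is arbitrary on the
    negative axis.\<close>
  define e where "e r = indicator {0..} r * (d (t * (L r * indicator {0..} r)) * r)" for r
  have [measurable]: "e \<in> borel_measurable borel" unfolding e_def[abs_def] by measurable
  have e0: "0 \<le> e r" for r using d0 t L_bounds(1) by (simp add: e_def split: split_indicator)
  have "main_defect t = (\<integral>x. d (t * L (norm (x :: real^2))) \<partial>lborel)"
    by (simp add: main_defect_def d_def)
  also have "\<dots> = enn2real (\<integral>\<^sup>+x. ennreal (d (t * L (norm (x :: real^2)))) \<partial>lborel)"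
    using d0 t L_bounds(1) by (intro integral_eq_nn_integral) auto
  also have "(\<integral>\<^sup>+x. ennreal (d (t * L (norm (x :: real^2)))) \<partial>lborel)
      = (\<integral>\<^sup>+x. ennreal (d (t * (L (norm (x :: real^2)) * indicator {0..} (norm x)))) \<partial>lborel)"
    by simp
  also have "\<dots> = (\<integral>\<^sup>+r\<in>{0..}. ennreal (2 * pi * r) * ennreal (d (t * (L r * indicator {0..} r))) \<partial>lborel)"
    by (rule nn_integral_radial) measurable
  also have "\<dots> = (\<integral>\<^sup>+r. ennreal (2 * pi) * ennreal (e r) \<partial>lborel)"
    using d0 t L_bounds(1) by (intro nn_integral_cong) (auto simp: e_def mult_ac simp flip: ennreal_mult split: split_indicator)
  also have "\<dots> = ennreal (2 * pi) * (\<integral>\<^sup>+r. ennreal (e r) \<partial>lborel)"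
    by (intro nn_integral_cmult) measurable
  also have "enn2real \<dots> = 2 * pi * enn2real (\<integral>\<^sup>+r. ennreal (e r) \<partial>lborel)"
    by (simp add: enn2real_mult)
  also have "enn2real (\<integral>\<^sup>+r. ennreal (e r) \<partial>lborel) = (\<integral>r. e r \<partial>lborel)"
    using e0 by (intro integral_eq_nn_integral[symmetric]) auto
  also have "(\<integral>r. e r \<partial>lborel) = (LBINT r:{0..}. (\<integral>\<omega>. 1 - exp (- (t * h 0 \<omega> * L r)) \<partial>M) * r)"
    unfolding set_lebesgue_integral_def e_def
    by (intro Bochner_Integration.integral_cong) (auto simp: inner split: split_indicator)
  finally show ?thesis .
qed

lemma mean_SINR_limit_eq: "m = (LBINT t:{0..}. L 0 * limit_laplace t)"
  unfolding mean_SINR_limit_def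
proof (rule set_lebesgue_integral_cong, simp, intro allI impI)
  fix t :: real assume t: "t \<in> {0..}"
  have "2 * pi * path_loss_moment L * t / (\<alpha> * \<zeta>) = side_rate * t" by (simp add: side_rate_def)
  moreover have "\<beta> / \<zeta> * (LBINT r:{0..}. (\<integral>\<omega>. 1 - exp (- (t * h 0 \<omega> * L r)) \<partial>M) * r) = \<beta> / (2 * pi * \<zeta>) * main_defect t"
    using t by (simp add: main_defect_radial)
  ultimately show "L 0 * exp (- (2 * pi * path_loss_moment L * t / (\<alpha> * \<zeta>)) - \<beta> / \<zeta> * (LBINT r:{0..}. (\<integral>\<omega>. 1 - exp (- (t * h 0 \<omega> * L r)) \<partial>M) * r)) = L 0 * limit_laplace t"
    by (simp add: limit_laplace_def)
qed

text \<open>The upper exponential bound shows that the integral is finite, so the real integral in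
  \<open>mean_SINR_limit\<close> agrees with the \<open>ennreal\<close> one. Both bounds are then
  values 1 / c of integrals of exp (- c t).\<close>

lemma mean_SINR_limit_eq_nn_integral:
  "ennreal m = ennreal (L 0) * (\<integral>\<^sup>+t\<in>{0..}. ennreal (limit_laplace t) \<partial>lborel)"
    (is "?m = _ * ?I")
  and mean_SINR_limit_le: "m \<le> L 0 * \<alpha> * \<zeta> / (2 * pi * path_loss_moment L)"
  and mean_SINR_limit_ge: "L 0 * \<alpha> * \<zeta> / (path_loss_moment L * (2 * pi + \<alpha> * \<beta>)) \<le> m"
proof -
  let ?\<gamma> = "path_loss_moment L"
  have \<gamma>: "0 < ?\<gamma>" by (rule path_loss_moment_pos[OF L])
  have le: "?I \<le> ennreal (1 / side_rate)"
    unfolding nn_integral_exp_atLeast_0[OF side_rate_pos, symmetric]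
    by (intro nn_integral_mono) (auto intro!: ennreal_leI limit_laplace_bounds split: split_indicator)
  define c where "c = side_rate + \<beta> / \<zeta> * ?\<gamma>"
  have c: "0 < c" using side_rate_pos pos \<gamma> by (simp add: c_def add_pos_pos)
  have lower: "exp (- (c * t)) \<le> limit_laplace t" if "0 \<le> t" for t
    using limit_laplace_bounds(2)[OF that] by (simp only: c_def)
  have "ennreal (1 / c) = (\<integral>\<^sup>+t\<in>{0..}. ennreal (exp (- (c * t))) \<partial>lborel)"
    by (rule nn_integral_exp_atLeast_0[OF c, symmetric])
  also have "\<dots> \<le> ?I"
    by (intro nn_integral_mono) (auto intro!: ennreal_leI lower split: split_indicator)
  finally have ge: "ennreal (1 / c) \<le> ?I" .
  have lpos: "0 \<le> limit_laplace t" for t by (simp add: limit_laplace_def)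
  have "m = enn2real (\<integral>\<^sup>+t. ennreal (indicator {0..} t *\<^sub>R (L 0 * limit_laplace t)) \<partial>lborel)"
    unfolding mean_SINR_limit_eq set_lebesgue_integral_def using L_bounds(3)
    by (intro integral_eq_nn_integral) (auto simp: lpos less_imp_le)
  also have "(\<integral>\<^sup>+t. ennreal (indicator {0..} t *\<^sub>R (L 0 * limit_laplace t)) \<partial>lborel) = (\<integral>\<^sup>+t. ennreal (L 0) * (ennreal (limit_laplace t) * indicator {0..} t) \<partial>lborel)"
    using L_bounds(3) by (intro nn_integral_cong) (auto simp: ennreal_mult' split: split_indicator)
  also have "\<dots> = ennreal (L 0) * ?I"
    by (intro nn_integral_cmult) measurable
  finally have m: "m = enn2real (ennreal (L 0) * ?I)" .
  obtain i where i: "?I = ennreal i" "0 \<le> i" using le by (cases ?I) (auto simp: top_unique)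
  have mi: "m = L 0 * i"
    using i L_bounds(3) by (simp add: m enn2real_mult)
  show "?m = ennreal (L 0) * ?I" using i L_bounds(3) by (simp add: mi ennreal_mult)
  have "i \<le> 1 / side_rate" using le i side_rate_pos by simp
  then have "L 0 * i \<le> L 0 * (1 / side_rate)" using L_bounds(3) by (intro mult_left_mono) auto
  then show "m \<le> L 0 * \<alpha> * \<zeta> / (2 * pi * ?\<gamma>)"
    by (simp add: mi side_rate_def mult_ac)
  have "1 / c \<le> i" using ge i by simp
  then have "L 0 * (1 / c) \<le> L 0 * i" using L_bounds(3) by (intro mult_left_mono) auto
  moreover have "c = ?\<gamma> * (2 * pi + \<alpha> * \<beta>) / (\<alpha> * \<zeta>)"
    using pos by (simp add: c_def side_rate_def field_simps)
  ultimately show "L 0 * \<alpha> * \<zeta> / (?\<gamma> * (2 * pi + \<alpha> * \<beta>)) \<le> m"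
    by (simp add: mi mult_ac)
qed

end

section \<open>Convergence in distribution\<close>

text \<open>Weierstrass: F is uniformly close to a polynomial on [0, 1], and expectations of
  polynomials converge with the moments.\<close>

lemma (in prob_space) tendsto_expectation_of_moments:
  fixes U :: "nat \<Rightarrow> 'a \<Rightarrow> real" and V :: "'a \<Rightarrow> real"
  assumes U: "\<And>k. U k \<in> borel_measurable M" "\<And>k \<omega>. U k \<omega> \<in> {0..1}"
    and V: "V \<in> borel_measurable M" "\<And>\<omega>. V \<omega> \<in> {0..1}"
    and moments: "\<And>n. (\<lambda>k. expectation (\<lambda>\<omega>. U k \<omega> ^ n)) \<longlonglongrightarrow> expectation (\<lambda>\<omega>. V \<omega> ^ n)"
    and F: "continuous_on {0..1} F" "F \<in> borel_measurable borel"
  shows "(\<lambda>k. expectation (\<lambda>\<omega>. F (U k \<omega>) :: real)) \<longlonglongrightarrow> expectation (\<lambda>\<omega>. F (V \<omega>))"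
proof (rule LIMSEQ_I)
  fix e :: real assume e: "0 < e"
  obtain G where G: "real_polynomial_function G" "\<And>u. u \<in> {0..1} \<Longrightarrow> \<bar>F u - G u\<bar> < e / 3"
    using Stone_Weierstrass_real_polynomial_function[of "{0..1}" F "e / 3"] F(1) e by auto
  then obtain a N where Gs: "G = (\<lambda>u. \<Sum>i\<le>N. a i * u ^ i)"
    by (auto simp: real_polynomial_function_iff_sum)
  have [measurable]: "F \<in> borel_measurable borel" by (rule F)
  have pow: "integrable M (\<lambda>\<omega>. W \<omega> ^ n)" if [measurable]: "W \<in> borel_measurable M" and W: "\<And>\<omega>. W \<omega> \<in> {0..1}" for W :: "'a \<Rightarrow> real" and n
    using W by (intro integrable_const_bound[where B = 1]) (auto simp: power_le_one)
  obtain C where C: "\<forall>u\<in>{0..1}. \<bar>F u\<bar> \<le> C"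
    using compact_imp_bounded[OF compact_continuous_image[OF F(1) compact_Icc]] by (auto simp: bounded_iff)
  have EG: "expectation (\<lambda>\<omega>. G (W \<omega>)) = (\<Sum>i\<le>N. a i * expectation (\<lambda>\<omega>. W \<omega> ^ i))" and
    close: "\<bar>expectation (\<lambda>\<omega>. F (W \<omega>)) - expectation (\<lambda>\<omega>. G (W \<omega>))\<bar> \<le> e / 3"
    if [measurable]: "W \<in> borel_measurable M" and W: "\<And>\<omega>. W \<omega> \<in> {0..1}" for W :: "'a \<Rightarrow> real"
  proof -
    show "expectation (\<lambda>\<omega>. G (W \<omega>)) = (\<Sum>i\<le>N. a i * expectation (\<lambda>\<omega>. W \<omega> ^ i))"
      unfolding Gs using pow[OF that] by (subst Bochner_Integration.integral_sum) auto
    have iG: "integrable M (\<lambda>\<omega>. G (W \<omega>))"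
      unfolding Gs using pow[OF that] by (intro Bochner_Integration.integrable_sum integrable_mult_right)
    have iF: "integrable M (\<lambda>\<omega>. F (W \<omega>))"
      using C W by (intro integrable_const_bound[where B = C]) auto
    have "\<bar>expectation (\<lambda>\<omega>. F (W \<omega>)) - expectation (\<lambda>\<omega>. G (W \<omega>))\<bar> = \<bar>expectation (\<lambda>\<omega>. F (W \<omega>) - G (W \<omega>))\<bar>"
      using iF iG by simp
    also have "\<dots> \<le> expectation (\<lambda>\<omega>. \<bar>F (W \<omega>) - G (W \<omega>)\<bar>)" by (rule integral_abs_bound)
    also have "\<dots> \<le> e / 3"
      using iF iG G(2)[OF W] by (intro integral_le_const) (auto intro: less_imp_le)
    finally show "\<bar>expectation (\<lambda>\<omega>. F (W \<omega>)) - expectation (\<lambda>\<omega>. G (W \<omega>))\<bar> \<le> e / 3" .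
  qed
  have "(\<lambda>k. expectation (\<lambda>\<omega>. G (U k \<omega>))) \<longlonglongrightarrow> expectation (\<lambda>\<omega>. G (V \<omega>))"
    unfolding EG[OF U] EG[OF V] by (intro tendsto_intros moments)
  from LIMSEQ_D[OF this, of "e / 3"] e obtain K where K: "\<And>k. K \<le> k \<Longrightarrow> \<bar>expectation (\<lambda>\<omega>. G (U k \<omega>)) - expectation (\<lambda>\<omega>. G (V \<omega>))\<bar> < e / 3"
    by auto
  show "\<exists>K. \<forall>k\<ge>K. norm (expectation (\<lambda>\<omega>. F (U k \<omega>)) - expectation (\<lambda>\<omega>. F (V \<omega>))) < e"
  proof (intro exI allI impI)
    fix k assume "K \<le> k"
    from K[OF this] close[OF U, of k] close[OF V]
    show "norm (expectation (\<lambda>\<omega>. F (U k \<omega>)) - expectation (\<lambda>\<omega>. F (V \<omega>))) < e"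
      unfolding real_norm_def by linarith
  qed
qed

lemma nexp_power: "nexp z ^ n = nexp (ennreal (real n) * z)"
proof (induction n)
  case (Suc n)
  have "ennreal (real (Suc n)) * z = ennreal (real n) * z + z"
    by (simp add: distrib_right)
  then show ?case using Suc by (simp add: nexp_add mult.commute)
qed simp

text \<open>\<open>1 / z\<close> as a function of \<open>u = nexp z\<close>, truncated at \<open>z = \<delta>\<close> to be continuous up to \<open>u = 1\<close>;
  the value at \<open>u = 0\<close> belongs to \<open>z = \<infinity>\<close>.\<close>

definition recip_load :: "real \<Rightarrow> real \<Rightarrow> real" where
  "recip_load \<delta> u = (if u \<le> 0 then 0 else 1 / max (- ln u) \<delta>)"

lemma recip_load_measurable [measurable]: "recip_load \<delta> \<in> borel_measurable borel"
  unfolding recip_load_def[abs_def] by measurable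

lemma recip_load_nexp:
  assumes "0 < \<delta>" "ennreal \<delta> \<le> z"
  shows "recip_load \<delta> (nexp z) = enn2real (inverse z)"
proof (cases z)
  case (real r)
  then have "\<delta> \<le> r" "0 < r" using assms by auto
  then show ?thesis using real by (simp add: nexp_ennreal recip_load_def inverse_ennreal inverse_eq_divide max_def)
qed (simp add: recip_load_def)

lemma continuous_on_recip_load:
  assumes \<delta>: "0 < \<delta>"
  shows "continuous_on {0..1} (recip_load \<delta>)"
  unfolding continuous_on_eq_continuous_within
proof
  fix u :: real assume u: "u \<in> {0..1}"
  show "continuous (at u within {0..1}) (recip_load \<delta>)"
  proof (cases "u = 0")
    case True
    \<comment> \<open>Near u = 0 the quantity - ln u exceeds \<delta>, so the cut is inactive there
      and the limit is the prescribed value 0.\<close>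
    have "((\<lambda>u. - 1 / ln u) \<longlongrightarrow> 0) (at_right (0::real))"
      by (rule tendsto_divide_0[OF tendsto_const filterlim_at_bot_imp_at_infinity[OF ln_at_0]])
    moreover have "\<forall>\<^sub>F u in at_right 0. - 1 / ln u = recip_load \<delta> u"
    proof -
      have "\<forall>\<^sub>F u in at_right 0. 0 < u \<and> u < exp (- \<delta>)"
        unfolding eventually_at_right_field by (rule exI[of _ "exp (- \<delta>)"]) simp
      then show ?thesis
      proof eventually_elim
        case (elim u)
        then have "ln u < - \<delta>" using ln_less_cancel_iff[of u "exp (- \<delta>)"] by simp
        then show ?case using elim by (simp add: recip_load_def max_def)
      qed
    qed
    ultimately have "(recip_load \<delta> \<longlongrightarrow> 0) (at_right 0)" by (rule Lim_transform_eventually)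
    then show ?thesis unfolding True continuous_within
      by (simp add: at_within_Icc_at_right) (simp add: recip_load_def)
  next
    case False
    with u have u0: "0 < u" by simp
    have "isCont (\<lambda>u. 1 / max (- ln u) \<delta>) u"
      using \<delta> u0 by (intro continuous_intros) auto
    moreover have "\<forall>\<^sub>F v in nhds u. recip_load \<delta> v = 1 / max (- ln v) \<delta>"
      using eventually_nhds_in_open[of "{0<..}" u] u0 by (auto elim!: eventually_mono simp: recip_load_def)
    ultimately have "isCont (recip_load \<delta>) u" by (simp add: isCont_cong)
    then show ?thesis by (rule continuous_at_imp_continuous_at_within)
  qed
qed

lemma weak_conv_m_cong:
  assumes "\<forall>\<^sub>F k in sequentially. A k = B k" "weak_conv_m A P"
  shows "weak_conv_m B P"
  unfolding weak_conv_m_def weak_conv_def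
proof (intro allI impI)
  fix x assume "isCont (cdf P) x"
  then have "(\<lambda>k. cdf (A k) x) \<longlonglongrightarrow> cdf P x"
    using assms(2) by (simp add: weak_conv_m_def weak_conv_def)
  moreover have "\<forall>\<^sub>F k in sequentially. cdf (A k) x = cdf (B k) x"
    using assms(1) by eventually_elim simp
  ultimately show "(\<lambda>k. cdf (B k) x) \<longlonglongrightarrow> cdf P x" by (rule Lim_transform_eventually)
qed

section \<open>The limiting Poisson process and weak convergence of the SINR\<close>

locale massive_mimo_limit = massive_mimo M L Gmax \<alpha> \<beta> \<zeta> \<sigma> X \<theta> h0 h g
  for M :: "'a measure" and L Gmax \<alpha> \<beta> \<zeta> \<sigma> X \<theta> h0 h g +
  fixes \<Psi> :: "nat \<Rightarrow> 'a \<Rightarrow> real^2"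
  assumes \<Psi>: "homogeneous_PPP M (\<beta> / (2 * pi * \<zeta>)) \<Psi>" "independent_marks M \<Psi> (fading h0 h g)"
begin

definition limit_load :: "'a \<Rightarrow> ennreal" where
  "limit_load \<omega> = (\<Sum>n. ennreal (L (norm (\<Psi> n \<omega>)) * h n \<omega>)) + ennreal side_rate"

abbreviation SINR_law :: "('a \<Rightarrow> ennreal) \<Rightarrow> real measure" where
  "SINR_law Z \<equiv> distr M borel (\<lambda>\<omega>. enn2real (ennreal (L 0 * h0 \<omega>) * inverse (Z \<omega>)))"

lemma limit_load_measurable [measurable]: "limit_load \<in> borel_measurable M"
proof -
  note [measurable] = PPP_measurable[OF \<Psi>(1)]
  show ?thesis unfolding limit_load_def[abs_def] by measurable
qed

lemma limit_load_ge: "ennreal side_rate \<le> limit_load \<omega>"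
  by (simp add: limit_load_def)

text \<open>No station is left out here, so the Poisson functional gives an exact value. The side
  lobes enter as the constant \<open>side_rate\<close>.\<close>

lemma limit_load_laplace:
  assumes t: "0 \<le> t"
  shows "expectation (\<lambda>\<omega>. nexp (ennreal t * limit_load \<omega>)) = limit_laplace t"
proof -
  define Q where "Q n z = ennreal (t * L (norm (fst z)) * snd z (Towards n))" for n and z :: "(real^2) \<times> (link \<Rightarrow> real)"
  let ?Q = "\<lambda>\<omega>. \<Sum>n. Q n (\<Psi> n \<omega>, \<lambda>i\<in>{Towards n}. fading h0 h g i \<omega>)"
  have tL: "0 \<le> t * L (norm x)" for x :: "real^2" using t L_bounds by simp
  have [measurable]: "(\<lambda>z. snd z (Towards n)) \<in> borel_measurable ((borel :: (real^2) measure) \<Otimes>\<^sub>M Pi\<^sub>M {Towards n} (\<lambda>_. borel :: real measure))" for n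
    by (rule measurable_compose[OF measurable_snd measurable_component_singleton]) simp
  have \<rho>: "0 \<le> \<beta> / (2 * pi * \<zeta>)" using pos by simp
  have "expectation (\<lambda>\<omega>. nexp (?Q \<omega>))
      = nexp (ennreal (\<beta> / (2 * pi * \<zeta>)) * (\<integral>\<^sup>+x. ennreal (1 - laplace (h 0) (t * L (norm (x :: real^2)))) \<partial>lborel))"
  proof (rule marked_PPP_laplace(1)[OF \<Psi>(1) \<rho> \<Psi>(2)])
    show "disjoint_family (\<lambda>n. {Towards n})" by (auto simp: disjoint_family_on_def)
    show "Q n \<in> borel_measurable (borel \<Otimes>\<^sub>M Pi\<^sub>M {Towards n} (\<lambda>_. borel))" for n
      unfolding Q_def[abs_def] by measurable
    show "expectation (\<lambda>\<omega>. nexp (Q n (x, \<lambda>i\<in>{Towards n}. fading h0 h g i \<omega>))) = laplace (h 0) (t * L (norm x))" for n x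
    proof -
      have "expectation (\<lambda>\<omega>. nexp (Q n (x, \<lambda>i\<in>{Towards n}. fading h0 h g i \<omega>))) = laplace (h n) (t * L (norm x))"
        using nexp_fading[OF fading(2) tL] by (simp add: Q_def)
      also have "\<dots> = laplace (h 0) (t * L (norm x))"
        by (rule identically_distributed_expectation[OF identical(1)]) measurable
      finally show ?thesis .
    qed
  qed
  also have "(\<integral>\<^sup>+x. ennreal (1 - laplace (h 0) (t * L (norm (x :: real^2)))) \<partial>lborel) = ennreal (main_defect t)"
    unfolding main_defect_def using integrable_laplace_defect[OF fading(2) L t] laplace_fading_bounds(1)[OF fading(2) tL]
    by (intro nn_integral_eq_integral) auto
  also have "nexp (ennreal (\<beta> / (2 * pi * \<zeta>)) * ennreal (main_defect t)) = exp (- (\<beta> / (2 * pi * \<zeta>) * main_defect t))"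
    using \<rho> main_defect_nonneg[OF t] by (simp only: ennreal_mult[symmetric] nexp_ennreal mult_nonneg_nonneg)
  finally have E: "expectation (\<lambda>\<omega>. nexp (?Q \<omega>)) = exp (- (\<beta> / (2 * pi * \<zeta>) * main_defect t))" .
  have "nexp (ennreal t * limit_load \<omega>) = nexp (?Q \<omega>) * exp (- (side_rate * t))" for \<omega>
  proof -
    have "ennreal t * (\<Sum>n. ennreal (L (norm (\<Psi> n \<omega>)) * h n \<omega>)) = (\<Sum>n. ennreal t * ennreal (L (norm (\<Psi> n \<omega>)) * h n \<omega>))"
      by (rule ennreal_suminf_cmult[symmetric])
    also have "\<dots> = ?Q \<omega>"
      using t by (intro suminf_cong) (simp add: Q_def mult.assoc flip: ennreal_mult')
    moreover have "nexp (ennreal t * ennreal side_rate) = exp (- (side_rate * t))"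
      using t side_rate_pos by (subst ennreal_mult[symmetric]) (auto simp: nexp_ennreal mult.commute)
    ultimately show ?thesis by (simp add: limit_load_def distrib_left nexp_add)
  qed
  then show ?thesis
    by (simp add: E limit_laplace_def exp_add[symmetric])
qed

lemma limit_load_independent:
  "distr M borel h0 \<Otimes>\<^sub>M distr M borel limit_load = distr M (borel \<Otimes>\<^sub>M borel) (\<lambda>\<omega>. (h0 \<omega>, limit_load \<omega>))"
proof -
  define F where "F z = (\<Sum>n. ennreal (L (norm (fst z n)) * snd z (Towards n))) + ennreal side_rate"
    for z :: "(nat \<Rightarrow> real^2) \<times> (link \<Rightarrow> real)"
  have c [measurable]: "(\<lambda>z. snd z (Towards n)) \<in> borel_measurable (Pi\<^sub>M UNIV (\<lambda>_. borel :: (real^2) measure) \<Otimes>\<^sub>M Pi\<^sub>M (- {Desired}) (\<lambda>_. borel :: real measure))" for n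
    by (rule measurable_compose[OF measurable_snd measurable_component_singleton]) simp
  have "F \<in> borel_measurable (Pi\<^sub>M UNIV (\<lambda>_. borel) \<Otimes>\<^sub>M Pi\<^sub>M (- {Desired}) (\<lambda>_. borel))"
    unfolding F_def[abs_def] by measurable
  from marks_indep_rest[OF \<Psi>(2) PPP_measurable[OF \<Psi>(1)] this]
  show ?thesis by (simp add: F_def limit_load_def[abs_def])
qed

text \<open>A Chernoff bound. With \<delta> = \<open>side_rate\<close> / 2, the limit of exp
  (\<delta> t) times the transform at t is at most exp (- \<delta> t), because
  \<open>limit_laplace\<close> decays at rate at least 2 \<delta>; then t is chosen large.\<close>

lemma load_small_limit:
  assumes \<Lambda>: "filterlim \<Lambda> at_top sequentially" "\<And>k. 0 < \<Lambda> k"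
  shows "(\<lambda>k. prob {\<omega> \<in> space M. load (\<Lambda> k) \<omega> < ennreal (side_rate / 2)}) \<longlonglongrightarrow> 0"
proof (rule tendstoI)
  fix e :: real assume e: "0 < e"
  let ?\<delta> = "side_rate / 2"
  have "((\<lambda>t. exp (- (d * t))) \<longlongrightarrow> 0) at_top" if "0 < d" for d :: real using that by real_asymp
  from this[of ?\<delta>] have "((\<lambda>t. exp (- (?\<delta> * t))) \<longlongrightarrow> 0) at_top" using side_rate_pos by simp
  then have "\<forall>\<^sub>F t in at_top. exp (- (?\<delta> * t)) < e" using e by (intro order_tendstoD(2)) auto
  from eventually_happens[OF eventually_conj[OF this eventually_gt_at_top[of 0]]]
  obtain t where t: "exp (- (?\<delta> * t)) < e" "0 < t" by auto
  have "((\<lambda>k. exp (?\<delta> * t) * load_laplace (\<Lambda> k) t) \<longlonglongrightarrow> exp (?\<delta> * t) * limit_laplace t)"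
    using filterlim_compose[OF load_laplace_limit[OF t(2)] \<Lambda>(1)] by (intro tendsto_mult tendsto_const)
  moreover have "exp (?\<delta> * t) * limit_laplace t < e"
  proof -
    have "exp (?\<delta> * t) * limit_laplace t \<le> exp (?\<delta> * t) * exp (- (side_rate * t))"
      using limit_laplace_bounds(1)[of t] t by (intro mult_left_mono) auto
    also have "\<dots> = exp (- (?\<delta> * t))" by (simp add: exp_add[symmetric])
    finally show ?thesis using t(1) by simp
  qed
  ultimately have "\<forall>\<^sub>F k in sequentially. exp (?\<delta> * t) * load_laplace (\<Lambda> k) t < e"
    by (rule order_tendstoD(2))
  then show "\<forall>\<^sub>F k in sequentially. dist (prob {\<omega> \<in> space M. load (\<Lambda> k) \<omega> < ennreal ?\<delta>}) 0 < e"
  proof eventually_elim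
    case (elim k)
    note [measurable] = network_measurable[OF \<Lambda>(2)[of k]]
    let ?A = "{\<omega> \<in> space M. load (\<Lambda> k) \<omega> < ennreal ?\<delta>}"
    have "prob ?A = expectation (indicator ?A)" by simp
    also have "\<dots> \<le> expectation (\<lambda>\<omega>. exp (?\<delta> * t) * nexp (ennreal t * load (\<Lambda> k) \<omega>))"
    proof (rule integral_mono)
      fix \<omega>
      have "1 \<le> exp (?\<delta> * t) * nexp (ennreal t * load (\<Lambda> k) \<omega>)" if "load (\<Lambda> k) \<omega> < ennreal ?\<delta>"
      proof -
        have "nexp (ennreal t * ennreal ?\<delta>) \<le> nexp (ennreal t * load (\<Lambda> k) \<omega>)"
          using that by (intro nexp_mono mult_left_mono) auto
        moreover have "nexp (ennreal t * ennreal ?\<delta>) = exp (- (?\<delta> * t))"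
          using t side_rate_pos by (subst ennreal_mult[symmetric]) (auto simp: nexp_ennreal mult.commute)
        ultimately have "exp (?\<delta> * t) * exp (- (?\<delta> * t)) \<le> exp (?\<delta> * t) * nexp (ennreal t * load (\<Lambda> k) \<omega>)"
          by (intro mult_left_mono) auto
        then show ?thesis by (simp add: exp_add[symmetric])
      qed
      then show "indicator ?A \<omega> \<le> exp (?\<delta> * t) * nexp (ennreal t * load (\<Lambda> k) \<omega>)"
        by (auto split: split_indicator)
    qed (auto intro!: integrable_mult_right integrable_const_bound[where B = 1])
    also have "\<dots> < e" using elim by simp
    finally show ?case by simp
  qed
qed

text \<open>b stands for a frozen desired signal. As 1 / z is unbounded near 0 it is cut at
  \<open>side_rate\<close> / 2: the limiting load never falls below this level, and the load does so
  with vanishing probability.\<close>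

lemma expectation_recip_load_limit:
  fixes f :: "real \<Rightarrow> real"
  assumes \<Lambda>: "filterlim \<Lambda> at_top sequentially" "\<And>k. 0 < \<Lambda> k"
    and f: "continuous_on UNIV f" "\<And>x. 0 \<le> f x" "\<And>x. f x \<le> 1"
  shows "(\<lambda>k. expectation (\<lambda>\<omega>. f (b * enn2real (inverse (load (\<Lambda> k) \<omega>))))) \<longlonglongrightarrow> expectation (\<lambda>\<omega>. f (b * enn2real (inverse (limit_load \<omega>))))"
proof -
  let ?\<delta> = "side_rate / 2" and ?f = "\<lambda>z. f (b * enn2real (inverse z))"
  have \<delta>: "0 < ?\<delta>" using side_rate_pos by simp
  have [measurable]: "f \<in> borel_measurable borel" using f(1) by (rule borel_measurable_continuous_onI)
  note [measurable] = network_measurable[OF \<Lambda>(2)]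
  define F where "F u = f (b * recip_load ?\<delta> u)" for u
  have Fm [measurable]: "F \<in> borel_measurable borel" unfolding F_def[abs_def] by measurable
  have Fc: "continuous_on {0..1} F"
    unfolding F_def by (intro continuous_on_compose2[OF f(1)] continuous_intros continuous_on_recip_load[OF \<delta>]) auto
  have main: "(\<lambda>k. expectation (\<lambda>\<omega>. F (nexp (load (\<Lambda> k) \<omega>)))) \<longlonglongrightarrow> expectation (\<lambda>\<omega>. F (nexp (limit_load \<omega>)))"
  proof (rule tendsto_expectation_of_moments[where U = "\<lambda>k \<omega>. nexp (load (\<Lambda> k) \<omega>)" and V = "\<lambda>\<omega>. nexp (limit_load \<omega>)"])
    fix n
    show "(\<lambda>k. expectation (\<lambda>\<omega>. nexp (load (\<Lambda> k) \<omega>) ^ n)) \<longlonglongrightarrow> expectation (\<lambda>\<omega>. nexp (limit_load \<omega>) ^ n)"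
    proof (cases "n = 0")
      case False
      then have "0 < real n" by simp
      from filterlim_compose[OF load_laplace_limit[OF this] \<Lambda>(1)]
      show ?thesis by (simp add: nexp_power limit_load_laplace)
    qed simp
  qed (auto intro: Fc)
  have lim_eq: "F (nexp (limit_load \<omega>)) = ?f (limit_load \<omega>)" for \<omega>
  proof -
    have "ennreal ?\<delta> \<le> limit_load \<omega>"
      using order_trans[OF _ limit_load_ge[of \<omega>], of "ennreal ?\<delta>"] side_rate_pos by (simp add: ennreal_leI)
    then show ?thesis using recip_load_nexp[OF \<delta>] by (simp add: F_def)
  qed
  let ?A = "\<lambda>k. {\<omega> \<in> space M. load (\<Lambda> k) \<omega> < ennreal ?\<delta>}"
  have diff: "\<bar>expectation (\<lambda>\<omega>. ?f (load (\<Lambda> k) \<omega>)) - expectation (\<lambda>\<omega>. F (nexp (load (\<Lambda> k) \<omega>)))\<bar> \<le> prob (?A k)" for k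
  proof -
    have i: "integrable M (\<lambda>\<omega>. ?f (load (\<Lambda> k) \<omega>))" "integrable M (\<lambda>\<omega>. F (nexp (load (\<Lambda> k) \<omega>)))"
      using f(2,3) by (auto intro!: integrable_const_bound[where B = 1] simp: F_def)
    have "\<bar>expectation (\<lambda>\<omega>. ?f (load (\<Lambda> k) \<omega>)) - expectation (\<lambda>\<omega>. F (nexp (load (\<Lambda> k) \<omega>)))\<bar>
        = \<bar>expectation (\<lambda>\<omega>. ?f (load (\<Lambda> k) \<omega>) - F (nexp (load (\<Lambda> k) \<omega>)))\<bar>"
      using i by simp
    also have "\<dots> \<le> expectation (\<lambda>\<omega>. \<bar>?f (load (\<Lambda> k) \<omega>) - F (nexp (load (\<Lambda> k) \<omega>))\<bar>)"
      by (rule integral_abs_bound)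
    also have "\<dots> \<le> expectation (indicator (?A k))"
    proof (rule integral_mono)
      fix \<omega> assume \<omega>: "\<omega> \<in> space M"
      show "\<bar>?f (load (\<Lambda> k) \<omega>) - F (nexp (load (\<Lambda> k) \<omega>))\<bar> \<le> indicator (?A k) \<omega>"
      proof (cases "ennreal ?\<delta> \<le> load (\<Lambda> k) \<omega>")
        case True
        then show ?thesis using recip_load_nexp[OF \<delta>] by (simp add: F_def)
      next
        case False
        have "\<bar>f x - f y\<bar> \<le> 1" for x y using f(2)[of x] f(2)[of y] f(3)[of x] f(3)[of y] by linarith
        then show ?thesis using False \<omega> by (simp add: F_def not_le)
      qed
    qed (use i in \<open>auto intro!: integrable_const_bound[where B = 1]\<close>)
    also have "\<dots> = prob (?A k)" by simp
    finally show ?thesis .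
  qed
  have "(\<lambda>k. expectation (\<lambda>\<omega>. ?f (load (\<Lambda> k) \<omega>)) - expectation (\<lambda>\<omega>. F (nexp (load (\<Lambda> k) \<omega>)))) \<longlonglongrightarrow> 0"
    by (rule Lim_null_comparison[OF _ load_small_limit[OF \<Lambda>]]) (auto intro!: always_eventually diff)
  from tendsto_add[OF this main] show ?thesis by (simp add: lim_eq)
qed

text \<open>Independence allows \<open>h0\<close> to be fixed first: for each of its values the
  expectation over the load converges, and dominated convergence then integrates over
  \<open>h0\<close>. No joint convergence of signal and load has to be established.\<close>

lemma weak_convergence:
  assumes \<Lambda>: "filterlim \<Lambda> at_top sequentially"
  shows "weak_conv_m (\<lambda>k. SINR_law (load (\<Lambda> k)))
    (SINR_law limit_load)"
proof -
  \<comment> \<open>Finitely many terms of the sequence may fail to be positive, and nothing is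
    assumed of the network there; replacing them leaves the limit unchanged.\<close>
  define \<Lambda>' where "\<Lambda>' k = (if 0 < \<Lambda> k then \<Lambda> k else 1)" for k
  have ev: "\<forall>\<^sub>F k in sequentially. \<Lambda>' k = \<Lambda> k"
    using \<Lambda> by (auto simp: filterlim_at_top_dense \<Lambda>'_def elim!: eventually_mono)
  have \<Lambda>'0: "0 < \<Lambda>' k" for k by (simp add: \<Lambda>'_def)
  have \<Lambda>'1: "filterlim \<Lambda>' at_top sequentially"
    using filterlim_cong[OF refl refl ev] \<Lambda> by simp
  note [measurable] = network_measurable[OF \<Lambda>'0]
  have "weak_conv_m (\<lambda>k. SINR_law (load (\<Lambda>' k)))
    (SINR_law limit_load)"
  proof (rule integral_cts_step_conv_imp_weak_conv)
    show "real_distribution (SINR_law (load (\<Lambda>' k)))" for k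
      by (rule real_distribution_distr) measurable
    show "real_distribution (SINR_law limit_load)"
      by (rule real_distribution_distr) measurable
    fix x y :: real assume xy: "x < y"
    define f where "f = cts_step x y"
    have f: "continuous_on UNIV f" "\<And>z. 0 \<le> f z" "\<And>z. f z \<le> 1"
      unfolding f_def using xy uniformly_continuous_imp_continuous[OF cts_step_uniformly_continuous[OF xy]]
      by (simp_all add: cts_step_def divide_simps)
    have [measurable]: "f \<in> borel_measurable borel" using f(1) by (rule borel_measurable_continuous_onI)
    define b where "b \<omega> = enn2real (ennreal (L 0 * h0 \<omega>))" for \<omega>
    let ?G = "\<lambda>Z \<omega>. expectation (\<lambda>\<omega>'. f (b \<omega> * enn2real (inverse (Z \<omega>'))))"
    have split: "expectation (\<lambda>\<omega>. f (enn2real (ennreal (L 0 * h0 \<omega>) * inverse (Z \<omega>))))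
        = expectation (\<lambda>\<omega>. ?G Z \<omega>)"
      if [measurable]: "Z \<in> borel_measurable M"
        and ind: "distr M borel h0 \<Otimes>\<^sub>M distr M borel Z = distr M (borel \<Otimes>\<^sub>M borel) (\<lambda>\<omega>. (h0 \<omega>, Z \<omega>))" for Z
    proof -
      have i: "integrable M (\<lambda>\<omega>. f (F \<omega>))" if [measurable]: "F \<in> borel_measurable M" for F
        using f by (intro integrable_const_bound[where B = 1]) auto
      have [measurable]: "(\<lambda>\<omega>. ?G Z \<omega>) \<in> borel_measurable M"
        unfolding b_def by (rule borel_measurable_lebesgue_integral) measurable
      have E01: "0 \<le> ?G Z \<omega>" "?G Z \<omega> \<le> 1" for \<omega>
        using f by (auto intro!: Bochner_Integration.integral_nonneg integral_le_const i)
      have "ennreal (expectation (\<lambda>\<omega>. f (enn2real (ennreal (L 0 * h0 \<omega>) * inverse (Z \<omega>)))))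
          = (\<integral>\<^sup>+\<omega>. ennreal (f (enn2real (ennreal (L 0 * h0 \<omega>) * inverse (Z \<omega>)))) \<partial>M)"
        using f by (intro nn_integral_eq_integral[symmetric] i AE_I2) auto
      also have "\<dots> = (\<integral>\<^sup>+\<omega>. (\<integral>\<^sup>+\<omega>'. ennreal (f (enn2real (ennreal (L 0 * h0 \<omega>) * inverse (Z \<omega>')))) \<partial>M) \<partial>M)"
        by (rule nn_integral_distr_pair[OF _ _ ind, of "\<lambda>(a, z). ennreal (f (enn2real (ennreal (L 0 * a) * inverse z)))", simplified]) measurable
      also have "\<dots> = (\<integral>\<^sup>+\<omega>. ennreal (?G Z \<omega>) \<partial>M)"
        unfolding b_def enn2real_mult[symmetric] using f
        by (intro nn_integral_cong nn_integral_eq_integral i AE_I2) auto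
      also have "\<dots> = ennreal (expectation (\<lambda>\<omega>. ?G Z \<omega>))"
        using E01 by (intro nn_integral_eq_integral integrable_const_bound[where B = 1] AE_I2) auto
      finally show ?thesis using f E01 by (simp add: Bochner_Integration.integral_nonneg)
    qed
    have "(\<lambda>k. expectation (\<lambda>\<omega>. ?G (load (\<Lambda>' k)) \<omega>))
        \<longlonglongrightarrow> expectation (\<lambda>\<omega>. ?G limit_load \<omega>)"
    proof (rule integral_dominated_convergence[where w = "\<lambda>_. 1"])
      show "(\<lambda>\<omega>. ?G limit_load \<omega>) \<in> borel_measurable M"
        unfolding b_def by (rule borel_measurable_lebesgue_integral) measurable
      show "(\<lambda>\<omega>. ?G (load (\<Lambda>' k)) \<omega>) \<in> borel_measurable M" for k
        unfolding b_def by (rule borel_measurable_lebesgue_integral) measurable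
      show "AE \<omega> in M. (\<lambda>k. ?G (load (\<Lambda>' k)) \<omega>)
          \<longlonglongrightarrow> ?G limit_load \<omega>"
        by (intro AE_I2 expectation_recip_load_limit \<Lambda>'1 \<Lambda>'0 f)
      show "AE \<omega> in M. norm (?G (load (\<Lambda>' k)) \<omega>) \<le> 1" for k
      proof (rule AE_I2)
        fix \<omega>
        have "integrable M (\<lambda>\<omega>'. f (b \<omega> * enn2real (inverse (load (\<Lambda>' k) \<omega>'))))"
          using f by (intro integrable_const_bound[where B = 1]) auto
        then have "?G (load (\<Lambda>' k)) \<omega> \<le> 1"
          using f by (intro integral_le_const) auto
        moreover have "0 \<le> ?G (load (\<Lambda>' k)) \<omega>"
          using f by (intro Bochner_Integration.integral_nonneg) auto
        ultimately show "norm (?G (load (\<Lambda>' k)) \<omega>) \<le> 1" by simp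
      qed
    qed simp
    then have "(\<lambda>k. expectation (\<lambda>\<omega>. f (enn2real (ennreal (L 0 * h0 \<omega>) * inverse (load (\<Lambda>' k) \<omega>)))))
        \<longlonglongrightarrow> expectation (\<lambda>\<omega>. f (enn2real (ennreal (L 0 * h0 \<omega>) * inverse (limit_load \<omega>))))"
      by (simp add: split load_independent[OF \<Lambda>'0] limit_load_independent)
    then show "(\<lambda>k. integral\<^sup>L (SINR_law (load (\<Lambda>' k))) (cts_step x y))
        \<longlonglongrightarrow> integral\<^sup>L (SINR_law limit_load) (cts_step x y)"
      unfolding f_def[symmetric] by (simp add: integral_distr)
  qed
  moreover have "\<forall>\<^sub>F k in sequentially. SINR_law (load (\<Lambda>' k))
      = SINR_law (load (\<Lambda> k))"
    using ev by eventually_elim simp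
  ultimately show ?thesis by (rule weak_conv_m_cong[rotated])
qed

end

theorem theorem1:
  fixes M :: "'a measure"
    and L Gmax Gmin B :: "real \<Rightarrow> real"
    and \<alpha> \<beta> \<zeta> \<sigma> :: real
    and X :: "real \<Rightarrow> nat \<Rightarrow> 'a \<Rightarrow> real^2"
    and \<theta> :: "real \<Rightarrow> nat \<Rightarrow> 'a \<Rightarrow> real"
    and \<Psi> :: "nat \<Rightarrow> 'a \<Rightarrow> real^2"
    and h0 :: "'a \<Rightarrow> real"
    and h g :: "nat \<Rightarrow> 'a \<Rightarrow> real"
  defines "S \<equiv> \<lambda>lam \<omega>. SINR L (Gmax (\<zeta> * lam)) (Gmin (\<zeta> * lam)) (B (\<zeta> * lam)) \<sigma>
                     (\<lambda>n. X lam n \<omega>) (\<lambda>n. \<theta> lam n \<omega>) (h0 \<omega>) (\<lambda>n. h n \<omega>) (\<lambda>n. g n \<omega>)"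
    and "S_lim \<equiv> \<lambda>\<omega>. limit_SINR L \<alpha> \<zeta> (\<lambda>n. \<Psi> n \<omega>) (h0 \<omega>) (\<lambda>n. h n \<omega>)"
    and "\<gamma> \<equiv> path_loss_moment L"
    and "m \<equiv> mean_SINR_limit M L \<alpha> \<beta> \<zeta> (h 0)"
  assumes "prob_space M"
    and "\<alpha> > 0" and "\<beta> > 0" and "\<zeta> > 0" and "\<sigma> > 0"
    and "\<forall>N>0. 0 < Gmax N" and "mono_on {0<..} Gmax" and "filterlim Gmax at_top at_top"
    and "\<forall>N>0. Gmax N / Gmin N = \<alpha> * N"
    and "\<forall>N>0. B N = \<beta> / N"
    and "physically_feasible L"
    and "unit_mean_fading M h0"
    and "\<forall>n. unit_mean_fading M (h n)" and "identically_distributed M h"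
    and "\<forall>n. unit_mean_fading M (g n)" and "identically_distributed M g"
    and "\<forall>lam>0. cellular_network M lam (X lam) (\<theta> lam) h0 h g"
    and "homogeneous_PPP M (\<beta> / (2 * pi * \<zeta>)) \<Psi>"
    and "independent_marks M \<Psi> (fading h0 h g)"
  shows "(AE \<omega> in M. S_lim \<omega> < \<infinity>) \<and>
         (\<forall>\<Lambda> :: nat \<Rightarrow> real. filterlim \<Lambda> at_top sequentially \<longrightarrow>
            weak_conv_m (\<lambda>k. distr M borel (\<lambda>\<omega>. enn2real (S (\<Lambda> k) \<omega>)))
                        (distr M borel (\<lambda>\<omega>. enn2real (S_lim \<omega>)))) \<and>
         (gain_tail_condition Gmax L \<longrightarrow>
            ((\<lambda>lam. \<integral>\<^sup>+ \<omega>. S lam \<omega> \<partial>M) \<longlongrightarrow> ennreal m) at_top) \<and>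
         L 0 * \<alpha> * \<zeta> / (\<gamma> * (2 * pi + \<alpha> * \<beta>)) \<le> m \<and>
         m \<le> L 0 * \<alpha> * \<zeta> / (2 * pi * \<gamma>)"
proof -
  interpret prob_space M by fact
  interpret massive_mimo_limit M L Gmax \<alpha> \<beta> \<zeta> \<sigma> X \<theta> h0 h g \<Psi>
    using assms by unfold_locales auto
  have S: "S lam \<omega> = ennreal (L 0 * h0 \<omega>) * inverse (load lam \<omega>)" if lam: "0 < lam" for lam \<omega>
  proof -
    have N: "0 < \<zeta> * lam" using pos lam by simp
    have ratio: "Gmax (\<zeta> * lam) / Gmin (\<zeta> * lam) = \<alpha> * (\<zeta> * lam)" using assms(13) N by blast
    \<comment> \<open>By the convention x / 0 = 0 a vanishing side-lobe gain would make the ratio 0,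
      whereas it is positive.\<close>
    then have "Gmin (\<zeta> * lam) \<noteq> 0" using pos lam by auto
    with ratio have Gmin: "Gmin (\<zeta> * lam) = Gmax (\<zeta> * lam) / (\<alpha> * \<zeta> * lam)"
      using pos lam by (simp add: field_simps)
    have B: "B (\<zeta> * lam) = \<beta> / (\<zeta> * lam)" using assms(14) N by blast
    show ?thesis
      unfolding S_def Gmin B load_def interference_def attenuation_def noise_def
      using pos lam by (intro SINR_eq_inverse_load L_bounds Gmax_pos N) auto
  qed
  have S_lim: "S_lim \<omega> = ennreal (L 0 * h0 \<omega>) * inverse (limit_load \<omega>)" for \<omega>
    by (simp add: S_lim_def limit_SINR_def limit_load_def side_rate_def divide_ennreal_def)
  have "S_lim \<omega> < \<infinity>" for \<omega>
  proof -
    \<comment> \<open>The averaged side lobes alone keep the denominator away from 0, so finiteness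
      holds at every outcome.\<close>
    have "limit_load \<omega> \<noteq> 0" using limit_load_ge[of \<omega>] side_rate_pos by auto
    then show ?thesis by (auto simp: S_lim ennreal_mult_eq_top_iff less_top[symmetric])
  qed
  then have "AE \<omega> in M. S_lim \<omega> < \<infinity>" by simp
  moreover have "weak_conv_m (\<lambda>k. distr M borel (\<lambda>\<omega>. enn2real (S (\<Lambda> k) \<omega>))) (distr M borel (\<lambda>\<omega>. enn2real (S_lim \<omega>)))"
    if \<Lambda>: "filterlim \<Lambda> at_top sequentially" for \<Lambda>
  proof (rule weak_conv_m_cong)
    show "weak_conv_m (\<lambda>k. distr M borel (\<lambda>\<omega>. enn2real (ennreal (L 0 * h0 \<omega>) * inverse (load (\<Lambda> k) \<omega>)))) (distr M borel (\<lambda>\<omega>. enn2real (S_lim \<omega>)))"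
      unfolding S_lim by (rule weak_convergence[OF \<Lambda>])
    have "\<forall>\<^sub>F k in sequentially. 0 < \<Lambda> k" using \<Lambda> by (auto simp: filterlim_at_top_dense)
    then show "\<forall>\<^sub>F k in sequentially. distr M borel (\<lambda>\<omega>. enn2real (ennreal (L 0 * h0 \<omega>) * inverse (load (\<Lambda> k) \<omega>)))
        = distr M borel (\<lambda>\<omega>. enn2real (S (\<Lambda> k) \<omega>))"
      by eventually_elim (simp add: S)
  qed
  moreover have "((\<lambda>lam. \<integral>\<^sup>+ \<omega>. S lam \<omega> \<partial>M) \<longlongrightarrow> ennreal m) at_top" if "gain_tail_condition Gmax L"
  proof (rule Lim_transform_eventually)
    show "((\<lambda>lam. ennreal (L 0) * (\<integral>\<^sup>+t\<in>{0..}. ennreal (load_laplace lam t) \<partial>lborel)) \<longlongrightarrow> ennreal m) at_top"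
      unfolding m_def mean_SINR_limit_eq_nn_integral by (intro ennreal_tendsto_cmult mean_limit that) simp
    show "\<forall>\<^sub>F lam in at_top. ennreal (L 0) * (\<integral>\<^sup>+t\<in>{0..}. ennreal (load_laplace lam t) \<partial>lborel) = (\<integral>\<^sup>+ \<omega>. S lam \<omega> \<partial>M)"
      using eventually_gt_at_top[of 0] by eventually_elim (simp add: S mean_SINR_eq)
  qed
  ultimately show ?thesis
    using mean_SINR_limit_le mean_SINR_limit_ge by (simp add: m_def \<gamma>_def)
qed

end
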